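(* Let $n\ge2$, let $\sigma>0$ and let $K$ be a convex body in $\mathbb{R}^n$ such that $K\subset RB$ for some $R\ge 2^{15/2}\sigma$. Let $(u_i)$ be a sequence in $S^{n-1}$ with $\Delta_k=O(k^{-1/(n-1)})$. If $\hat P_k$ is an output from Algorithm NoisySupportLSQ (described in the context), run with the directions $u_1,\dots,u_k$ and noisy support function measurements of $K$, then, almost surely, there are constants $C_4=C_4(n,(u_i))$ and $N_4=N_4(\sigma,n,R,(u_i))$ such that $$\delta_2(K,\hat P_k)\le\begin{cases}C_4\,\sigma^{4/(n+3)}R^{(n-1)/(n+3)}k^{-2/(n+3)}, & \text{if } n=2,3,4,\\ C_4\,\sigma k^{-1/4}\log k, & \text{if } n=5,\\ C_4\,(R+(\sigma R)^{1/2})k^{-1/(n-1)}, & \text{if } n\ge6,\end{cases}$$ for $k\ge N_4$. Also, almost surely, there are constants $C_5=C_5(n,(u_i))$ and $N_5=N_5(\sigma,n,R,(u_i))$ such that $$\delta(K,\hat P_k)\le\begin{cases}C_5\,\sigma^{8/((n+1)(n+3))}R^{(n-1)(n+5)/((n+1)(n+3))}k^{-4/((n+1)(n+3))}, & \text{if } n=2,3,4,\\ C_5\,\sigma^{1/3}R^{2/3}k^{-1/12}(\log k)^{1/3}, & \text{if } n=5,\\ C_5\,(R+\sigma^{1/(n+1)}R^{n/(n+1)})k^{-2/(n^2-1)}, & \text{if } n\ge6,\end{cases}$$ for $k\ge N_5$.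
   Context: $B$ and $S^{n-1}$ are the unit ball and unit sphere in $\mathbb{R}^n$. A convex body is a compact convex set with nonempty interior. For a nonempty compact convex set $L$, $h_L(x)=\max\{x\cdot y:y\in L\}$ is its support function. $\delta(K,L)=\sup_{u\in S^{n-1}}|h_K(u)-h_L(u)|$ is the Hausdorff distance and $\delta_2(K,L)=\left(\int_{S^{n-1}}(h_K(u)-h_L(u))^2\,du\right)^{1/2}$ is the $L_2$ distance, integration being with respect to $(n-1)$-dimensional Hausdorff measure. $\Delta_k=\max_{u\in S^{n-1}}\min_{1\le i\le k}\|u-u_i\|$ is the spread of $u_1,\dots,u_k$. The notation $O(\cdot)$ is used in the sense of "less than a constant multiple depending only on $n$". Algorithm NoisySupportLSQ. Input: natural numbers $n\ge2$ and $k\ge n+1$; vectors $u_1,\dots,u_k\in S^{n-1}$ whose positive hull is $\mathbb{R}^n$ (true for all sufficiently large $k$ here, since $(u_i)$ is dense in $S^{n-1}$); noisy support function measurements $y_i=h_K(u_i)+X_i$, $i=1,\dots,k$, of an unknown convex body $K$ in $\mathbb{R}^n$, where the $X_i$'s are independent normal $N(0,\sigma^2)$ random variables. Nonnegative real numbers $h_1,\dots,h_k$ are called consistent if there is a compact convex set $L$ in $\mathbb{R}^n$ with $h_L(u_i)=h_i$, $i=1,\dots,k$. Let $\hat h_1,\dots,\hat h_k$ be a solution of the problem of minimizing $\sum_{i=1}^k(y_i-h_i)^2$ over $h_1,\dots,h_k$ subject to $h_1,\dots,h_k$ being consistent. The output is the polytope $\hat P_k=\bigcap_{i=1}^k\{x\in\mathbb{R}^n:x\cdot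 u_i\le\hat h_i\}$. A constant written as a function of certain data depends only on those data.
   Formalization: With nonnegative consistent numbers the claim fails if K does not contain the origin (the output always contains 0); it is proved for the algorithm as described when 0 is in K, and for arbitrary K when the numbers h_i in the algorithm may have any sign. *)

theory Defs
  imports "HOL-Probability.Probability"
begin

definition convex_body :: "'a::euclidean_space set \<Rightarrow> bool" where
  "convex_body K \<longleftrightarrow> compact K \<and> convex K \<and> interior K \<noteq> {}"

definition support_fun :: "'a::euclidean_space set \<Rightarrow> 'a \<Rightarrow> real" where
  "support_fun L x = (SUP y\<in>L. x \<bullet> y)"

(* Hausdorff measure, normalised by the volume of a ball of diameter d.  It is meant for s > 0:
   since 0 powr 0 = 0, the case s = 0 is not counting measure.  Boundedness of the covering sets is
   required separately because diameter is meaningful only for bounded sets. *)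

definition hausdorff_premeasure :: "real \<Rightarrow> real \<Rightarrow> 'a::metric_space set \<Rightarrow> ennreal" where
  "hausdorff_premeasure s d A =
     (INF U \<in> {U :: nat \<Rightarrow> 'a set. A \<subseteq> (\<Union>i. U i) \<and> (\<forall>i. bounded (U i) \<and> diameter (U i) \<le> d)}.
        \<Sum>i. ennreal (unit_ball_vol s * (diameter (U i) / 2) powr s))"

definition hausdorff_outer :: "real \<Rightarrow> 'a::metric_space set \<Rightarrow> ennreal" where
  "hausdorff_outer s A = (SUP d\<in>{0<..}. hausdorff_premeasure s d A)"

definition hausdorff_measure :: "real \<Rightarrow> 'a::metric_space measure" where
  "hausdorff_measure s = measure_of UNIV (sets borel) (hausdorff_outer s)"

lemma hausdorff_premeasure_mono:
  assumes "d \<le> d'" "A \<subseteq> B"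
  shows "hausdorff_premeasure s d' A \<le> hausdorff_premeasure s d B"
  unfolding hausdorff_premeasure_def
proof (rule INF_superset_mono)
  show "{U. B \<subseteq> (\<Union>i. U i) \<and> (\<forall>i. bounded (U i) \<and> diameter (U i) \<le> d)}
      \<subseteq> {U. A \<subseteq> (\<Union>i. U i) \<and> (\<forall>i. bounded (U i) \<and> diameter (U i) \<le> d')}"
    using assms by (blast intro: order_trans)
qed simp

lemma hausdorff_premeasure_le_outer:
  "0 < d \<Longrightarrow> hausdorff_premeasure s d A \<le> hausdorff_outer s A"
  unfolding hausdorff_outer_def by (rule SUP_upper) simp

lemma hausdorff_outer_mono: "A \<subseteq> B \<Longrightarrow> hausdorff_outer s A \<le> hausdorff_outer s B"
  unfolding hausdorff_outer_def by (intro SUP_mono) (auto intro: hausdorff_premeasure_mono)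

lemma hausdorff_outer_empty [simp]: "hausdorff_outer s {} = 0"
proof -
  have "hausdorff_premeasure s d ({} :: 'a set) \<le> 0" if "0 < d" for d
    unfolding hausdorff_premeasure_def by (rule INF_lower2[of "\<lambda>_. {}"]) (use that in auto)
  then show ?thesis unfolding hausdorff_outer_def by (simp add: SUP_eq_const)
qed

lemma hausdorff_outer_subadditive:
  fixes A :: "nat \<Rightarrow> 'a::metric_space set"
  shows "hausdorff_outer s (\<Union>i. A i) \<le> (\<Sum>i. hausdorff_outer s (A i))"
  unfolding hausdorff_outer_def[of s "\<Union>i. A i"]
proof (rule SUP_least)
  fix d :: real assume "d \<in> {0<..}"
  then have d: "0 < d" by simp
  let ?O = "\<lambda>X :: 'a set. hausdorff_premeasure s d X"
  let ?c = "\<lambda>X :: 'a set. ennreal (unit_ball_vol s * (diameter X / 2) powr s)"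
  have "?O (\<Union>i. A i) \<le> (\<Sum>n. ?O (A n))"
  proof (rule ennreal_le_epsilon)
    fix e :: real assume "0 < e" "(\<Sum>n. ?O (A n)) < top"
    then have *: "\<And>n. ?O (A n) < ?O (A n) + e * (1/2)^Suc n"
      by (auto simp add: less_top dest!: ennreal_suminf_lessD)
    have "\<exists>U. A n \<subseteq> (\<Union>i. U i) \<and> (\<forall>i. bounded (U i) \<and> diameter (U i) \<le> d) \<and>
              (\<Sum>i. ?c (U i)) < ?O (A n) + e * (1/2)^Suc n" for n
      using *[of n] unfolding hausdorff_premeasure_def[of s d "A n"] INF_less_iff by blast
    then obtain B where B: "\<And>n. A n \<subseteq> (\<Union>i. B n i)"
      "\<And>n i. bounded (B n i) \<and> diameter (B n i) \<le> d"
      "\<And>n. (\<Sum>i. ?c (B n i)) < ?O (A n) + e * (1/2)^Suc n"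
      by metis
    define C where "C = case_prod B o prod_decode"
    have A_C: "(\<Union>i. A i) \<subseteq> (\<Union>i. C i)"
      using B(1) by (auto simp add: C_def subset_eq) (metis prod.case prod_encode_inverse)
    have "?O (\<Union>i. A i) \<le> (\<Sum>i. ?c (C i))"
      unfolding hausdorff_premeasure_def
      by (rule INF_lower) (use A_C B(2) in \<open>auto simp: C_def split_def\<close>)
    also have "\<dots> = (\<Sum>i. (\<lambda>p. ?c (case_prod B p)) (prod_decode i))"
      by (simp add: C_def)
    also have "\<dots> = (\<Sum>n. \<Sum>i. ?c (B n i))"
      by (rule suminf_ennreal_2dimen) simp
    also have "\<dots> \<le> (\<Sum>n. ?O (A n) + e * (1/2) ^ Suc n)"
      by (intro suminf_le allI less_imp_le[OF B(3)]) auto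
    also have "... = (\<Sum>n. ?O (A n)) + (\<Sum>n. ennreal e * ennreal ((1/2) ^ Suc n))"
      using \<open>0 < e\<close> by (subst suminf_add[symmetric])
                       (auto simp del: ennreal_suminf_cmult simp add: ennreal_mult[symmetric])
    also have "\<dots> = (\<Sum>n. ?O (A n)) + e"
      unfolding ennreal_suminf_cmult
      by (subst suminf_ennreal_eq[OF zero_le_power power_half_series]) auto
    finally show "?O (\<Union>i. A i) \<le> (\<Sum>n. ?O (A n)) + e" .
  qed
  also have "\<dots> \<le> (\<Sum>n. hausdorff_outer s (A n))"
    by (intro suminf_le hausdorff_premeasure_le_outer d) auto
  finally show "?O (\<Union>i. A i) \<le> (\<Sum>n. hausdorff_outer s (A n))" .
qed

lemma hausdorff_outer_Un_le:
  "hausdorff_outer s (A \<union> B) \<le> hausdorff_outer s A + hausdorff_outer s B"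
proof -
  let ?F = "\<lambda>i::nat. if i = 0 then A else if i = 1 then B else {}"
  have "A \<union> B = (\<Union>i. ?F i)" by (force split: if_splits)
  then have "hausdorff_outer s (A \<union> B) \<le> (\<Sum>i. hausdorff_outer s (?F i))"
    using hausdorff_outer_subadditive[of s ?F] by simp
  also have "\<dots> = (\<Sum>i\<in>{0,1}. hausdorff_outer s (?F i))"
    by (rule suminf_finite) auto
  finally show ?thesis by simp
qed

lemma hausdorff_premeasure_separated:
  fixes A B :: "'a::metric_space set"
  assumes "d < r" and sep: "\<And>x y. x \<in> A \<Longrightarrow> y \<in> B \<Longrightarrow> r \<le> dist x y" and "0 \<le> d"
  shows "hausdorff_premeasure s d A + hausdorff_premeasure s d B \<le> hausdorff_premeasure s d (A \<union> B)"
  unfolding hausdorff_premeasure_def[of s d "A \<union> B"]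
proof (rule INF_greatest, clarify)
  fix U :: "nat \<Rightarrow> 'a set"
  assume U: "A \<union> B \<subseteq> (\<Union>i. U i)" "\<forall>i. bounded (U i) \<and> diameter (U i) \<le> d"
  let ?c = "\<lambda>X :: 'a set. ennreal (unit_ball_vol s * (diameter X / 2) powr s)"
  define V where "V = (\<lambda>i. if U i \<inter> A = {} then {} else U i)"
  define W where "W = (\<lambda>i. if U i \<inter> B = {} then {} else U i)"
  have "hausdorff_premeasure s d A \<le> (\<Sum>i. ?c (V i))"
    unfolding hausdorff_premeasure_def
    by (rule INF_lower) (use U \<open>0 \<le> d\<close> in \<open>auto simp: V_def\<close>, blast)
  moreover have "hausdorff_premeasure s d B \<le> (\<Sum>i. ?c (W i))"
    unfolding hausdorff_premeasure_def
    by (rule INF_lower) (use U \<open>0 \<le> d\<close> in \<open>auto simp: W_def\<close>, blast)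
  moreover have "?c (V i) + ?c (W i) \<le> ?c (U i)" for i
  proof -
    have "U i \<inter> A = {} \<or> U i \<inter> B = {}"
    proof (rule ccontr)
      assume "\<not> ?thesis"
      then obtain x y where "x \<in> U i" "x \<in> A" "y \<in> U i" "y \<in> B" by blast
      then have "r \<le> diameter (U i)"
        using sep[of x y] diameter_bounded_bound[of "U i" x y] U(2) by auto
      moreover have "diameter (U i) \<le> d" using U(2) by blast
      ultimately show False using \<open>d < r\<close> by simp
    qed
    then show ?thesis by (auto simp: V_def W_def)
  qed
  ultimately have "hausdorff_premeasure s d A + hausdorff_premeasure s d B
      \<le> (\<Sum>i. ?c (V i)) + (\<Sum>i. ?c (W i))" by (intro add_mono)
  also have "\<dots> = (\<Sum>i. ?c (V i) + ?c (W i))" by (rule suminf_add) auto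
  also have "\<dots> \<le> (\<Sum>i. ?c (U i))"
    by (rule suminf_le) (use \<open>\<And>i. ?c (V i) + ?c (W i) \<le> ?c (U i)\<close> in auto)
  finally show "hausdorff_premeasure s d A + hausdorff_premeasure s d B \<le> (\<Sum>i. ?c (U i))" .
qed

lemma hausdorff_outer_separated:
  fixes A B :: "'a::metric_space set"
  assumes "0 < r" and sep: "\<And>x y. x \<in> A \<Longrightarrow> y \<in> B \<Longrightarrow> r \<le> dist x y"
  shows "hausdorff_outer s A + hausdorff_outer s B \<le> hausdorff_outer s (A \<union> B)"
proof -
  have *: "hausdorff_premeasure s d A + hausdorff_premeasure s d' B \<le> hausdorff_outer s (A \<union> B)"
    if "0 < d" "0 < d'" for d d'
  proof -
    define m where "m = min (min d d') (r / 2)"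
    have m: "0 < m" "m \<le> d" "m \<le> d'" "m < r" using that assms(1) by (auto simp: m_def)
    have "hausdorff_premeasure s d A + hausdorff_premeasure s d' B
        \<le> hausdorff_premeasure s m A + hausdorff_premeasure s m B"
      by (intro add_mono hausdorff_premeasure_mono m) auto
    also have "\<dots> \<le> hausdorff_premeasure s m (A \<union> B)"
      by (rule hausdorff_premeasure_separated[OF m(4) sep]) (use m in auto)
    also have "\<dots> \<le> hausdorff_outer s (A \<union> B)"
      by (rule hausdorff_premeasure_le_outer[OF m(1)])
    finally show ?thesis .
  qed
  have ne: "{0::real<..} \<noteq> {}" by simp
  have "hausdorff_premeasure s d A + hausdorff_outer s B \<le> hausdorff_outer s (A \<union> B)"
    if "0 < d" for d
    unfolding hausdorff_outer_def[of s B] ennreal_SUP_add_right[OF ne]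
    by (rule SUP_least) (use * that in auto)
  then show ?thesis
    unfolding hausdorff_outer_def[of s A] ennreal_SUP_add_left[OF ne, symmetric]
    by (auto intro: SUP_least)
qed

lemma hausdorff_outer_sum_separated:
  fixes R :: "nat \<Rightarrow> 'a::metric_space set"
  assumes sep: "\<And>k. \<exists>r>0. \<forall>j<k. \<forall>x\<in>R j. \<forall>y\<in>R k. r \<le> dist x y"
  shows "(\<Sum>k<N. hausdorff_outer s (R k)) \<le> hausdorff_outer s (\<Union>k<N. R k)"
proof (induction N)
  case 0
  then show ?case by simp
next
  case (Suc N)
  obtain r where r: "r > 0" "\<And>j x y. j < N \<Longrightarrow> x \<in> R j \<Longrightarrow> y \<in> R N \<Longrightarrow> r \<le> dist x y"
    using sep[of N] by blast
  have "(\<Sum>k<Suc N. hausdorff_outer s (R k))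
      \<le> hausdorff_outer s (\<Union>k<N. R k) + hausdorff_outer s (R N)"
    using Suc by (simp add: add_mono)
  also have "\<dots> \<le> hausdorff_outer s ((\<Union>k<N. R k) \<union> R N)"
    by (rule hausdorff_outer_separated[OF r(1)]) (use r(2) in auto)
  also have "(\<Union>k<N. R k) \<union> R N = (\<Union>k<Suc N. R k)"
    by (auto simp: lessThan_Suc)
  finally show ?case .
qed

lemma hausdorff_outer_closed_split:
  fixes C T :: "'a::metric_space set"
  assumes "closed C"
  shows "hausdorff_outer s (T \<inter> C) + hausdorff_outer s (T - C) \<le> hausdorff_outer s T"
proof (cases "C = {} \<or> hausdorff_outer s T = top")
  case True
  then show ?thesis by auto
next
  case False
  then have ne: "C \<noteq> {}" and fin: "hausdorff_outer s T < top" by (auto simp: less_top)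
  define S where "S = (\<lambda>n::nat. {x\<in>T. 1 / real (n + 1) \<le> infdist x C})"
  define R where "R = (\<lambda>n. S (Suc n) - S n)"
  define f where "f = (\<lambda>n. hausdorff_outer s (R n))"
  have subT: "R n \<subseteq> T" for n by (auto simp: R_def S_def)
  have sepR: "1 / real (i + 2) - 1 / real (i + 3) \<le> dist x y"
    if "i + 2 \<le> j" "x \<in> R i" "y \<in> R j" for i j x y
  proof -
    have "1 / real (i + 2) \<le> infdist x C" using that(2) by (auto simp: R_def S_def)
    moreover have "infdist y C < 1 / real (j + 1)" using that(3) by (auto simp: R_def S_def)
    moreover have "1 / real (j + 1) \<le> 1 / real (i + 3)" using that(1) by (intro divide_left_mono) auto
    moreover have "infdist x C \<le> infdist y C + dist x y" by (rule infdist_triangle)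
    ultimately show ?thesis by linarith
  qed
  have part: "(\<Sum>k<N. f (2 * k + b)) \<le> hausdorff_outer s T" for N b
  proof -
    have "(\<Sum>k<N. f (2 * k + b)) \<le> hausdorff_outer s (\<Union>k<N. R (2 * k + b))"
      unfolding f_def
    proof (rule hausdorff_outer_sum_separated)
      fix k
      define i where "i = 2 * k + b"
      show "\<exists>r>0. \<forall>j<k. \<forall>x\<in>R (2 * j + b). \<forall>y\<in>R (2 * k + b). r \<le> dist x y"
      proof (intro exI conjI allI impI ballI)
        have "1 / real (i + 3) < 1 / real (i + 2)" by (rule divide_strict_left_mono) auto
        then show "0 < 1 / real (i + 2) - 1 / real (i + 3)" by simp
        fix j x y assume *: "j < k" "x \<in> R (2 * j + b)" "y \<in> R (2 * k + b)"
        let ?m = "2 * j + b"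
        have "1 / real (i + 2) - 1 / real (i + 3) = 1 / (real (i + 2) * real (i + 3))"
          by (simp add: field_simps)
        also have "\<dots> \<le> 1 / (real (?m + 2) * real (?m + 3))"
          using * by (intro divide_left_mono mult_mono) (auto simp: i_def)
        also have "\<dots> = 1 / real (?m + 2) - 1 / real (?m + 3)"
          by (simp add: field_simps)
        also have "\<dots> \<le> dist x y"
          by (rule sepR[OF _ *(2,3)]) (use * in auto)
        finally show "1 / real (i + 2) - 1 / real (i + 3) \<le> dist x y" .
      qed
    qed
    also have "\<dots> \<le> hausdorff_outer s T"
      using subT by (intro hausdorff_outer_mono) auto
    finally show ?thesis .
  qed
  have "(\<Sum>k<N. f k) \<le> hausdorff_outer s T + hausdorff_outer s T" for N
  proof -
    have "(\<Sum>k<N. f k) \<le> (\<Sum>k<2 * N. f k)" by (rule sum_mono2) auto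
    also have "\<dots> = (\<Sum>k<N. f (2 * k + 0)) + (\<Sum>k<N. f (2 * k + 1))"
      by (induction N) (auto simp: algebra_simps)
    also have "\<dots> \<le> hausdorff_outer s T + hausdorff_outer s T"
      by (intro add_mono part)
    finally show ?thesis .
  qed
  then have "suminf f \<le> hausdorff_outer s T + hausdorff_outer s T"
    unfolding suminf_eq_SUP by (rule SUP_least)
  then have finf: "suminf f < top" using fin by (auto simp: ennreal_add_less_top le_less_trans)
  show ?thesis
  proof (rule ennreal_le_epsilon)
    fix e :: real assume e: "0 < e"
    have "\<exists>n. suminf f < (\<Sum>k<n. f k) + e"
    proof (rule ccontr)
      assume "\<not> ?thesis"
      then have "(SUP n. (\<Sum>k<n. f k) + ennreal e) \<le> suminf f"
        by (intro SUP_least) (simp add: not_less)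
      then have "suminf f + ennreal e \<le> suminf f + 0"
        by (simp add: suminf_eq_SUP ennreal_SUP_add_left)
      then have "ennreal e \<le> 0"
        using finf unfolding ennreal_add_left_cancel_le by auto
      then show False using e by simp
    qed
    then obtain n where n: "suminf f < (\<Sum>k<n. f k) + e" by blast
    have "(\<Sum>k. f (k + n)) + (\<Sum>k<n. f k) = suminf f"
      using suminf_offset[of f n] by (simp add: add.commute)
    with n have "(\<Sum>k<n. f k) + (\<Sum>k. f (k + n)) \<le> (\<Sum>k<n. f k) + e" by (simp add: add.commute)
    moreover have "(\<Sum>k<n. f k) \<noteq> top"
      using finf sum_le_suminf[of f "{..<n}"] by (metis finite_lessThan le_less_trans less_irrefl summableI zero_le)
    ultimately have tail: "(\<Sum>k. f (k + n)) \<le> e"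
      by (simp add: ennreal_add_left_cancel_le)
    have cover: "T - C \<subseteq> S n \<union> (\<Union>k. R (k + n))"
    proof
      fix x assume x: "x \<in> T - C"
      then have "0 < infdist x C" using infdist_pos_not_in_closed[OF assms ne] by auto
      then obtain m where "inverse (real (Suc m)) < infdist x C"
        using reals_Archimedean by blast
      then have ex: "x \<in> S m" using x by (auto simp: S_def inverse_eq_divide)
      show "x \<in> S n \<union> (\<Union>k. R (k + n))"
      proof (rule ccontr)
        assume not: "\<not> ?thesis"
        have "x \<notin> S (k + n)" for k
          by (induction k) (use not in \<open>auto simp: R_def\<close>)
        moreover have "1 / real (m + n + 1) \<le> 1 / real (m + 1)"
          by (intro divide_left_mono) auto
        then have "S m \<subseteq> S (m + n)"
          unfolding S_def by (blast intro: order_trans)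
        ultimately show False using ex by blast
      qed
    qed
    have "hausdorff_outer s (T - C) \<le> hausdorff_outer s (S n \<union> (\<Union>k. R (k + n)))"
      by (rule hausdorff_outer_mono[OF cover])
    also have "\<dots> \<le> hausdorff_outer s (S n) + hausdorff_outer s (\<Union>k. R (k + n))"
      by (rule hausdorff_outer_Un_le)
    also have "\<dots> \<le> hausdorff_outer s (S n) + (\<Sum>k. f (k + n))"
      unfolding f_def by (intro add_left_mono hausdorff_outer_subadditive)
    also have "\<dots> \<le> hausdorff_outer s (S n) + e"
      by (intro add_left_mono tail)
    finally have "hausdorff_outer s (T \<inter> C) + hausdorff_outer s (T - C)
        \<le> hausdorff_outer s (T \<inter> C) + hausdorff_outer s (S n) + e"
      by (simp add: add_left_mono add.assoc)
    also have "hausdorff_outer s (T \<inter> C) + hausdorff_outer s (S n)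
        \<le> hausdorff_outer s ((T \<inter> C) \<union> S n)"
    proof (rule hausdorff_outer_separated)
      show "0 < 1 / real (n + 1)" by simp
      fix x y assume "x \<in> T \<inter> C" "y \<in> S n"
      then show "1 / real (n + 1) \<le> dist x y"
        using infdist_le[of x C y] by (auto simp: S_def dist_commute)
    qed
    also have "\<dots> \<le> hausdorff_outer s T"
      by (rule hausdorff_outer_mono) (auto simp: S_def)
    finally show "hausdorff_outer s (T \<inter> C) + hausdorff_outer s (T - C) \<le> hausdorff_outer s T + e"
      by (simp add: add_right_mono)
  qed
qed

lemma measure_space_hausdorff_outer:
  "measure_space UNIV (sets (borel :: 'a::metric_space measure)) (hausdorff_outer s)"
proof -
  let ?L = "lambda_system UNIV (Pow UNIV) (hausdorff_outer s :: 'a set \<Rightarrow> ennreal)"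
  have oms: "outer_measure_space (Pow UNIV) (hausdorff_outer s :: 'a set \<Rightarrow> ennreal)"
    unfolding outer_measure_space_def positive_def increasing_def countably_subadditive_def
    by (auto intro: hausdorff_outer_mono hausdorff_outer_subadditive)
  have ms: "measure_space UNIV ?L (hausdorff_outer s)"
    by (rule sigma_algebra.caratheodory_lemma[OF sigma_algebra_Pow oms])
  then have sa: "sigma_algebra UNIV ?L" by (simp add: measure_space_def)
  have "Collect closed \<subseteq> ?L"
  proof
    fix C :: "'a set" assume "C \<in> Collect closed"
    then have "hausdorff_outer s (C \<inter> T) + hausdorff_outer s ((UNIV - C) \<inter> T) = hausdorff_outer s T"
      for T
    proof -
      have eq: "C \<inter> T = T \<inter> C" "(UNIV - C) \<inter> T = T - C" "T \<inter> C \<union> (T - C) = T" by auto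
      show ?thesis
        using hausdorff_outer_closed_split[of C s T] hausdorff_outer_Un_le[of s "T \<inter> C" "T - C"]
          \<open>C \<in> Collect closed\<close>
        unfolding eq by (intro antisym) auto
    qed
    then show "C \<in> ?L" by (simp add: lambda_system_def)
  qed
  then have "sets (borel :: 'a measure) \<subseteq> ?L"
    unfolding borel_eq_closed using sigma_algebra.sigma_sets_subset[OF sa] by simp
  then show ?thesis
    using measure_down[OF ms] sets.sigma_algebra_axioms[of "borel :: 'a measure"] by simp
qed

(* measure_of yields the zero measure unless the given set function is countably additive,
   which the following lemma excludes. *)
lemma emeasure_hausdorff_measure:
  fixes A :: "'a::metric_space set"
  assumes "A \<in> sets borel"
  shows "emeasure (hausdorff_measure s) A = hausdorff_outer s A"
proof -
  have "sigma_sets UNIV (sets borel) = sets (borel :: 'a measure)"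
    using sets.sigma_sets_eq[of "borel :: 'a measure"] by simp
  then show ?thesis
    using assms measure_space_hausdorff_outer[where 'a='a and s=s]
    by (simp add: hausdorff_measure_def emeasure_measure_of_conv)
qed

definition hausdorff_dist :: "'a::euclidean_space set \<Rightarrow> 'a set \<Rightarrow> real" where
  "hausdorff_dist K L = (SUP u\<in>sphere 0 1. \<bar>support_fun K u - support_fun L u\<bar>)"

definition l2_dist :: "'a::euclidean_space set \<Rightarrow> 'a set \<Rightarrow> real" where
  "l2_dist K L =
     sqrt (LINT u:sphere 0 1|hausdorff_measure (real DIM('a) - 1).
             (support_fun K u - support_fun L u)\<^sup>2)"

definition spread :: "(nat \<Rightarrow> 'a::euclidean_space) \<Rightarrow> nat \<Rightarrow> real" where
  "spread u k = (SUP v\<in>sphere 0 1. Min ((\<lambda>i. norm (v - u i)) ` {1..k}))"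

(* A is the set of values allowed for the h i: {0..} gives consistency of nonnegative numbers, UNIV
   the same notion without a restriction on the sign.  If K does not contain the origin, some
   support function values of K are negative and only the second notion admits them. *)
definition consistent ::
  "real set \<Rightarrow> nat \<Rightarrow> (nat \<Rightarrow> 'a::euclidean_space) \<Rightarrow> (nat \<Rightarrow> real) \<Rightarrow> bool" where
  "consistent A k u h \<longleftrightarrow>
     (\<forall>i\<in>{1..k}. h i \<in> A) \<and>
     (\<exists>L. L \<noteq> {} \<and> compact L \<and> convex L \<and> (\<forall>i\<in>{1..k}. support_fun L (u i) = h i))"

definition noisy_support_lsq_output ::
  "real set \<Rightarrow> nat \<Rightarrow> (nat \<Rightarrow> 'a::euclidean_space) \<Rightarrow> (nat \<Rightarrow> real) \<Rightarrow> 'a set \<Rightarrow> bool" where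
  "noisy_support_lsq_output A k u y P \<longleftrightarrow>
     2 \<le> DIM('a) \<and> DIM('a) + 1 \<le> k \<and> u ` {1..k} \<subseteq> sphere 0 1 \<and>
     convex_cone hull (u ` {1..k}) = UNIV \<and>
     (\<exists>h. consistent A k u h \<and>
          (\<forall>h'. consistent A k u h' \<longrightarrow> (\<Sum>i=1..k. (y i - h i)\<^sup>2) \<le> (\<Sum>i=1..k. (y i - h' i)\<^sup>2)) \<and>
          P = (\<Inter>i\<in>{1..k}. {x. x \<bullet> u i \<le> h i}))"

definition normal_noise :: "'w measure \<Rightarrow> real \<Rightarrow> (nat \<Rightarrow> 'w \<Rightarrow> real) \<Rightarrow> bool" where
  "normal_noise M \<sigma> X \<longleftrightarrow>
     prob_space M \<and>
     prob_space.indep_vars M (\<lambda>_. borel) X {1..} \<and>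
     (\<forall>i\<ge>1. distributed M lborel (X i) (normal_density 0 \<sigma>))"

end

theory Submission
  imports Defs "HOL-Real_Asymp.Real_Asymp"
begin

text \<open>
  Write \<open>d = n - 1\<close>, let \<open>h\<close> denote support functions, and let the empirical norm of a function on the
  sphere be its root mean square over \<open>u 1, \<dots>, u k\<close>.

  Since the body \<open>K\<close> competes in the minimization, the estimate \<open>P\<close> satisfies the basic inequality
  \<open>\<Sum>i. (h\<^sub>P - h\<^sub>K)\<^sup>2 \<le> 2 * (\<Sum>i. (h\<^sub>P - h\<^sub>K) * X\<^sub>i)\<close> (\<open>lsq_output_props\<close>), and its right-hand side has to be bounded
  uniformly over all pairs of bodies.  This is possible because the class of bodies is small: the bodies
  in the unit ball are covered by \<open>exp (B * 2 ^ (j * d))\<close> sup-norm balls of radius of order \<open>4 ^ - j\<close>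
  (\<open>convex_body_entropy\<close>, due to Bronshtein).  The proof given here replaces a body by its distance
  function on the sphere of radius 2.  This loses nothing for the sup norm
  (\<open>support_fun_diff_le_half_sqdist\<close>), and since the half squared distance is convex with a Lipschitz
  gradient, its values and gradients on a \<open>2 ^ - j\<close>-net determine it up to \<open>4 ^ - j\<close>.  Passing from one
  dyadic scale to the next costs a bounded number of choices at each point of the net, so no
  logarithmic factor arises.

  Gaussian tails and Borel-Cantelli show that, almost surely and for all large \<open>k\<close>, the noise is not
  aligned with any difference of two members of neighbouring nets (\<open>AE_eventually_noise_good\<close>).  This event
  does not refer to \<open>K\<close>, which is why the threshold for \<open>k\<close> can be chosen as a function of the noise alone.
  On it, chaining along the nets (\<open>chaining_bound\<close>) turns the basic inequality into a quadratic inequality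
  for the empirical norm of \<open>h\<^sub>P - h\<^sub>K\<close> (\<open>empirical_bound\<close>).  The error collected by the chain is a geometric sum with
  ratio \<open>2 powr (d / 2 - 2)\<close>, and the three cases of the theorem are those of a ratio below, equal to or
  above 1.

  It remains to pass from the measured directions to the sphere.  The bound for the spread makes the
  sphere a union of \<open>k\<close> caps of Hausdorff measure of order \<open>1 / k\<close>, which controls \<open>l2_dist\<close> by the
  empirical norm (\<open>l2_dist_le_empirical\<close>); and it puts at least a fixed multiple of \<open>k * r ^ d\<close> of the
  directions into each cap of radius \<open>r\<close> above the mesh size (\<open>cap_count\<close>), which gives the bound for the Hausdorff distance
  (\<open>support_diff_power_le\<close>) and the boundedness of \<open>P\<close>.  Both facts are volume estimates in \<open>n\<close>-space.
\<close>

section \<open>Packing and counting points on the unit sphere\<close>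


lemma card_packing_volume:
  fixes F :: "'a::euclidean_space set"
  assumes "finite F" "0 < e" "0 \<le> s" "F \<subseteq> cball p s"
    and sep: "\<And>x y. x \<in> F \<Longrightarrow> y \<in> F \<Longrightarrow> x \<noteq> y \<Longrightarrow> 2 * e \<le> dist x y"
  shows "real (card F) * e ^ DIM('a) \<le> (s + e) ^ DIM('a)"
proof -
  let ?w = "unit_ball_vol (real DIM('a))"
  have disj: "disjoint_family_on (\<lambda>x. ball x e) F"
    unfolding disjoint_family_on_def
  proof (intro ballI impI)
    fix x y assume "x \<in> F" "y \<in> F" "x \<noteq> y"
    then have "2 * e \<le> dist x y" by (rule sep)
    then have "e + e \<le> dist x y" by simp
    then show "ball x e \<inter> ball y e = {}" by (simp add: disjoint_ballI)
  qed
  have "real (card F) * (?w * e ^ DIM('a)) = (\<Sum>x\<in>F. measure lborel (ball x e))"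
    using assms(2) by (simp add: content_ball)
  also have "\<dots> = measure lborel (\<Union>x\<in>F. ball x e)"
    by (rule measure_finite_Union[symmetric]) (use assms disj emeasure_lborel_ball_finite in \<open>auto simp: top.not_eq_extremum\<close>)
  also have "\<dots> \<le> measure lborel (cball p (s + e))"
  proof (rule measure_mono_fmeasurable)
    show "(\<Union>x\<in>F. ball x e) \<subseteq> cball p (s + e)"
    proof
      fix y assume "y \<in> (\<Union>x\<in>F. ball x e)"
      then obtain x where "x \<in> F" "dist x y < e" by auto
      moreover have "dist p x \<le> s" using \<open>x \<in> F\<close> assms(4) by auto
      ultimately show "y \<in> cball p (s + e)" using dist_triangle[of p y x] by simp
    qed
  qed (use assms in \<open>auto intro: fmeasurable_compact\<close>)
  also have "\<dots> = ?w * (s + e) ^ DIM('a)"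
    using assms by (simp add: content_cball)
  finally have "?w * (real (card F) * e ^ DIM('a)) \<le> ?w * (s + e) ^ DIM('a)"
    by (simp add: mult_ac)
  then show ?thesis by (simp add: mult_le_cancel_left_pos)
qed

lemma card_covering_volume:
  fixes F :: "'a::euclidean_space set"
  assumes "finite F" "0 \<le> e" "0 \<le> s" "cball p s \<subseteq> (\<Union>x\<in>F. cball x e)"
  shows "s ^ DIM('a) \<le> real (card F) * e ^ DIM('a)"
proof -
  let ?w = "unit_ball_vol (real DIM('a))"
  have "?w * s ^ DIM('a) = measure lborel (cball p s)"
    using assms by (simp add: content_cball)
  also have "\<dots> \<le> measure lborel (\<Union>x\<in>F. cball x e)"
    by (rule measure_mono_fmeasurable) (use assms in \<open>auto intro!: fmeasurable.finite_UN fmeasurable_compact\<close>)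
  also have "\<dots> \<le> (\<Sum>x\<in>F. measure lborel (cball x e))"
    by (rule measure_UNION_le) (use assms in auto)
  also have "\<dots> = real (card F) * (?w * e ^ DIM('a))"
    using assms by (simp add: content_cball)
  finally have "?w * s ^ DIM('a) \<le> ?w * (real (card F) * e ^ DIM('a))"
    by (simp add: mult_ac)
  then show ?thesis by (simp add: mult_le_cancel_left_pos)
qed

lemma norm_diff_radial:
  fixes v w :: "'a::real_inner"
  assumes "norm v = 1" "norm w = 1"
  shows "(norm (s *\<^sub>R v - t *\<^sub>R w))\<^sup>2 = (s - t)\<^sup>2 + s * t * (norm (v - w))\<^sup>2"
proof -
  have "v \<bullet> v = 1" "w \<bullet> w = 1" using assms by (simp_all add: dot_square_norm)
  then show ?thesis
    unfolding power2_norm_eq_inner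
    by (simp add: inner_diff inner_commute power2_eq_square algebra_simps)
qed

text \<open>The packing is moved off the sphere: pushing a separated set radially inwards in steps of
  \<open>\<epsilon> / 2\<close> gives about \<open>r / \<epsilon>\<close> disjoint copies inside a ball of radius of order \<open>r\<close>, so that the volume
  bound in dimension \<open>n\<close> yields the exponent \<open>n - 1\<close>.\<close>

lemma card_sphere_packing:
  fixes S :: "'a::euclidean_space set"
  assumes fin: "finite S" and S: "S \<subseteq> sphere 0 1 \<inter> cball v r" and e: "0 < e" "e \<le> r" "r \<le> 2"
    and sep: "\<And>x y. x \<in> S \<Longrightarrow> y \<in> S \<Longrightarrow> x \<noteq> y \<Longrightarrow> e \<le> dist x y"
  shows "real (card S) \<le> 4 * 8 ^ DIM('a) * (r / e) ^ (DIM('a) - 1)"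
proof -
  define m where "m = nat \<lfloor>r / (4 * e)\<rfloor>"
  define \<tau> where "\<tau> = (\<lambda>j::nat. 1 - real j * e / 2)"
  define g where "g = (\<lambda>(j, w::'a). \<tau> j *\<^sub>R w)"
  define F where "F = g ` ({..m} \<times> S)"
  have q: "0 \<le> r / (4 * e)" using e by simp
  have m1: "real m \<le> r / (4 * e)" unfolding m_def using q by (simp add: of_nat_floor)
  have m2: "r / (4 * e) \<le> real (m + 1)" unfolding m_def using q by linarith
  have jm: "real j * e / 2 \<le> r / 8" if "j \<le> m" for j
  proof -
    have "real j \<le> r / (4 * e)" using that m1 by (meson of_nat_le_iff order_trans)
    then have "real j * e \<le> r / (4 * e) * e" using e by (intro mult_right_mono) auto
    then show ?thesis using e by (simp add: mult_ac)
  qed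
  have \<tau>: "3 / 4 \<le> \<tau> j" "\<tau> j \<le> 1" if "j \<le> m" for j
    using jm[OF that] e by (auto simp: \<tau>_def)
  have dist_g: "e / 2 \<le> dist (g (i, x)) (g (j, y))"
    if "i \<le> m" "j \<le> m" "x \<in> S" "y \<in> S" "(i, x) \<noteq> (j, y)" for i j x y
  proof -
    have nx: "norm x = 1" "norm y = 1" using that S by auto
    have eq: "(dist (g (i, x)) (g (j, y)))\<^sup>2 = (\<tau> i - \<tau> j)\<^sup>2 + \<tau> i * \<tau> j * (norm (x - y))\<^sup>2"
      unfolding g_def dist_norm using norm_diff_radial[OF nx] by simp
    have pos: "0 \<le> \<tau> i * \<tau> j" using \<tau>[OF that(1)] \<tau>[OF that(2)] by simp
    have "(e / 2)\<^sup>2 \<le> (dist (g (i, x)) (g (j, y)))\<^sup>2"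
    proof (cases "i = j")
      case True
      then have "e \<le> norm (x - y)" using that sep by (auto simp: dist_norm)
      then have "e\<^sup>2 \<le> (norm (x - y))\<^sup>2" using e by (intro power_mono) auto
      moreover have "(3/4) * (3/4) \<le> \<tau> i * \<tau> j"
        using \<tau>[OF that(1)] \<tau>[OF that(2)] by (intro mult_mono) auto
      ultimately have "(1/4) * e\<^sup>2 \<le> \<tau> i * \<tau> j * (norm (x - y))\<^sup>2"
        by (intro mult_mono) auto
      moreover have "0 \<le> (\<tau> i - \<tau> j)\<^sup>2" by simp
      moreover have "(e / 2)\<^sup>2 = (1/4) * e\<^sup>2" by (simp add: power_divide)
      ultimately show ?thesis unfolding eq by linarith
    next
      case False
      then have "1 \<le> \<bar>real j - real i\<bar>" by linarith
      then have "1\<^sup>2 \<le> \<bar>real j - real i\<bar>\<^sup>2" by (intro power_mono) auto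
      then have "1 \<le> (real j - real i)\<^sup>2" by simp
      moreover have "(\<tau> i - \<tau> j)\<^sup>2 = (e / 2)\<^sup>2 * (real j - real i)\<^sup>2"
        by (simp add: \<tau>_def power2_eq_square algebra_simps)
      ultimately have "(e / 2)\<^sup>2 \<le> (\<tau> i - \<tau> j)\<^sup>2" by (simp add: mult_le_cancel_left1)
      moreover have "0 \<le> \<tau> i * \<tau> j * (norm (x - y))\<^sup>2" using pos by simp
      ultimately show ?thesis unfolding eq by linarith
    qed
    then show ?thesis by (rule power2_le_imp_le) simp
  qed
  have inj: "inj_on g ({..m} \<times> S)"
  proof (rule inj_onI)
    fix p q assume *: "p \<in> {..m} \<times> S" "q \<in> {..m} \<times> S" "g p = g q"
    show "p = q"
    proof (rule ccontr)
      assume "p \<noteq> q"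
      then have "e / 2 \<le> dist (g p) (g q)"
        using dist_g[of "fst p" "fst q" "snd p" "snd q"] * by auto
      then show False using * e by simp
    qed
  qed
  have F_ball: "F \<subseteq> cball v (r + r / 4)"
  proof
    fix z assume "z \<in> F"
    then obtain j x where *: "j \<le> m" "x \<in> S" "z = \<tau> j *\<^sub>R x" by (auto simp: F_def g_def)
    have "norm (x - z) = \<bar>1 - \<tau> j\<bar> * norm x"
      unfolding *(3) by (metis norm_scaleR scaleR_left_diff_distrib scaleR_one)
    also have "\<dots> \<le> r / 8" using *(2) S jm[OF *(1)] e by (auto simp: \<tau>_def)
    finally have "dist x z \<le> r / 8" by (simp add: dist_norm)
    moreover have "dist v x \<le> r" using * S by auto
    ultimately show "z \<in> cball v (r + r / 4)" using dist_triangle[of v z x] e by simp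
  qed
  have "real (card F) * (e / 4) ^ DIM('a) \<le> (r + r / 4 + e / 4) ^ DIM('a)"
  proof (rule card_packing_volume[OF _ _ _ F_ball])
    show "finite F" using fin by (auto simp: F_def)
    fix p q assume "p \<in> F" "q \<in> F" "p \<noteq> q"
    then show "2 * (e / 4) \<le> dist p q" unfolding F_def using dist_g by force
  qed (use e in auto)
  also have "\<dots> \<le> (2 * r) ^ DIM('a)" using e by (intro power_mono) auto
  finally have "real (card F) \<le> (2 * r) ^ DIM('a) / (e / 4) ^ DIM('a)"
    using e by (simp add: pos_le_divide_eq)
  also have "\<dots> = 8 ^ DIM('a) * (r / e) ^ DIM('a)"
    unfolding power_divide[symmetric] power_mult_distrib[symmetric] using e
    by (intro arg_cong[where f = "\<lambda>x. x ^ DIM('a)"]) (simp add: field_simps)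
  also have "real (card F) = real (m + 1) * real (card S)"
    unfolding F_def by (subst card_image[OF inj]) (simp add: card_cartesian_product algebra_simps)
  finally have "real (m + 1) * real (card S) \<le> 8 ^ DIM('a) * (r / e) ^ DIM('a)" .
  then have "r / (4 * e) * real (card S) \<le> 8 ^ DIM('a) * (r / e) ^ DIM('a)"
    using m2 by (meson mult_right_mono of_nat_0_le_iff order_trans)
  also have "(r / e) ^ DIM('a) = (r / e) * (r / e) ^ (DIM('a) - 1)"
    by (metis DIM_positive Suc_diff_1 power_Suc)
  finally have "(r / e) * real (card S) \<le> 4 * (8 ^ DIM('a) * ((r / e) * (r / e) ^ (DIM('a) - 1)))"
    by simp
  also have "\<dots> = (r / e) * (4 * 8 ^ DIM('a) * (r / e) ^ (DIM('a) - 1))"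
    by (simp only: mult_ac)
  finally have "(r / e) * real (card S) \<le> (r / e) * (4 * 8 ^ DIM('a) * (r / e) ^ (DIM('a) - 1))" .
  moreover have "0 < r / e" using e by simp
  ultimately show ?thesis by (simp only: mult_le_cancel_left_pos)
qed

lemma sphere_net:
  fixes T :: "'a::euclidean_space set"
  assumes T: "T \<subseteq> sphere 0 1 \<inter> cball v r" and e: "0 < e" "e \<le> r" "r \<le> 2"
  obtains S where "finite S" "S \<subseteq> T" "T \<subseteq> (\<Union>x\<in>S. cball x e)"
    "real (card S) \<le> 4 * 8 ^ DIM('a) * (r / e) ^ (DIM('a) - 1)"
proof -
  define Q where "Q = (\<lambda>S. finite S \<and> S \<subseteq> T \<and> (\<forall>x\<in>S. \<forall>y\<in>S. x \<noteq> y \<longrightarrow> e \<le> dist x y))"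
  let ?b = "4 * 8 ^ DIM('a) * (r / e) ^ (DIM('a) - 1)"
  have bound: "real (card S) \<le> ?b" if "Q S" for S
    by (rule card_sphere_packing[OF _ _ e]) (use that T in \<open>auto simp: Q_def\<close>)
  have "Q {}" by (simp add: Q_def)
  moreover have "\<forall>S. Q S \<longrightarrow> card S < nat \<lfloor>?b\<rfloor> + 1"
    using bound by (metis le_imp_less_Suc le_nat_floor Suc_eq_plus1)
  ultimately obtain S where S: "Q S" "\<forall>S'. Q S' \<longrightarrow> card S' \<le> card S"
    using ex_has_greatest_nat[of Q "{}" card "nat \<lfloor>?b\<rfloor> + 1"] by (metis less_imp_le)
  have "T \<subseteq> (\<Union>x\<in>S. cball x e)"
  proof (rule ccontr)
    assume "\<not> ?thesis"
    then obtain z where z: "z \<in> T" "\<forall>x\<in>S. e < dist x z" by (auto simp: not_le subset_eq)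
    \<comment> \<open>A separated set of maximal cardinality is a net.\<close>
    have "z \<notin> S" using z(2) e by auto
    have "Q (insert z S)" using S(1) z by (auto simp: Q_def dist_commute less_imp_le)
    then have "card (insert z S) \<le> card S" using S(2) by blast
    then show False using \<open>z \<notin> S\<close> S(1) by (simp add: Q_def)
  qed
  then show ?thesis using that[of S] S(1) bound[OF S(1)] by (simp add: Q_def)
qed

text \<open>Dually, finitely many directions that are \<open>\<Delta>\<close>-dense in the sphere, moved radially in steps of
  \<open>\<Delta>\<close>, cover a ball of radius \<open>r / 2\<close>; so every cap of radius \<open>2 r\<close> contains many of them.  The number
  is counted with repetitions of the directions.\<close>

lemma card_directions_in_cap:
  fixes u :: "nat \<Rightarrow> 'a::euclidean_space"
  assumes u: "\<And>i. i \<in> I \<Longrightarrow> norm (u i) = 1" and I: "finite I"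
    and dense: "\<And>w. norm w = 1 \<Longrightarrow> \<exists>i\<in>I. dist w (u i) \<le> D"
    and D: "0 < D" "D \<le> r" "r \<le> 1" and v: "norm v = 1"
  shows "(r / D) ^ (DIM('a) - 1) \<le> 2 * 6 ^ DIM('a) * real (card {i\<in>I. dist v (u i) \<le> 2 * r})"
proof -
  define J where "J = {i\<in>I. dist v (u i) \<le> 2 * r}"
  define m where "m = nat \<lfloor>r / D\<rfloor>"
  define \<tau> where "\<tau> = (\<lambda>j::nat. 1 - r / 2 + real j * D)"
  define F where "F = (\<lambda>(j, i). \<tau> j *\<^sub>R u i) ` ({..m} \<times> J)"
  have q: "0 \<le> r / D" using D by simp
  have m1: "real m \<le> r / D" unfolding m_def using q by (simp add: of_nat_floor)
  have m1': "real m * D \<le> r" using m1 D by (simp add: pos_le_divide_eq)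
  \<comment> \<open>A point is reached by choosing a direction close to its own and a step close to its norm.\<close>
  have cover: "cball v (r / 2) \<subseteq> (\<Union>x\<in>F. cball x (3 * D))"
  proof
    fix x assume "x \<in> cball v (r / 2)"
    then have x: "norm (v - x) \<le> r / 2" by (simp add: dist_norm)
    have nx: "\<bar>norm x - 1\<bar> \<le> r / 2" using norm_triangle_ineq3[of x v] x v by (simp add: norm_minus_commute)
    then have npos: "0 < norm x" using D by linarith
    define w where "w = (1 / norm x) *\<^sub>R x"
    have nw: "norm w = 1" and xw: "x = norm x *\<^sub>R w" using npos by (auto simp: w_def)
    have "norm (x - w) = \<bar>norm x - 1\<bar>"
    proof -
      have "x - w = (norm x - 1) *\<^sub>R w" by (subst (1) xw) (simp add: algebra_simps)
      then show ?thesis using nw by simp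
    qed
    then have vw: "dist v w \<le> r" using norm_triangle_ineq[of "v - x" "x - w"] x nx by (simp add: dist_norm)
    obtain i where i: "i \<in> I" "dist w (u i) \<le> D" using dense[OF nw] by blast
    have "dist v (u i) \<le> 2 * r" using dist_triangle[of v "u i" w] vw i D by linarith
    then have iJ: "i \<in> J" using i by (simp add: J_def)
    define a where "a = norm x - (1 - r / 2)"
    have a: "0 \<le> a" "a \<le> r" using nx by (auto simp: a_def abs_if split: if_splits)
    define j where "j = nat \<lfloor>a / D\<rfloor>"
    have q2: "0 \<le> a / D" using a D by simp
    have j1: "real j \<le> a / D" unfolding j_def using q2 by (simp add: of_nat_floor)
    have j2: "a / D \<le> real j + 1" unfolding j_def using q2 by linarith
    have "real j * D \<le> a" using j1 D by (simp add: pos_le_divide_eq)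
    moreover have "a \<le> (real j + 1) * D" using j2 D by (simp add: pos_divide_le_eq)
    ultimately have t: "\<bar>norm x - \<tau> j\<bar> \<le> D" by (simp add: \<tau>_def a_def algebra_simps)
    have t2: "0 \<le> \<tau> j" using D by (simp add: \<tau>_def)
    have t3: "\<tau> j \<le> 2" using \<open>real j * D \<le> a\<close> a D by (simp add: \<tau>_def)
    have "a / D \<le> r / D" using a D by (simp add: divide_right_mono)
    then have jm: "j \<le> m" unfolding j_def m_def by (intro nat_mono floor_mono)
    have "x - \<tau> j *\<^sub>R u i = (norm x - \<tau> j) *\<^sub>R w + \<tau> j *\<^sub>R (w - u i)"
      by (subst (1) xw) (simp add: algebra_simps)
    then have "norm (x - \<tau> j *\<^sub>R u i) \<le> \<bar>norm x - \<tau> j\<bar> * norm w + \<bar>\<tau> j\<bar> * norm (w - u i)"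
      by (metis norm_scaleR norm_triangle_ineq)
    also have "\<dots> \<le> D * 1 + 2 * D"
      using t t2 t3 i nw by (intro add_mono mult_mono) (auto simp: dist_norm)
    finally have "dist (\<tau> j *\<^sub>R u i) x \<le> 3 * D" by (simp add: dist_norm norm_minus_commute)
    moreover have "\<tau> j *\<^sub>R u i \<in> F" using jm iJ by (auto simp: F_def)
    ultimately show "x \<in> (\<Union>x\<in>F. cball x (3 * D))" by auto
  qed
  have finF: "finite F" using I by (auto simp: F_def J_def)
  have finJ: "finite J" using I by (simp add: J_def)
  have "card F \<le> card ({..m} \<times> J)" unfolding F_def by (rule card_image_le) (use finJ in auto)
  then have cF: "real (card F) \<le> real (m + 1) * real (card J)"
    by (simp add: card_cartesian_product) (metis of_nat_Suc of_nat_le_iff of_nat_mult of_nat_add mult_Suc)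
  have m3: "real (m + 1) \<le> 2 * (r / D)" using m1 D by (simp add: field_simps) 
  have "(r / 2) ^ DIM('a) \<le> real (card F) * (3 * D) ^ DIM('a)"
    by (rule card_covering_volume[OF finF _ _ cover]) (use D in auto)
  also have "\<dots> \<le> (2 * (r / D) * real (card J)) * (3 * D) ^ DIM('a)"
    using order_trans[OF cF mult_right_mono[OF m3]] D by (intro mult_right_mono) auto
  finally have "(r / 2) ^ DIM('a) / (3 * D) ^ DIM('a) \<le> 2 * (r / D) * real (card J)"
    using D by (simp add: pos_divide_le_eq)
  moreover have "(r / 2) ^ DIM('a) / (3 * D) ^ DIM('a) = (r / D) ^ DIM('a) / 6 ^ DIM('a)"
    unfolding power_divide[symmetric]
    by (rule arg_cong[where f = "\<lambda>x. x ^ DIM('a)"]) (simp add: field_simps)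
  ultimately have "(r / D) ^ DIM('a) \<le> 2 * (r / D) * real (card J) * 6 ^ DIM('a)"
    by (simp add: pos_divide_le_eq)
  moreover have "(r / D) ^ DIM('a) = (r / D) * (r / D) ^ (DIM('a) - 1)"
    by (metis DIM_positive Suc_diff_1 power_Suc)
  ultimately have "(r / D) * (r / D) ^ (DIM('a) - 1) \<le> (r / D) * (2 * 6 ^ DIM('a) * real (card J))"
    by (simp only: mult_ac)
  moreover have "0 < r / D" using D by simp
  ultimately show ?thesis unfolding J_def[symmetric] by (simp only: mult_le_cancel_left_pos)
qed

section \<open>Hausdorff measure of spherical caps\<close>

text \<open>The net of the packing bound is a cover by balls of one common radius \<open>e\<close>, and the number of its points
  is exactly compensated by \<open>e ^ (n - 1)\<close>, whatever the bound \<open>d\<close> for the diameters.\<close>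

lemma hausdorff_cap_upper:
  fixes v :: "'a::euclidean_space"
  assumes "2 \<le> DIM('a)" and r: "0 < r" "r \<le> 2"
  shows "hausdorff_outer (real DIM('a) - 1) (sphere 0 1 \<inter> cball v r)
    \<le> ennreal (4 * 8 ^ DIM('a) * unit_ball_vol (real DIM('a) - 1) * r ^ (DIM('a) - 1))"
  unfolding hausdorff_outer_def
proof (rule SUP_least)
  fix d :: real assume "d \<in> {0<..}"
  then have d: "0 < d" by simp
  let ?s = "real DIM('a) - 1"
  have s: "?s = real (DIM('a) - 1)" using assms by (simp add: of_nat_diff)
  define e where "e = min (d / 2) r"
  have e: "0 < e" "e \<le> r" "2 * e \<le> d" using d r by (auto simp: e_def)
  obtain S where S: "finite S" "sphere 0 1 \<inter> cball v r \<subseteq> (\<Union>x\<in>S. cball x e)"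
    "real (card S) \<le> 4 * 8 ^ DIM('a) * (r / e) ^ (DIM('a) - 1)"
    by (rule sphere_net[OF subset_refl e(1,2) r(2)])
  obtain f where f: "bij_betw f {..<card S} S"
    using ex_bij_betw_nat_finite[OF S(1)] by (auto simp: atLeast0LessThan)
  define U where "U = (\<lambda>i. if i < card S then cball (f i) e else {})"
  have U1: "sphere 0 1 \<inter> cball v r \<subseteq> (\<Union>i. U i)"
  proof
    fix x assume "x \<in> sphere 0 1 \<inter> cball v r"
    then obtain y where y: "y \<in> S" "x \<in> cball y e" using S(2) by blast
    then obtain i where "i < card S" "f i = y" using f by (metis bij_betw_iff_bijections lessThan_iff)
    then show "x \<in> (\<Union>i. U i)" using y by (auto simp: U_def)
  qed
  have dU: "diameter (U i) = (if i < card S then 2 * e else 0)" for i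
    using e by (simp add: U_def diameter_cball)
  have "hausdorff_premeasure ?s d (sphere 0 1 \<inter> cball v r)
      \<le> (\<Sum>i. ennreal (unit_ball_vol ?s * (diameter (U i) / 2) powr ?s))"
    unfolding hausdorff_premeasure_def
  proof (rule INF_lower)
    have "bounded (U i) \<and> diameter (U i) \<le> d" for i
      using dU[of i] e d by (simp add: U_def)
    then show "U \<in> {U. sphere 0 1 \<inter> cball v r \<subseteq> (\<Union>i. U i) \<and> (\<forall>i. bounded (U i) \<and> diameter (U i) \<le> d)}"
      using U1 by blast
  qed
  also have "\<dots> = (\<Sum>i<card S. ennreal (unit_ball_vol ?s * (diameter (U i) / 2) powr ?s))"
    by (rule suminf_finite) (use dU in auto)
  also have "\<dots> = (\<Sum>i<card S. ennreal (unit_ball_vol ?s * e ^ (DIM('a) - 1)))"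
  proof (rule sum.cong)
    fix i assume "i \<in> {..<card S}"
    then have "diameter (U i) / 2 = e" using dU[of i] by simp
    moreover have "e powr ?s = e ^ (DIM('a) - 1)" unfolding s using e(1) by (rule powr_realpow)
    ultimately show "ennreal (unit_ball_vol ?s * (diameter (U i) / 2) powr ?s)
      = ennreal (unit_ball_vol ?s * e ^ (DIM('a) - 1))" by simp
  qed simp
  also have "\<dots> = ennreal (real (card S) * (unit_ball_vol ?s * e ^ (DIM('a) - 1)))"
    by (simp add: ennreal_of_nat_eq_real_of_nat ennreal_mult' )
  also have "\<dots> \<le> ennreal ((4 * 8 ^ DIM('a) * (r / e) ^ (DIM('a) - 1))
        * (unit_ball_vol ?s * e ^ (DIM('a) - 1)))"
    using S(3) e assms by (intro ennreal_leI mult_right_mono) auto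
  also have "\<dots> = ennreal (4 * 8 ^ DIM('a) * unit_ball_vol ?s * r ^ (DIM('a) - 1))"
    using e by (simp add: power_divide)
  finally show "hausdorff_premeasure ?s d (sphere 0 1 \<inter> cball v r)
    \<le> ennreal (4 * 8 ^ DIM('a) * unit_ball_vol ?s * r ^ (DIM('a) - 1))" .
qed

section \<open>Support functions\<close>

definition body_in :: "real \<Rightarrow> 'a::euclidean_space set \<Rightarrow> bool" where
  "body_in \<rho> L \<longleftrightarrow> compact L \<and> convex L \<and> L \<noteq> {} \<and> L \<subseteq> cball 0 \<rho>"

lemma support_fun_attained:
  assumes "compact L" "L \<noteq> {}"
  obtains y where "y \<in> L" "support_fun L x = x \<bullet> y"
proof -
  have "continuous_on L (\<lambda>y. x \<bullet> y)" by (intro continuous_intros)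
  then obtain y where y: "y \<in> L" "\<forall>z\<in>L. x \<bullet> z \<le> x \<bullet> y"
    using continuous_attains_sup[OF assms] by blast
  have "support_fun L x = x \<bullet> y" unfolding support_fun_def
    by (rule cSup_eq_maximum) (use y in auto)
  then show ?thesis using that y by blast
qed

lemma support_fun_upper:
  assumes "compact L" "y \<in> L"
  shows "x \<bullet> y \<le> support_fun L x"
proof -
  have "bdd_above ((\<lambda>y. x \<bullet> y) ` L)"
    by (intro bounded_imp_bdd_above compact_imp_bounded compact_continuous_image continuous_intros assms)
  then show ?thesis unfolding support_fun_def using assms by (intro cSUP_upper)
qed

lemma support_fun_le:
  assumes "L \<noteq> {}" "\<And>y. y \<in> L \<Longrightarrow> x \<bullet> y \<le> b"
  shows "support_fun L x \<le> b"
  unfolding support_fun_def using assms by (intro cSUP_least) auto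

lemma support_fun_lipschitz:
  assumes "body_in \<rho> L"
  shows "\<bar>support_fun L x - support_fun L x'\<bar> \<le> \<rho> * norm (x - x')"
proof -
  have *: "support_fun L a - support_fun L b \<le> \<rho> * norm (a - b)" for a b
  proof -
    obtain y where y: "y \<in> L" "support_fun L a = a \<bullet> y"
      using support_fun_attained[of L a] assms by (auto simp: body_in_def)
    have "a \<bullet> y - b \<bullet> y = (a - b) \<bullet> y" by (simp add: inner_diff_left)
    also have "\<dots> \<le> norm (a - b) * norm y" by (rule norm_cauchy_schwarz)
    also have "\<dots> \<le> norm (a - b) * \<rho>"
      using y assms by (intro mult_left_mono) (auto simp: body_in_def)
    finally show ?thesis
      using support_fun_upper[of L y b] y assms by (simp add: body_in_def mult.commute)
  qed
  show ?thesis using *[of x x'] *[of x' x] by (simp add: norm_minus_commute abs_le_iff)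
qed

lemma support_fun_abs_le:
  assumes "body_in \<rho> L"
  shows "\<bar>support_fun L x\<bar> \<le> \<rho> * norm x"
proof -
  have "support_fun L 0 = 0"
    using support_fun_attained[of L 0] assms by (auto simp: body_in_def)
  then show ?thesis using support_fun_lipschitz[OF assms, of x 0] by simp
qed

lemma continuous_on_support_fun:
  assumes "body_in \<rho> L"
  shows "continuous_on UNIV (support_fun L)"
proof -
  obtain y where "y \<in> L" using assms by (auto simp: body_in_def)
  then have "0 \<le> \<rho>" using assms norm_ge_zero[of y] by (force simp: body_in_def)
  then have "\<rho>-lipschitz_on UNIV (support_fun L)"
    using support_fun_lipschitz[OF assms] by (intro lipschitz_onI) (simp_all add: dist_norm)
  then show ?thesis by (rule lipschitz_on_continuous_on)
qed

lemma body_in_scale: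
  assumes "body_in \<rho> L" "0 < \<rho>"
  shows "body_in 1 ((*\<^sub>R) (1 / \<rho>) ` L)"
proof -
  have "(*\<^sub>R) (1 / \<rho>) ` L \<subseteq> cball 0 1"
  proof
    fix x assume "x \<in> (*\<^sub>R) (1 / \<rho>) ` L"
    then obtain y where "y \<in> L" "x = (1 / \<rho>) *\<^sub>R y" by blast
    moreover have "norm y \<le> \<rho>" using \<open>y \<in> L\<close> assms by (auto simp: body_in_def)
    ultimately show "x \<in> cball 0 1" using assms(2) by simp
  qed
  then show ?thesis
    using assms unfolding body_in_def by (metis compact_scaling convex_scaling image_is_empty)
qed

lemma support_fun_scale:
  assumes "body_in \<rho> L" "0 \<le> c"
  shows "support_fun ((*\<^sub>R) c ` L) x = c * support_fun L x"
proof (rule antisym)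
  have L: "compact L" "L \<noteq> {}" using assms by (auto simp: body_in_def)
  show "support_fun ((*\<^sub>R) c ` L) x \<le> c * support_fun L x"
  proof (rule support_fun_le)
    fix y assume "y \<in> (*\<^sub>R) c ` L"
    then obtain z where z: "z \<in> L" "y = c *\<^sub>R z" by blast
    show "x \<bullet> y \<le> c * support_fun L x"
      using mult_left_mono[OF support_fun_upper[OF L(1) z(1)] assms(2)] z(2) by simp
  qed (use L in simp)
  obtain y where y: "y \<in> L" "support_fun L x = x \<bullet> y" using support_fun_attained[OF L] by blast
  then have "x \<bullet> (c *\<^sub>R y) \<le> support_fun ((*\<^sub>R) c ` L) x"
    by (intro support_fun_upper compact_scaling L) auto
  then show "c * support_fun L x \<le> support_fun ((*\<^sub>R) c ` L) x" using y by simp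
qed

section \<open>Metric entropy of the convex bodies in the unit ball\<close>

definition half_sqdist :: "'a::euclidean_space set \<Rightarrow> 'a \<Rightarrow> real" where
  "half_sqdist K z = (dist z (closest_point K z))\<^sup>2 / 2"

lemma body_closest_point:
  assumes "body_in \<rho> K"
  shows "closest_point K z \<in> K" "norm (closest_point K z) \<le> \<rho>"
    "\<And>x. x \<in> K \<Longrightarrow> dist z (closest_point K z) \<le> dist z x"
    "\<And>x. x \<in> K \<Longrightarrow> (z - closest_point K z) \<bullet> (x - closest_point K z) \<le> 0"
proof -
  have K: "closed K" "convex K" "K \<noteq> {}" "K \<subseteq> cball 0 \<rho>"
    using assms by (auto simp: body_in_def compact_imp_closed)
  show "closest_point K z \<in> K" using K by (intro closest_point_in_set)
  then show "norm (closest_point K z) \<le> \<rho>" using K(4) by auto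
  show "\<And>x. x \<in> K \<Longrightarrow> dist z (closest_point K z) \<le> dist z x"
    using K by (intro closest_point_le)
  show "\<And>x. x \<in> K \<Longrightarrow> (z - closest_point K z) \<bullet> (x - closest_point K z) \<le> 0"
    using K by (intro closest_point_dot)
qed

text \<open>A boundary point of \<open>K\<close> with outer normal \<open>v\<close> is pushed out along \<open>v\<close> until it meets the sphere
  of radius 2.  There the distance to \<open>K\<close> is the length of the push, while the distance to \<open>L\<close> is
  larger by the gap between the support functions, since \<open>L\<close> lies behind its supporting hyperplane.\<close>

lemma support_fun_diff_le_half_sqdist:
  assumes K: "body_in 1 K" and L: "body_in 1 L"
    and close: "\<And>z. z \<in> sphere 0 2 \<Longrightarrow> \<bar>half_sqdist K z - half_sqdist L z\<bar> \<le> \<eta>"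
    and v: "norm v = 1"
  shows "support_fun K v - support_fun L v \<le> \<eta>"
proof (cases "support_fun K v \<le> support_fun L v")
  case True
  have "2 *\<^sub>R v \<in> sphere 0 2" using v by simp
  then have "0 \<le> \<eta>" using close by (meson abs_ge_zero order_trans)
  then show ?thesis using True by simp
next
  case False
  define t where "t = support_fun K v - support_fun L v"
  have t: "0 < t" using False by (simp add: t_def)
  obtain x where x: "x \<in> K" "support_fun K v = v \<bullet> x"
    using support_fun_attained[of K v] K by (auto simp: body_in_def)
  have nx: "norm x \<le> 1" using x K by (auto simp: body_in_def)
  have "norm (x + 1 *\<^sub>R v) \<le> 2" using norm_triangle_ineq[of x v] nx v by simp
  moreover have "2 \<le> norm (x + 3 *\<^sub>R v)"
    using norm_triangle_ineq2[of "3 *\<^sub>R v" "- x"] nx v by (simp add: add.commute)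
  moreover have "continuous_on {1..3} (\<lambda>s. norm (x + s *\<^sub>R v))" by (intro continuous_intros)
  ultimately obtain s where s: "1 \<le> s" "norm (x + s *\<^sub>R v) = 2"
    using IVT'[of "\<lambda>s. norm (x + s *\<^sub>R v)" 1 2 3] by auto
  define z where "z = x + s *\<^sub>R v"
  have z: "z \<in> sphere 0 2" using s by (simp add: z_def)
  have "dist z (closest_point K z) \<le> dist z x" by (rule body_closest_point(3)[OF K x(1)])
  also have "\<dots> = s" using s v by (simp add: z_def dist_norm)
  finally have "(dist z (closest_point K z))\<^sup>2 \<le> s\<^sup>2" by (intro power_mono) auto
  then have phiK: "half_sqdist K z \<le> s\<^sup>2 / 2" by (simp add: half_sqdist_def)
  define y where "y = closest_point L z"
  have yL: "y \<in> L" unfolding y_def by (rule body_closest_point(1)[OF L])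
  have "v \<bullet> y \<le> support_fun L v" using support_fun_upper yL L by (auto simp: body_in_def)
  then have "s + t \<le> v \<bullet> (z - y)"
    using v x(2) by (simp add: t_def z_def inner_diff_right inner_add_right dot_square_norm)
  also have "\<dots> \<le> norm v * norm (z - y)" by (rule norm_cauchy_schwarz)
  finally have "s + t \<le> dist z y" using v by (simp add: dist_norm)
  then have "(s + t)\<^sup>2 \<le> (dist z y)\<^sup>2" using s t by (intro power_mono) auto
  then have phiL: "(s + t)\<^sup>2 / 2 \<le> half_sqdist L z" by (simp add: half_sqdist_def y_def)
  have "1 * t \<le> s * t" using s t by (intro mult_right_mono) auto
  moreover have "0 \<le> t\<^sup>2" by simp
  moreover have "(s + t)\<^sup>2 / 2 - s\<^sup>2 / 2 = s * t + t\<^sup>2 / 2"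
    by (simp add: power2_eq_square field_simps)
  ultimately have "t \<le> (s + t)\<^sup>2 / 2 - s\<^sup>2 / 2" by linarith
  also have "\<dots> \<le> \<eta>" using phiK phiL close[OF z] by (simp add: abs_le_iff)
  finally show ?thesis by (simp add: t_def)
qed

text \<open>The half squared distance is convex with gradient \<open>w - closest_point K w\<close>, and it is bounded above
  by the half squared distance to the single point \<open>closest_point K w\<close>; so it has a first-order
  expansion with an error of at most half the squared increment.\<close>

lemma half_sqdist_expansion:
  assumes K: "body_in \<rho> K"
  defines "g \<equiv> \<lambda>w. w - closest_point K w"
  shows "half_sqdist K w + g w \<bullet> (z - w) \<le> half_sqdist K z"
    "half_sqdist K z \<le> half_sqdist K w + g w \<bullet> (z - w) + (norm (z - w))\<^sup>2 / 2"
proof -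
  let ?p = "closest_point K w" and ?q = "closest_point K z"
  have ne: "(dist x y)\<^sup>2 = (x - y) \<bullet> (x - y)" for x y :: 'a
    by (simp add: dist_norm power2_norm_eq_inner)
  have "(w - ?p) \<bullet> (?q - ?p) \<le> 0"
    by (rule body_closest_point(4)[OF K]) (rule body_closest_point(1)[OF K])
  moreover have "0 \<le> (norm (g z - g w))\<^sup>2" by simp
  moreover have "half_sqdist K z - half_sqdist K w - g w \<bullet> (z - w)
      = (norm (g z - g w))\<^sup>2 / 2 - (w - ?p) \<bullet> (?q - ?p)"
    unfolding half_sqdist_def g_def ne power2_norm_eq_inner
    by (simp add: inner_diff_left inner_diff_right inner_commute[of ?q z] inner_commute[of ?p z]
        inner_commute[of ?p w] inner_commute[of ?q w] inner_commute[of ?q ?p] inner_commute[of w z])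
      (simp add: field_simps)
  ultimately show "half_sqdist K w + g w \<bullet> (z - w) \<le> half_sqdist K z" by linarith
  have "dist z ?q \<le> dist z ?p"
    by (rule body_closest_point(3)[OF K]) (rule body_closest_point(1)[OF K])
  then have "(dist z ?q)\<^sup>2 \<le> (dist z ?p)\<^sup>2" by (intro power_mono) auto
  then have "half_sqdist K z \<le> (dist z ?p)\<^sup>2 / 2" by (simp add: half_sqdist_def)
  also have "\<dots> = half_sqdist K w + g w \<bullet> (z - w) + (norm (z - w))\<^sup>2 / 2"
    unfolding half_sqdist_def g_def ne power2_norm_eq_inner
    by (simp add: inner_diff_left inner_diff_right inner_commute[of ?p z]
        inner_commute[of ?p w] inner_commute[of w z]) (simp add: field_simps)
  finally show "half_sqdist K z \<le> half_sqdist K w + g w \<bullet> (z - w) + (norm (z - w))\<^sup>2 / 2" .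
qed

lemma half_sqdist_diff_le:
  assumes K: "body_in \<rho> K" and L: "body_in \<rho> L"
  shows "\<bar>half_sqdist K z - half_sqdist L z\<bar>
    \<le> \<bar>half_sqdist K w - half_sqdist L w\<bar>
      + norm (closest_point K w - closest_point L w) * norm (z - w) + (norm (z - w))\<^sup>2 / 2"
proof -
  let ?p = "closest_point K w" and ?q = "closest_point L w"
  have "\<bar>(?p - ?q) \<bullet> (z - w)\<bar> \<le> norm (?p - ?q) * norm (z - w)"
    by (rule Cauchy_Schwarz_ineq2)
  moreover have "(w - ?q) \<bullet> (z - w) - (w - ?p) \<bullet> (z - w) = (?p - ?q) \<bullet> (z - w)"
    by (simp add: inner_diff_left)
  ultimately show ?thesis
    using half_sqdist_expansion[OF K, where w=w and z=z] half_sqdist_expansion[OF L, where w=w and z=z]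
    by linarith
qed

lemma closest_point_diff_le:
  assumes K: "body_in \<rho> K" and L: "body_in \<rho> L"
  shows "norm (closest_point K z - closest_point L z)
    \<le> norm (closest_point K w - closest_point L w) + 2 * norm (z - w)"
proof -
  have *: "norm (closest_point M z - closest_point M w) \<le> norm (z - w)" if "body_in \<rho> M" for M
    using closest_point_lipschitz[of M z w] that
    by (simp add: body_in_def compact_imp_closed dist_norm)
  have "closest_point K z - closest_point L z
      = (closest_point K w - closest_point L w)
        + ((closest_point K z - closest_point K w) - (closest_point L z - closest_point L w))" by simp
  then have "norm (closest_point K z - closest_point L z)
      \<le> norm (closest_point K w - closest_point L w)
        + norm ((closest_point K z - closest_point K w) - (closest_point L z - closest_point L w))"
    by (metis norm_triangle_ineq)
  also have "norm ((closest_point K z - closest_point K w) - (closest_point L z - closest_point L w))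
      \<le> norm (z - w) + norm (z - w)"
    using norm_triangle_ineq4 *[OF K] *[OF L] by (meson add_mono order_trans)
  finally show ?thesis by simp
qed

text \<open>At scale \<open>\<eta>\<close>, the natural accuracy is \<open>\<eta>\<^sup>2\<close> for the values and \<open>\<eta>\<close> for the gradients, since both
  contribute equally to the first-order expansion at distance \<open>\<eta>\<close>.\<close>

definition close_on :: "real \<Rightarrow> real \<Rightarrow> real \<Rightarrow> 'a::euclidean_space set \<Rightarrow> 'a set set \<Rightarrow> bool" where
  "close_on a b \<eta> Z G \<longleftrightarrow> (\<forall>K\<in>G. \<forall>L\<in>G. \<forall>z\<in>Z.
     \<bar>half_sqdist K z - half_sqdist L z\<bar> \<le> a * \<eta>\<^sup>2 \<and>
     norm (closest_point K z - closest_point L z) \<le> b * \<eta>)"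

lemma floor_window:
  fixes x y :: real
  assumes "\<bar>x - y\<bar> \<le> real a"
  shows "\<lfloor>x\<rfloor> \<in> {\<lfloor>y\<rfloor> - int a..\<lfloor>y\<rfloor> + int a}"
  using assms by (auto simp: abs_le_iff) linarith+

lemma abs_diff_lt_if_floor_eq:
  fixes x y :: real
  assumes "\<lfloor>x\<rfloor> = \<lfloor>y\<rfloor>"
  shows "\<bar>x - y\<bar> \<le> 1"
  using assms by linarith

text \<open>Bodies are sorted by rounding the value and the gradient data at each point of \<open>Z\<close>.  As these data
  are known in advance up to a fixed multiple of the mesh, each of them takes only boundedly many
  rounded values: there is no logarithmic loss.\<close>

lemma refine_close_on:
  fixes Z :: "'a::euclidean_space set" and a :: nat
  assumes fin: "finite Z" and \<eta>: "0 < \<eta>" and close: "close_on (real a) (real a) \<eta> Z G"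
  obtains F where "finite F" "\<Union>F = G"
    "card F \<le> (2 * a + 1) ^ ((DIM('a) + 1) * card Z)"
    "\<And>H. H \<in> F \<Longrightarrow> close_on 1 (real DIM('a)) \<eta> Z H"
proof (cases "G = {}")
  case True
  then show ?thesis using that[of "{}"] by simp
next
  case False
  then obtain K0 where K0: "K0 \<in> G" by blast
  define I where "I = Z \<times> insert (0::'a) Basis"
  define d where "d = (\<lambda>(K::'a set) (z, b). if b = 0 then half_sqdist K z / \<eta>\<^sup>2
      else (closest_point K z \<bullet> b) / \<eta>)"
  define code where "code = (\<lambda>K. restrict (\<lambda>p. \<lfloor>d K p\<rfloor>) I)"
  define W where "W = (\<lambda>p. {\<lfloor>d K0 p\<rfloor> - int a..\<lfloor>d K0 p\<rfloor> + int a})"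
  have finI: "finite I" using fin by (simp add: I_def)
  have cI: "card I = (DIM('a) + 1) * card Z" by (simp add: I_def card_cartesian_product)
  have d_close: "\<bar>d K p - d L p\<bar> \<le> real a" if KL: "K \<in> G" "L \<in> G" and pI: "p \<in> I" for K L p
  proof -
    obtain z b where p: "p = (z, b)" "z \<in> Z" "b = 0 \<or> b \<in> Basis" using pI by (auto simp: I_def)
    have c: "\<bar>half_sqdist K z - half_sqdist L z\<bar> \<le> real a * \<eta>\<^sup>2"
      "norm (closest_point K z - closest_point L z) \<le> real a * \<eta>"
      using close KL p(2) by (auto simp: close_on_def)
    show ?thesis
    proof (cases "b = 0")
      case True
      have "\<bar>d K p - d L p\<bar> = \<bar>half_sqdist K z - half_sqdist L z\<bar> / \<eta>\<^sup>2"
        using True \<eta> by (simp add: d_def p(1) diff_divide_distrib[symmetric])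
      then show ?thesis using c(1) \<eta> by (simp add: pos_divide_le_eq)
    next
      case False
      then have "b \<in> Basis" using p(3) by simp
      then have "\<bar>(closest_point K z - closest_point L z) \<bullet> b\<bar> \<le> real a * \<eta>"
        using Basis_le_norm c(2) order_trans by blast
      moreover have "\<bar>d K p - d L p\<bar> = \<bar>(closest_point K z - closest_point L z) \<bullet> b\<bar> / \<eta>"
        using False \<eta> by (simp add: d_def p(1) diff_divide_distrib[symmetric] inner_diff_left)
      ultimately show ?thesis using \<eta> by (simp add: pos_divide_le_eq)
    qed
  qed
  have "code ` G \<subseteq> PiE I W"
  proof
    fix f assume "f \<in> code ` G"
    then obtain K where "K \<in> G" "f = code K" by blast
    then show "f \<in> PiE I W"
      using floor_window[OF d_close[OF _ K0]] by (auto simp: code_def W_def)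
  qed
  moreover have finP: "finite (PiE I W)" using finI by (intro finite_PiE) (auto simp: W_def)
  ultimately have fc: "finite (code ` G)" and "card (code ` G) \<le> card (PiE I W)"
    by (auto intro: finite_subset card_mono)
  moreover have "card (PiE I W) = (2 * a + 1) ^ card I"
  proof -
    have "card (W p) = 2 * a + 1" for p by (simp add: W_def)
    then show ?thesis using finI by (simp add: card_PiE)
  qed
  ultimately have cc: "card (code ` G) \<le> (2 * a + 1) ^ ((DIM('a) + 1) * card Z)"
    using cI by simp
  define F where "F = (\<lambda>f. {K \<in> G. code K = f}) ` (code ` G)"
  show ?thesis
  proof (rule that)
    show "finite F" using fc by (simp add: F_def)
    show "\<Union>F = G" by (auto simp: F_def)
    have "card F \<le> card (code ` G)" unfolding F_def by (rule card_image_le[OF fc])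
    then show "card F \<le> (2 * a + 1) ^ ((DIM('a) + 1) * card Z)" using cc by simp
    fix H assume "H \<in> F"
    then obtain f where H: "H = {K \<in> G. code K = f}" by (auto simp: F_def)
    show "close_on 1 (real DIM('a)) \<eta> Z H"
      unfolding close_on_def
    proof (intro ballI)
      fix K L z assume *: "K \<in> H" "L \<in> H" "z \<in> Z"
      have eq: "\<bar>d K (z, b) - d L (z, b)\<bar> \<le> 1" if "b = 0 \<or> b \<in> Basis" for b
      proof -
        have "(z, b) \<in> I" using that * by (auto simp: I_def)
        moreover have "code K (z, b) = code L (z, b)" using * H by simp
        ultimately show ?thesis by (intro abs_diff_lt_if_floor_eq) (simp add: code_def)
      qed
      have "\<bar>half_sqdist K z - half_sqdist L z\<bar> / \<eta>\<^sup>2 \<le> 1"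
        using eq[of 0] \<eta> by (simp add: d_def diff_divide_distrib[symmetric])
      then have 1: "\<bar>half_sqdist K z - half_sqdist L z\<bar> \<le> 1 * \<eta>\<^sup>2"
        using \<eta> by (simp add: pos_divide_le_eq)
      have 2: "\<bar>(closest_point K z - closest_point L z) \<bullet> b\<bar> \<le> \<eta>" if "b \<in> Basis" for b
      proof -
        have "b \<noteq> 0" using that nonzero_Basis by auto
        then have "\<bar>(closest_point K z - closest_point L z) \<bullet> b\<bar> / \<eta> \<le> 1"
          using eq[of b] that \<eta> by (simp add: d_def diff_divide_distrib[symmetric] inner_diff_left)
        then show ?thesis using \<eta> by (simp add: pos_divide_le_eq)
      qed
      have "norm (closest_point K z - closest_point L z)
          \<le> (\<Sum>b\<in>Basis. \<bar>(closest_point K z - closest_point L z) \<bullet> b\<bar>)" by (rule norm_le_l1)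
      also have "\<dots> \<le> (\<Sum>b\<in>(Basis::'a set). \<eta>)" by (intro sum_mono 2)
      also have "\<dots> = real DIM('a) * \<eta>" by simp
      finally show "\<bar>half_sqdist K z - half_sqdist L z\<bar> \<le> 1 * \<eta>\<^sup>2 \<and>
        norm (closest_point K z - closest_point L z) \<le> real DIM('a) * \<eta>" using 1 by blast
    qed
  qed
qed

lemma sphere2_net:
  fixes j :: nat
  obtains Z :: "'a::euclidean_space set" where "finite Z" "Z \<subseteq> sphere 0 2"
    "\<And>z. z \<in> sphere 0 2 \<Longrightarrow> \<exists>w\<in>Z. norm (z - w) \<le> (1/2) ^ j"
    "real (card Z) \<le> 4 * 8 ^ DIM('a) * 4 ^ (DIM('a) - 1) * 2 ^ (j * (DIM('a) - 1))"
proof -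
  define e :: real where "e = (1/2) ^ (j + 1)"
  have e: "0 < e" "e \<le> 2" unfolding e_def using power_le_one[of "1/2::real" "j + 1"] by auto
  obtain S where S: "finite S" "S \<subseteq> sphere (0::'a) 1" "sphere 0 1 \<subseteq> (\<Union>x\<in>S. cball x e)"
    "real (card S) \<le> 4 * 8 ^ DIM('a) * (2 / e) ^ (DIM('a) - 1)"
    by (rule sphere_net[of "sphere (0::'a) 1" 0 2 e]) (use e in auto)
  have e2: "2 / e = 4 * 2 ^ j" by (simp add: e_def power_one_over field_simps)
  show ?thesis
  proof (rule that[of "(*\<^sub>R) 2 ` S"])
    show "finite ((*\<^sub>R) 2 ` S)" using S by simp
    show "(*\<^sub>R) 2 ` S \<subseteq> sphere 0 2" using S(2) by auto
    have "card ((*\<^sub>R) (2::real) ` S) \<le> card S" by (rule card_image_le[OF S(1)])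
    then have "real (card ((*\<^sub>R) (2::real) ` S)) \<le> 4 * 8 ^ DIM('a) * (2 / e) ^ (DIM('a) - 1)"
      using S(4) by linarith
    also have "\<dots> = 4 * 8 ^ DIM('a) * 4 ^ (DIM('a) - 1) * 2 ^ (j * (DIM('a) - 1))"
      unfolding e2 by (simp add: power_mult_distrib power_mult)
    finally show "real (card ((*\<^sub>R) (2::real) ` S))
      \<le> 4 * 8 ^ DIM('a) * 4 ^ (DIM('a) - 1) * 2 ^ (j * (DIM('a) - 1))" .
    fix z :: 'a assume "z \<in> sphere 0 2"
    then have "(1/2) *\<^sub>R z \<in> sphere 0 1" by simp
    then have "(1/2) *\<^sub>R z \<in> (\<Union>x\<in>S. cball x e)" using S(3) by blast
    then obtain x where x: "x \<in> S" "dist x ((1/2) *\<^sub>R z) \<le> e" by auto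
    have "z - 2 *\<^sub>R x = 2 *\<^sub>R ((1/2) *\<^sub>R z - x)" by (simp add: algebra_simps)
    then have "norm (z - 2 *\<^sub>R x) = 2 * dist x ((1/2) *\<^sub>R z)"
      by (metis abs_numeral dist_commute dist_norm norm_scaleR)
    also have "\<dots> \<le> (1/2) ^ j" using x(2) by (simp add: e_def)
    finally show "\<exists>w\<in>(*\<^sub>R) 2 ` S. norm (z - w) \<le> (1/2) ^ j" using x(1) by blast
  qed
qed

text \<open>Bronshtein's theorem, at dyadic scales: the exponent is half the dimension of the sphere, because
  on the sphere of radius 2 bodies are described by functions with two derivatives.\<close>

theorem convex_body_entropy:
  assumes dim: "2 \<le> DIM('a::euclidean_space)"
  obtains B :: real and T :: "nat \<Rightarrow> 'a::euclidean_space set set" where "0 \<le> B"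
    "\<And>j. finite (T j)" "\<And>j K. K \<in> T j \<Longrightarrow> body_in 1 K"
    "\<And>j. real (card (T j)) \<le> exp (B * 2 ^ (j * (DIM('a) - 1)))"
    "\<And>j K. body_in 1 K \<Longrightarrow> \<exists>L\<in>T j. \<forall>v. norm v = 1 \<longrightarrow>
        \<bar>support_fun K v - support_fun L v\<bar> \<le> (real DIM('a) + 2) / 4 ^ j"
proof -
  let ?n = "DIM('a)" and ?d = "DIM('a) - 1"
  define G :: "'a set set" where "G = {K. body_in 1 K}"
  have "\<forall>j. \<exists>Z. finite Z \<and> Z \<subseteq> sphere (0::'a) 2 \<and>
      (\<forall>z\<in>sphere 0 2. \<exists>w\<in>Z. norm (z - w) \<le> (1/2) ^ j) \<and>
      real (card Z) \<le> 4 * 8 ^ ?n * 4 ^ ?d * 2 ^ (j * ?d)"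
    by (metis sphere2_net)
  then obtain Z where Z: "\<And>j. finite (Z j)" "\<And>j. Z j \<subseteq> sphere (0::'a) 2"
    "\<And>j z. z \<in> sphere 0 2 \<Longrightarrow> \<exists>w\<in>Z j. norm (z - w) \<le> (1/2) ^ j"
    "\<And>j. real (card (Z j)) \<le> 4 * 8 ^ ?n * 4 ^ ?d * 2 ^ (j * ?d)"
    by metis
  define a where "a = 4 * (?n + 2)"
  define B where "B = ln (real (2 * a + 1)) * (real (?n + 1) * (4 * 8 ^ ?n * 4 ^ ?d))"
  have B: "0 \<le> B" by (simp add: B_def)
  have Q: "real ((2 * a + 1) ^ ((?n + 1) * card (Z j))) \<le> exp (B * 2 ^ (j * ?d))" for j
  proof -
    have "real ((2 * a + 1) ^ ((?n + 1) * card (Z j)))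
        = exp (ln (real (2 * a + 1)) * (real (?n + 1) * real (card (Z j))))"
      unfolding of_nat_power
      by (subst powr_realpow[symmetric]) (simp_all add: powr_def algebra_simps)
    also have "\<dots> \<le> exp (ln (real (2 * a + 1)) * (real (?n + 1) * (4 * 8 ^ ?n * 4 ^ ?d * 2 ^ (j * ?d))))"
      unfolding exp_le_cancel_iff by (intro mult_left_mono Z(4)) auto
    also have "\<dots> = exp (B * 2 ^ (j * ?d))" by (simp add: B_def mult_ac)
    finally show ?thesis .
  qed
  have near: "close_on (real ?n + 2) (real ?n + 2) ((1/2) ^ j) (sphere 0 2) H"
    if "close_on 1 (real ?n) ((1/2) ^ j) (Z j) H" "H \<subseteq> G" for j H
    unfolding close_on_def
  proof (intro ballI)
    fix K L z assume *: "K \<in> H" "L \<in> H" "z \<in> sphere (0::'a) 2"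
    have K: "body_in 1 K" "body_in 1 L" using * that(2) by (auto simp: G_def)
    obtain w where w: "w \<in> Z j" "norm (z - w) \<le> (1/2) ^ j" using Z(3)[OF *(3)] by blast
    let ?e = "(1/2::real) ^ j"
    have c: "\<bar>half_sqdist K w - half_sqdist L w\<bar> \<le> 1 * ?e\<^sup>2"
      "norm (closest_point K w - closest_point L w) \<le> real ?n * ?e"
      using that(1) * w by (auto simp: close_on_def)
    have "norm (closest_point K w - closest_point L w) * norm (z - w) \<le> (real ?n * ?e) * ?e"
      using c(2) w(2) by (intro mult_mono) auto
    moreover have "(norm (z - w))\<^sup>2 \<le> ?e\<^sup>2" using w(2) by (intro power_mono) auto
    moreover have "0 \<le> ?e\<^sup>2" by simp
    ultimately have "\<bar>half_sqdist K z - half_sqdist L z\<bar> \<le> ?e\<^sup>2 + real ?n * ?e * ?e + ?e\<^sup>2"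
      using half_sqdist_diff_le[OF K, of z w] c(1) by linarith
    then have 1: "\<bar>half_sqdist K z - half_sqdist L z\<bar> \<le> (real ?n + 2) * ?e\<^sup>2"
      by (simp add: power2_eq_square algebra_simps)
    have "norm (closest_point K z - closest_point L z) \<le> real ?n * ?e + 2 * ?e"
      using closest_point_diff_le[OF K, of z w] c(2) w(2) by linarith
    then show "\<bar>half_sqdist K z - half_sqdist L z\<bar> \<le> (real ?n + 2) * ?e\<^sup>2 \<and>
        norm (closest_point K z - closest_point L z) \<le> (real ?n + 2) * ?e"
      using 1 by (simp add: algebra_simps)
  qed
  have family: "\<exists>F. finite F \<and> \<Union>F = G \<and> real (card F) \<le> exp (2 * B * 2 ^ (j * ?d)) \<and>
      (\<forall>H\<in>F. close_on 1 (real ?n) ((1/2) ^ j) (Z j) H)" for j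
  proof (induction j)
    case 0
    have "close_on (real a) (real a) ((1/2) ^ 0) (Z 0) G"
      unfolding close_on_def
    proof (intro ballI)
      fix K L z assume *: "K \<in> G" "L \<in> G" "z \<in> Z 0"
      have z: "norm z = 2" using subsetD[OF Z(2) *(3)] by simp
      have b: "0 \<le> half_sqdist M z \<and> half_sqdist M z \<le> 9 / 2 \<and> norm (closest_point M z) \<le> 1"
        if "M \<in> G" for M
      proof -
        have n1: "norm (closest_point M z) \<le> 1"
          using body_closest_point(2)[of 1 M z] that by (simp add: G_def)
        then have "dist z (closest_point M z) \<le> 3"
          using norm_triangle_ineq4[of z "closest_point M z"] z by (simp add: dist_norm)
        then have "(dist z (closest_point M z))\<^sup>2 \<le> 3\<^sup>2" by (intro power_mono) auto
        then show ?thesis using n1 by (simp add: half_sqdist_def)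
      qed
      have a5: "5 \<le> real a" by (simp add: a_def)
      have "\<bar>half_sqdist K z - half_sqdist L z\<bar> \<le> real a"
        using b[OF *(1)] b[OF *(2)] a5 unfolding abs_le_iff by linarith
      moreover have "norm (closest_point K z - closest_point L z) \<le> real a"
        using norm_triangle_ineq4[of "closest_point K z" "closest_point L z"] b[OF *(1)] b[OF *(2)] a5
        by linarith
      ultimately show "\<bar>half_sqdist K z - half_sqdist L z\<bar> \<le> real a * ((1/2) ^ 0)\<^sup>2 \<and>
        norm (closest_point K z - closest_point L z) \<le> real a * (1/2) ^ 0" by simp
    qed
    then obtain F where F: "finite F" "\<Union>F = G" "card F \<le> (2 * a + 1) ^ ((?n + 1) * card (Z 0))"
      "\<And>H. H \<in> F \<Longrightarrow> close_on 1 (real ?n) ((1/2) ^ 0) (Z 0) H"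
      by (rule refine_close_on[OF Z(1), rotated]) auto
    have "real (card F) \<le> real ((2 * a + 1) ^ ((?n + 1) * card (Z 0)))" using F(3) of_nat_le_iff by blast
    also have "\<dots> \<le> exp (B * 2 ^ (0 * ?d))" by (rule Q)
    also have "\<dots> \<le> exp (2 * B * 2 ^ (0 * ?d))" using B by simp
    finally show ?case using F by blast
  next
    case (Suc j)
    then obtain F where F: "finite F" "\<Union>F = G" "real (card F) \<le> exp (2 * B * 2 ^ (j * ?d))"
      "\<And>H. H \<in> F \<Longrightarrow> close_on 1 (real ?n) ((1/2) ^ j) (Z j) H" by blast
    have "\<forall>H\<in>F. \<exists>F'. finite F' \<and> \<Union>F' = H \<and>
        card F' \<le> (2 * a + 1) ^ ((?n + 1) * card (Z (Suc j))) \<and>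
        (\<forall>H'\<in>F'. close_on 1 (real ?n) ((1/2) ^ Suc j) (Z (Suc j)) H')"
    proof
      fix H assume "H \<in> F"
      then have cl: "close_on (real ?n + 2) (real ?n + 2) ((1/2) ^ j) (sphere 0 2) H"
        using near F by blast
      have e: "(1/2::real) ^ j = 2 * (1/2) ^ Suc j" by simp
      have "close_on (real a) (real a) ((1/2) ^ Suc j) (Z (Suc j)) H"
        unfolding close_on_def
      proof (intro ballI)
        fix K L z assume *: "K \<in> H" "L \<in> H" "z \<in> Z (Suc j)"
        then have "z \<in> sphere 0 2" using Z(2) by blast
        then have c: "\<bar>half_sqdist K z - half_sqdist L z\<bar> \<le> (real ?n + 2) * ((1/2) ^ j)\<^sup>2"
          "norm (closest_point K z - closest_point L z) \<le> (real ?n + 2) * (1/2) ^ j"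
          using cl * by (auto simp: close_on_def)
        have 1: "(real ?n + 2) * ((1/2) ^ j)\<^sup>2 = real a * ((1/2) ^ Suc j)\<^sup>2"
          unfolding e by (simp add: a_def power2_eq_square algebra_simps)
        have "(real ?n + 2) * (1/2) ^ j = (2 * (real ?n + 2)) * (1/2) ^ Suc j"
          unfolding e by simp
        also have "\<dots> \<le> real a * (1/2) ^ Suc j"
          by (intro mult_right_mono) (auto simp: a_def)
        finally show "\<bar>half_sqdist K z - half_sqdist L z\<bar> \<le> real a * ((1/2) ^ Suc j)\<^sup>2 \<and>
          norm (closest_point K z - closest_point L z) \<le> real a * (1/2) ^ Suc j"
          using c 1 by linarith
      qed
      then show "\<exists>F'. finite F' \<and> \<Union>F' = H \<and>
          card F' \<le> (2 * a + 1) ^ ((?n + 1) * card (Z (Suc j))) \<and>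
          (\<forall>H'\<in>F'. close_on 1 (real ?n) ((1/2) ^ Suc j) (Z (Suc j)) H')"
        by (rule refine_close_on[OF Z(1), rotated]) auto
    qed
    then obtain f where f: "\<And>H. H \<in> F \<Longrightarrow> finite (f H) \<and> \<Union>(f H) = H \<and>
        card (f H) \<le> (2 * a + 1) ^ ((?n + 1) * card (Z (Suc j))) \<and>
        (\<forall>H'\<in>f H. close_on 1 (real ?n) ((1/2) ^ Suc j) (Z (Suc j)) H')" by metis
    define F' where "F' = (\<Union>H\<in>F. f H)"
    have "card F' \<le> (\<Sum>H\<in>F. card (f H))" unfolding F'_def by (rule card_UN_le[OF F(1)])
    also have "\<dots> \<le> (\<Sum>H\<in>F. (2 * a + 1) ^ ((?n + 1) * card (Z (Suc j))))"
      using f by (intro sum_mono) auto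
    also have "\<dots> = card F * (2 * a + 1) ^ ((?n + 1) * card (Z (Suc j)))" by simp
    finally have "real (card F') \<le> real (card F) * real ((2 * a + 1) ^ ((?n + 1) * card (Z (Suc j))))"
      by (metis of_nat_le_iff of_nat_mult)
    also have "\<dots> \<le> exp (2 * B * 2 ^ (j * ?d)) * exp (B * 2 ^ (Suc j * ?d))"
      by (intro mult_mono F(3) Q) auto
    also have "\<dots> = exp (B * (2 * 2 ^ (j * ?d) + 2 ^ (Suc j * ?d)))"
      by (simp add: exp_add[symmetric] algebra_simps)
    also have "\<dots> \<le> exp (2 * B * 2 ^ (Suc j * ?d))"
    proof -
      have "2 * (2::real) ^ (j * ?d) = 2 ^ (j * ?d + 1)" by simp
      also have "\<dots> \<le> 2 ^ (Suc j * ?d)" using dim by (intro power_increasing) auto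
      finally have "B * (2 * 2 ^ (j * ?d) + 2 ^ (Suc j * ?d)) \<le> B * (2 * 2 ^ (Suc j * ?d))"
        using B by (intro mult_left_mono) auto
      then show ?thesis by (simp add: mult_ac)
    qed
    finally have "real (card F') \<le> exp (2 * B * 2 ^ (Suc j * ?d))" .
    moreover have "finite F'" unfolding F'_def using F(1) f by blast
    moreover have "\<Union>F' = G" unfolding F'_def
      using F(2) f by (auto simp: set_eq_iff)
    moreover have "\<forall>H'\<in>F'. close_on 1 (real ?n) ((1/2) ^ Suc j) (Z (Suc j)) H'"
      using f by (auto simp: F'_def)
    ultimately show ?case by blast
  qed
  obtain F where F: "\<And>j. finite (F j)" "\<And>j. \<Union>(F j) = G"
    "\<And>j. real (card (F j)) \<le> exp (2 * B * 2 ^ (j * ?d))"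
    "\<And>j H. H \<in> F j \<Longrightarrow> close_on 1 (real ?n) ((1/2) ^ j) (Z j) H"
    using family by metis
  define T where "T = (\<lambda>j. (\<lambda>H. SOME K. K \<in> H) ` (F j - {{}}))"
  show ?thesis
  proof (rule that[of "2 * B" T])
    show "0 \<le> 2 * B" using B by simp
    show "finite (T j)" for j using F(1) by (simp add: T_def)
    show "real (card (T j)) \<le> exp (2 * B * 2 ^ (j * ?d))" for j
    proof -
      have "card (T j) \<le> card (F j - {{}})" unfolding T_def using F(1) by (intro card_image_le) auto
      also have "\<dots> \<le> card (F j)" using F(1) by (intro card_mono) auto
      finally show ?thesis using F(3)[of j] by linarith
    qed
    show "body_in 1 K" if KT: "K \<in> T j" for j K
    proof -
      obtain H where H: "H \<in> F j" "H \<noteq> {}" "K = (SOME K. K \<in> H)" using KT by (auto simp: T_def)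
      then have "K \<in> H" by (metis ex_in_conv someI_ex)
      then show ?thesis using F(2)[of j] H(1) by (auto simp: G_def)
    qed
    show "\<exists>L\<in>T j. \<forall>v. norm v = 1 \<longrightarrow>
        \<bar>support_fun K v - support_fun L v\<bar> \<le> (real ?n + 2) / 4 ^ j" if K: "body_in 1 K" for j K
    proof -
      have "K \<in> \<Union>(F j)" using K by (simp add: F(2) G_def)
      then obtain H where H: "H \<in> F j" "K \<in> H" by blast
      define L where "L = (SOME K. K \<in> H)"
      have LH: "L \<in> H" using H(2) by (metis L_def someI_ex)
      have L: "body_in 1 L" using LH H(1) F(2)[of j] by (auto simp: G_def)
      have HG: "H \<subseteq> G" using H(1) F(2) by blast
      have "close_on (real ?n + 2) (real ?n + 2) ((1/2) ^ j) (sphere 0 2) H"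
        by (rule near[OF F(4)[OF H(1)] HG])
      moreover have "((1/2::real) ^ j)\<^sup>2 = 1 / 4 ^ j"
        by (simp add: power_one_over power_mult[symmetric] power2_eq_square power_mult_distrib[symmetric])
      ultimately have cl: "\<bar>half_sqdist K z - half_sqdist L z\<bar> \<le> (real ?n + 2) / 4 ^ j"
        "\<bar>half_sqdist L z - half_sqdist K z\<bar> \<le> (real ?n + 2) / 4 ^ j" if "z \<in> sphere 0 2" for z
        using that H(2) LH unfolding close_on_def by force+
      have "\<bar>support_fun K v - support_fun L v\<bar> \<le> (real ?n + 2) / 4 ^ j" if "norm v = 1" for v
        using support_fun_diff_le_half_sqdist[OF K L cl(1) that]
          support_fun_diff_le_half_sqdist[OF L K cl(2) that] by (simp add: abs_le_iff)
      moreover have "L \<in> T j" using H by (auto simp: T_def L_def)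
      ultimately show ?thesis by blast
    qed
  qed
qed

section \<open>Gaussian noise against a finite set of directions at every scale\<close>

lemma nn_integral_normal_density [simp]:
  assumes "0 < \<sigma>"
  shows "(\<integral>\<^sup>+x. ennreal (normal_density \<mu> \<sigma> x) \<partial>lborel) = 1"
  using assms by (subst nn_integral_eq_integral) auto

lemma normal_density_exp_linear:
  assumes "0 < \<sigma>"
  shows "normal_density 0 \<sigma> x * exp (a * x) = exp (a\<^sup>2 * \<sigma>\<^sup>2 / 2) * normal_density (a * \<sigma>\<^sup>2) \<sigma> x"
proof -
  have "- x\<^sup>2 / (2 * \<sigma>\<^sup>2) + a * x = a\<^sup>2 * \<sigma>\<^sup>2 / 2 + - (x - a * \<sigma>\<^sup>2)\<^sup>2 / (2 * \<sigma>\<^sup>2)"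
    using assms by (simp add: power2_eq_square field_simps)
  then have "exp (- x\<^sup>2 / (2 * \<sigma>\<^sup>2)) * exp (a * x)
      = exp (a\<^sup>2 * \<sigma>\<^sup>2 / 2) * exp (- (x - a * \<sigma>\<^sup>2)\<^sup>2 / (2 * \<sigma>\<^sup>2))"
    by (simp only: exp_add[symmetric])
  then show ?thesis by (simp add: normal_density_def)
qed

lemma normal_density_exp_square:
  assumes "0 < \<sigma>"
  shows "normal_density 0 \<sigma> x * exp (1 / (4 * \<sigma>\<^sup>2) * x\<^sup>2) = sqrt 2 * normal_density 0 (sqrt 2 * \<sigma>) x"
proof -
  have "- x\<^sup>2 / (2 * \<sigma>\<^sup>2) + 1 / (4 * \<sigma>\<^sup>2) * x\<^sup>2 = - x\<^sup>2 / (2 * (sqrt 2 * \<sigma>)\<^sup>2)"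
    using assms by (simp add: power_mult_distrib field_simps)
  then have "exp (- x\<^sup>2 / (2 * \<sigma>\<^sup>2)) * exp (1 / (4 * \<sigma>\<^sup>2) * x\<^sup>2) = exp (- x\<^sup>2 / (2 * (sqrt 2 * \<sigma>)\<^sup>2))"
    by (simp only: exp_add[symmetric])
  moreover have "1 / sqrt (2 * pi * \<sigma>\<^sup>2) = sqrt 2 / sqrt (2 * pi * (sqrt 2 * \<sigma>)\<^sup>2)"
    using assms by (simp add: power_mult_distrib real_sqrt_mult field_simps)
  ultimately show ?thesis
    unfolding normal_density_def by (simp add: algebra_simps)
qed

context
  fixes M :: "'w measure" and X :: "nat \<Rightarrow> 'w \<Rightarrow> real" and \<sigma> :: real
  assumes noise: "normal_noise M \<sigma> X" and \<sigma>: "0 < \<sigma>"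
begin

interpretation prob_space M using noise by (simp add: normal_noise_def)

lemma noise_measurable [measurable]: "1 \<le> i \<Longrightarrow> X i \<in> borel_measurable M"
  using noise unfolding normal_noise_def by (metis distributed_measurable measurable_lborel2 lborel_def measurable_lborel1)

lemma noise_product_integral:
  fixes g :: "nat \<Rightarrow> real \<Rightarrow> real"
  assumes "finite I" "I \<subseteq> {1..}" and [measurable]: "\<And>i. g i \<in> borel_measurable borel"
  shows "(\<integral>\<^sup>+\<omega>. ennreal (exp (\<Sum>i\<in>I. g i (X i \<omega>))) \<partial>M)
    = (\<Prod>i\<in>I. \<integral>\<^sup>+x. ennreal (normal_density 0 \<sigma> x * exp (g i x)) \<partial>lborel)"
proof -
  have iv: "indep_vars (\<lambda>_. borel) X I"
    using noise assms(2) indep_vars_subset unfolding normal_noise_def by blast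
  have iv': "indep_vars (\<lambda>_. borel) (\<lambda>i \<omega>. ennreal (exp (g i (X i \<omega>)))) I"
    by (rule indep_vars_compose2[OF iv, where Y = "\<lambda>i x. ennreal (exp (g i x))"]) measurable
  have "(\<integral>\<^sup>+\<omega>. ennreal (exp (\<Sum>i\<in>I. g i (X i \<omega>))) \<partial>M)
      = (\<integral>\<^sup>+\<omega>. (\<Prod>i\<in>I. ennreal (exp (g i (X i \<omega>)))) \<partial>M)"
    using assms(1) by (simp add: exp_sum prod_ennreal)
  also have "\<dots> = (\<Prod>i\<in>I. \<integral>\<^sup>+\<omega>. ennreal (exp (g i (X i \<omega>))) \<partial>M)"
    by (rule indep_vars_nn_integral[OF assms(1) iv']) simp
  also have "\<dots> = (\<Prod>i\<in>I. \<integral>\<^sup>+x. ennreal (normal_density 0 \<sigma> x * exp (g i x)) \<partial>lborel)"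
  proof (rule prod.cong)
    fix i assume "i \<in> I"
    then have "distributed M lborel (X i) (normal_density 0 \<sigma>)"
      using noise assms(2) by (auto simp: normal_noise_def)
    from distributed_nn_integral[OF this, of "\<lambda>x. ennreal (exp (g i x))"]
    show "(\<integral>\<^sup>+\<omega>. ennreal (exp (g i (X i \<omega>))) \<partial>M)
      = (\<integral>\<^sup>+x. ennreal (normal_density 0 \<sigma> x * exp (g i x)) \<partial>lborel)"
      by (simp add: ennreal_mult')
  qed simp
  finally show ?thesis .
qed

lemma noise_linear_mgf:
  assumes "finite I" "I \<subseteq> {1..}"
  shows "(\<integral>\<^sup>+\<omega>. ennreal (exp (\<Sum>i\<in>I. v i * X i \<omega>)) \<partial>M) = ennreal (exp (\<sigma>\<^sup>2 * (\<Sum>i\<in>I. (v i)\<^sup>2) / 2))"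
proof -
  have "(\<integral>\<^sup>+x. ennreal (normal_density 0 \<sigma> x * exp (v i * x)) \<partial>lborel) = ennreal (exp ((v i)\<^sup>2 * \<sigma>\<^sup>2 / 2))" for i
    unfolding normal_density_exp_linear[OF \<sigma>] using \<sigma> by (simp add: ennreal_mult' nn_integral_cmult)
  then have "(\<integral>\<^sup>+\<omega>. ennreal (exp (\<Sum>i\<in>I. v i * X i \<omega>)) \<partial>M) = (\<Prod>i\<in>I. ennreal (exp ((v i)\<^sup>2 * \<sigma>\<^sup>2 / 2)))"
    using noise_product_integral[OF assms, of "\<lambda>i x. v i * x"] by simp
  also have "\<dots> = ennreal (exp (\<Sum>i\<in>I. (v i)\<^sup>2 * \<sigma>\<^sup>2 / 2))"
    using assms by (simp add: exp_sum prod_ennreal)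
  also have "(\<Sum>i\<in>I. (v i)\<^sup>2 * \<sigma>\<^sup>2 / 2) = \<sigma>\<^sup>2 * (\<Sum>i\<in>I. (v i)\<^sup>2) / 2"
    by (simp add: sum_distrib_left sum_divide_distrib mult.commute)
  finally show ?thesis .
qed

lemma noise_one_sided_tail:
  assumes "finite I" "I \<subseteq> {1..}" "0 \<le> t"
  shows "prob {\<omega>\<in>space M. \<sigma> * t * sqrt (\<Sum>i\<in>I. (v i)\<^sup>2) < (\<Sum>i\<in>I. v i * X i \<omega>)} \<le> exp (- t\<^sup>2 / 2)"
proof -
  define s where "s = sqrt (\<Sum>i\<in>I. (v i)\<^sup>2)"
  have s2: "(\<Sum>i\<in>I. (v i)\<^sup>2) = s\<^sup>2" by (simp add: s_def sum_nonneg)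
  have s0: "0 \<le> s" by (simp add: s_def sum_nonneg)
  have [measurable]: "(\<lambda>\<omega>. \<Sum>i\<in>I. v i * X i \<omega>) \<in> borel_measurable M"
    using assms by (intro borel_measurable_sum borel_measurable_times) auto
  show ?thesis
  proof (cases "s = 0 \<or> t = 0")
    case True
    then consider "s = 0" | "t = 0" by blast
    then show ?thesis
    proof cases
      case 1
      then have "\<forall>i\<in>I. v i = 0" using s2 assms(1) by (simp add: sum_nonneg_eq_0_iff)
      then show ?thesis using 1 by (simp add: s_def[symmetric])
    next
      case 2
      then show ?thesis by simp
    qed
  next
    case False
    then have pos: "0 < s" "0 < t" using s0 assms(3) by auto
    \<comment> \<open>This parameter minimizes the exponent in the Chernoff bound.\<close>
    define l where "l = t / (\<sigma> * s)"
    have l: "0 < l" using pos \<sigma> by (simp add: l_def)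
    have "emeasure M {\<omega>\<in>space M. \<sigma> * t * s < (\<Sum>i\<in>I. v i * X i \<omega>)}
        \<le> emeasure M {\<omega>\<in>space M. \<sigma> * t * s \<le> (\<Sum>i\<in>I. v i * X i \<omega>)}"
      by (rule emeasure_mono) auto
    also have "\<dots> \<le> ennreal (exp (- l * (\<sigma> * t * s))) *
        (\<integral>\<^sup>+\<omega>. ennreal (exp (l * (\<Sum>i\<in>I. v i * X i \<omega>))) * indicator (space M) \<omega> \<partial>M)"
      by (rule Chernoff_ineq_nn_integral_ge[OF l]) auto
    also have "(\<integral>\<^sup>+\<omega>. ennreal (exp (l * (\<Sum>i\<in>I. v i * X i \<omega>))) * indicator (space M) \<omega> \<partial>M)
        = (\<integral>\<^sup>+\<omega>. ennreal (exp (\<Sum>i\<in>I. (l * v i) * X i \<omega>)) \<partial>M)"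
      by (rule nn_integral_cong) (simp add: sum_distrib_left mult.assoc)
    also have "\<dots> = ennreal (exp (\<sigma>\<^sup>2 * (\<Sum>i\<in>I. (l * v i)\<^sup>2) / 2))"
      by (rule noise_linear_mgf) (use assms in auto)
    also have "(\<Sum>i\<in>I. (l * v i)\<^sup>2) = l\<^sup>2 * s\<^sup>2"
      unfolding s2[symmetric] by (simp add: power_mult_distrib sum_distrib_left)
    also have "\<sigma>\<^sup>2 * (l\<^sup>2 * s\<^sup>2) / 2 = t\<^sup>2 / 2"
      using pos \<sigma> by (simp add: l_def power_divide power_mult_distrib)
    also have "- l * (\<sigma> * t * s) = - t\<^sup>2" using pos \<sigma> by (simp add: l_def power2_eq_square)
    also have "ennreal (exp (- t\<^sup>2)) * ennreal (exp (t\<^sup>2 / 2)) = ennreal (exp (- t\<^sup>2 / 2))"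
      by (simp add: ennreal_mult'[symmetric] exp_add[symmetric])
    finally show ?thesis
      unfolding s_def[symmetric] by (simp add: emeasure_eq_measure)
  qed
qed

lemma noise_tail:
  assumes "finite I" "I \<subseteq> {1..}" "0 \<le> t"
  shows "prob {\<omega>\<in>space M. \<sigma> * t * sqrt (\<Sum>i\<in>I. (v i)\<^sup>2) < \<bar>\<Sum>i\<in>I. v i * X i \<omega>\<bar>} \<le> 2 * exp (- t\<^sup>2 / 2)"
proof -
  let ?E = "\<lambda>w. {\<omega>\<in>space M. \<sigma> * t * sqrt (\<Sum>i\<in>I. (w i)\<^sup>2) < (\<Sum>i\<in>I. w i * X i \<omega>)}"
  have m: "(\<lambda>\<omega>. \<Sum>i\<in>I. w i * X i \<omega>) \<in> borel_measurable M" for w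
    using assms by (intro borel_measurable_sum borel_measurable_times) auto
  have ev: "?E w \<in> events" for w using m[of w] by measurable
  have "{\<omega>\<in>space M. \<sigma> * t * sqrt (\<Sum>i\<in>I. (v i)\<^sup>2) < \<bar>\<Sum>i\<in>I. v i * X i \<omega>\<bar>} = ?E v \<union> ?E (\<lambda>i. - v i)"
    by (auto simp: sum_negf abs_if)
  then have "prob {\<omega>\<in>space M. \<sigma> * t * sqrt (\<Sum>i\<in>I. (v i)\<^sup>2) < \<bar>\<Sum>i\<in>I. v i * X i \<omega>\<bar>}
      \<le> prob (?E v) + prob (?E (\<lambda>i. - v i))"
    by (simp only: measure_Un_le[OF ev ev])
  also have "\<dots> \<le> exp (- t\<^sup>2 / 2) + exp (- t\<^sup>2 / 2)"
    by (intro add_mono noise_one_sided_tail assms)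
  finally show ?thesis by simp
qed

text \<open>With the parameter \<open>1 / (4 * \<sigma>\<^sup>2)\<close> the exponential of the square has expectation \<open>sqrt 2\<close>, so the
  sum of squares exceeds four times its mean with probability at most \<open>(sqrt 2 / exp 1) ^ k\<close>.\<close>

lemma noise_square_tail:
  "prob {\<omega>\<in>space M. 4 * \<sigma>\<^sup>2 * real k < (\<Sum>i=1..k. (X i \<omega>)\<^sup>2)} \<le> (3 / 4) ^ k"
proof -
  let ?l = "1 / (4 * \<sigma>\<^sup>2)"
  have l: "0 < ?l" using \<sigma> by simp
  have [measurable]: "(\<lambda>\<omega>. \<Sum>i=1..k. (X i \<omega>)\<^sup>2) \<in> borel_measurable M"
    by (intro borel_measurable_sum borel_measurable_power) auto
  have int: "(\<integral>\<^sup>+x. ennreal (normal_density 0 \<sigma> x * exp (?l * x\<^sup>2)) \<partial>lborel) = ennreal (sqrt 2)"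
    unfolding normal_density_exp_square[OF \<sigma>] using \<sigma> by (simp add: ennreal_mult' nn_integral_cmult)
  have "emeasure M {\<omega>\<in>space M. 4 * \<sigma>\<^sup>2 * real k < (\<Sum>i=1..k. (X i \<omega>)\<^sup>2)}
      \<le> emeasure M {\<omega>\<in>space M. 4 * \<sigma>\<^sup>2 * real k \<le> (\<Sum>i=1..k. (X i \<omega>)\<^sup>2)}"
    by (rule emeasure_mono) auto
  also have "\<dots> \<le> ennreal (exp (- ?l * (4 * \<sigma>\<^sup>2 * real k))) *
      (\<integral>\<^sup>+\<omega>. ennreal (exp (?l * (\<Sum>i=1..k. (X i \<omega>)\<^sup>2))) * indicator (space M) \<omega> \<partial>M)"
    by (rule Chernoff_ineq_nn_integral_ge[OF l]) auto
  also have "(\<integral>\<^sup>+\<omega>. ennreal (exp (?l * (\<Sum>i=1..k. (X i \<omega>)\<^sup>2))) * indicator (space M) \<omega> \<partial>M)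
      = (\<integral>\<^sup>+\<omega>. ennreal (exp (\<Sum>i=1..k. ?l * (X i \<omega>)\<^sup>2)) \<partial>M)"
    by (rule nn_integral_cong) (simp add: sum_distrib_left[symmetric] del: times_divide_eq_left)
  also have "\<dots> = ennreal (sqrt 2) ^ k"
    by (subst noise_product_integral[of "{1..k}" "\<lambda>i x. ?l * x\<^sup>2"]) (use int in auto)
  also have "- ?l * (4 * \<sigma>\<^sup>2 * real k) = - real k" using \<sigma> by simp
  also have "ennreal (exp (- real k)) * ennreal (sqrt 2) ^ k = ennreal ((exp (- 1) * sqrt 2) ^ k)"
    by (simp add: ennreal_power ennreal_mult'[symmetric] power_mult_distrib exp_of_nat_mult[symmetric])
  also have "\<dots> \<le> ennreal ((3 / 4) ^ k)"
  proof (intro ennreal_leI power_mono)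
    have "exp (-1) \<le> (1/2::real)"
      using exp_ge_add_one_self[of "1::real"] by (simp add: exp_minus field_simps)
    moreover have "sqrt 2 \<le> 3 / 2" by (rule real_le_lsqrt) (auto simp: power2_eq_square)
    ultimately have "exp (-1) * sqrt 2 \<le> (1/2) * (3/2::real)" by (intro mult_mono) auto
    then show "exp (-1) * sqrt 2 \<le> (3 / 4 :: real)" by simp
  qed auto
  finally show ?thesis by (simp add: emeasure_eq_measure)
qed

end

text \<open>The summand \<open>4 * ln k\<close> in the level makes the probabilities of the exceptional events summable over
  the number \<open>k\<close> of measurements; the other summand pays for the number of pairs at scale \<open>4 ^ - j\<close>.\<close>

definition noise_good ::
  "(nat \<Rightarrow> 'a::euclidean_space set set) \<Rightarrow> real \<Rightarrow> (nat \<Rightarrow> 'a) \<Rightarrow> real \<Rightarrow> nat \<Rightarrow> (nat \<Rightarrow> real) \<Rightarrow> bool" where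
  "noise_good T B u \<sigma> k x \<longleftrightarrow>
     (\<Sum>i=1..k. (x i)\<^sup>2) \<le> 4 * \<sigma>\<^sup>2 * real k \<and>
     (\<forall>j<k. \<forall>K\<in>T j \<union> T (Suc j). \<forall>L\<in>T j \<union> T (Suc j).
       \<bar>\<Sum>i=1..k. (support_fun K (u i) - support_fun L (u i)) * x i\<bar>
         \<le> \<sigma> * sqrt (2 * (2 * B * 2 ^ (Suc j * (DIM('a) - 1)) + 4 * ln (real k)))
           * sqrt (\<Sum>i=1..k. (support_fun K (u i) - support_fun L (u i))\<^sup>2))"

lemma AE_eventually_noise_good:
  fixes T :: "nat \<Rightarrow> 'a::euclidean_space set set"
  assumes noise: "normal_noise M \<sigma> X" and \<sigma>: "0 < \<sigma>" and B: "0 \<le> B"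
    and T: "\<And>j. finite (T j)" "\<And>j. real (card (T j)) \<le> exp (B * 2 ^ (j * (DIM('a) - 1)))"
  shows "AE \<omega> in M. \<exists>N. \<forall>k\<ge>N. noise_good T B u \<sigma> k (\<lambda>i. X i \<omega>)"
proof -
  interpret prob_space M using noise by (simp add: normal_noise_def)
  note [measurable] = noise_measurable[OF noise \<sigma>]
  let ?q = "\<lambda>j. (2::real) ^ (Suc j * (DIM('a) - 1))"
  define P where "P = (\<lambda>j. (T j \<union> T (Suc j)) \<times> (T j \<union> T (Suc j)))"
  define t where "t = (\<lambda>k j. sqrt (2 * (2 * B * ?q j + 4 * ln (real k))))"
  define v where "v = (\<lambda>(K, L) i. support_fun K (u i) - support_fun L (u i))"
  define E where "E = (\<lambda>k j p. {\<omega>\<in>space M. \<sigma> * t k j * sqrt (\<Sum>i=1..k. (v p i)\<^sup>2) < \<bar>\<Sum>i=1..k. v p i * X i \<omega>\<bar>})"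
  define S where "S = (\<lambda>k. {\<omega>\<in>space M. 4 * \<sigma>\<^sup>2 * real k < (\<Sum>i=1..k. (X i \<omega>)\<^sup>2)})"
  define A where "A = (\<lambda>k. S k \<union> (\<Union>j<k. \<Union>p\<in>P j. E k j p))"
  have finP: "finite (P j)" for j using T(1) by (simp add: P_def)
  have cardP: "real (card (P j)) \<le> 4 * exp (2 * B * ?q j)" for j
  proof -
    have "B * 2 ^ (j * (DIM('a) - 1)) \<le> B * ?q j"
      by (intro mult_left_mono power_increasing B) auto
    then have "exp (B * 2 ^ (j * (DIM('a) - 1))) \<le> exp (B * ?q j)" by simp
    then have "real (card (T j)) + real (card (T (Suc j))) \<le> 2 * exp (B * ?q j)"
      using T(2)[of j] T(2)[of "Suc j"] by linarith
    then have "real (card (T j \<union> T (Suc j))) \<le> 2 * exp (B * ?q j)"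
      using card_Un_le[of "T j" "T (Suc j)"] by linarith
    then have "real (card (T j \<union> T (Suc j))) * real (card (T j \<union> T (Suc j)))
        \<le> (2 * exp (B * ?q j)) * (2 * exp (B * ?q j))"
      by (intro mult_mono) auto
    also have "\<dots> = 4 * exp (B * ?q j + B * ?q j)" by (simp only: exp_add)
    also have "B * ?q j + B * ?q j = 2 * B * ?q j" by simp
    finally show ?thesis by (simp add: P_def card_cartesian_product)
  qed
  have mX: "(\<lambda>\<omega>. \<Sum>i=1..k. v p i * X i \<omega>) \<in> borel_measurable M" for k p
    by (intro borel_measurable_sum borel_measurable_times) auto
  have E_ev: "E k j p \<in> events" for k j p unfolding E_def using mX by measurable
  have mS: "(\<lambda>\<omega>. \<Sum>i=1..k. (X i \<omega>)\<^sup>2) \<in> borel_measurable M" for k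
    by (intro borel_measurable_sum borel_measurable_power) auto
  have S_ev: "S k \<in> events" for k unfolding S_def using mS by measurable
  have A_ev: "A k \<in> events" for k
    unfolding A_def using finP E_ev S_ev by (intro sets.Un sets.finite_UN) auto
  have EP: "prob (\<Union>p\<in>P j. E k j p) \<le> 8 / real k ^ 4" if k: "1 \<le> k" for k j
  proof -
    have arg: "0 \<le> 2 * B * ?q j + 4 * ln (real k)" using B k by (intro add_nonneg_nonneg) auto
    have "(t k j)\<^sup>2 / 2 = 2 * B * ?q j + 4 * ln (real k)" unfolding t_def using arg by simp
    then have ex: "exp (- (t k j)\<^sup>2 / 2) = exp (- (2 * B * ?q j) - 4 * ln (real k))"
      by simp
    also have "\<dots> = exp (- (2 * B * ?q j)) / real k ^ 4"
    proof -
      have "exp (4 * ln (real k)) = real k ^ 4"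
        using k by (metis exp_ln exp_of_nat_mult of_nat_0_less_iff of_nat_numeral less_le_trans zero_less_one)
      then show ?thesis by (simp add: exp_diff)
    qed
    finally have ex: "exp (- (t k j)\<^sup>2 / 2) = exp (- (2 * B * ?q j)) / real k ^ 4" .
    have t0: "0 \<le> t k j" using arg by (simp add: t_def)
    have "prob (\<Union>p\<in>P j. E k j p) \<le> (\<Sum>p\<in>P j. prob (E k j p))"
      by (rule measure_UNION_le) (use finP E_ev in auto)
    also have "\<dots> \<le> (\<Sum>p\<in>P j. 2 * exp (- (t k j)\<^sup>2 / 2))"
      unfolding E_def by (intro sum_mono noise_tail[OF noise \<sigma>] t0) auto
    also have "\<dots> = real (card (P j)) * (2 * exp (- (t k j)\<^sup>2 / 2))" by simp
    also have "\<dots> \<le> (4 * exp (2 * B * ?q j)) * (2 * exp (- (t k j)\<^sup>2 / 2))"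
      by (intro mult_right_mono cardP) auto
    also have "\<dots> = 8 * (exp (2 * B * ?q j) * exp (- (2 * B * ?q j))) / real k ^ 4" unfolding ex by simp
    also have "\<dots> = 8 / real k ^ 4" by (simp add: exp_minus)
    finally show ?thesis .
  qed
  have pA: "prob (A k) \<le> (3/4) ^ k + 8 * (1 / real k ^ 3)" if k: "1 \<le> k" for k
  proof -
    have "prob (A k) \<le> prob (S k) + prob (\<Union>j<k. \<Union>p\<in>P j. E k j p)"
      unfolding A_def using finP E_ev S_ev by (intro measure_Un_le sets.finite_UN) auto
    also have "prob (\<Union>j<k. \<Union>p\<in>P j. E k j p) \<le> (\<Sum>j<k. prob (\<Union>p\<in>P j. E k j p))"
      by (rule measure_UNION_le) (use finP E_ev in \<open>auto intro: sets.finite_UN\<close>)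
    also have "\<dots> \<le> (\<Sum>j<k. 8 / real k ^ 4)" by (intro sum_mono EP k)
    also have "\<dots> = 8 * (1 / real k ^ 3)" using k by (simp add: power_def field_simps eval_nat_numeral)
    also have "prob (S k) \<le> (3/4) ^ k" unfolding S_def by (rule noise_square_tail[OF noise \<sigma>])
    finally show ?thesis by simp
  qed
  have "summable (\<lambda>k. (3/4) ^ k + 8 * (1 / real k ^ 3))"
    using inverse_power_summable[of 3, where 'a=real]
    by (intro summable_add summable_geometric summable_mult) (auto simp: inverse_eq_divide)
  then have "summable (\<lambda>k. prob (A k))"
    by (rule summable_comparison_test'[where N=1]) (use pA in auto)
  then have "AE \<omega> in M. eventually (\<lambda>k. \<omega> \<in> space M - A k) sequentially"
    by (intro borel_cantelli_AE1 A_ev) (auto simp: emeasure_eq_measure)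
  then show ?thesis
  proof (rule AE_mp, intro AE_I2 impI)
    fix \<omega> assume "eventually (\<lambda>k. \<omega> \<in> space M - A k) sequentially"
    then obtain N where N: "\<And>k. N \<le> k \<Longrightarrow> \<omega> \<in> space M - A k" by (auto simp: eventually_sequentially)
    show "\<exists>N. \<forall>k\<ge>N. noise_good T B u \<sigma> k (\<lambda>i. X i \<omega>)"
    proof (intro exI allI impI)
      fix k assume "N \<le> k"
      then have w: "\<omega> \<in> space M" "\<omega> \<notin> S k" "\<And>j p. j < k \<Longrightarrow> p \<in> P j \<Longrightarrow> \<omega> \<notin> E k j p"
        using N[of k] by (auto simp: A_def)
      have "\<bar>\<Sum>i=1..k. v p i * X i \<omega>\<bar> \<le> \<sigma> * t k j * sqrt (\<Sum>i=1..k. (v p i)\<^sup>2)" if "j < k" "p \<in> P j" for j p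
        using w(3)[OF that] w(1) by (simp add: E_def not_less)
      then show "noise_good T B u \<sigma> k (\<lambda>i. X i \<omega>)"
        using w(1,2) unfolding noise_good_def S_def P_def t_def v_def by (auto simp: not_less)
    qed
  qed
qed

section \<open>Chaining\<close>

lemma L2_set_le_bound:
  assumes "\<And>i. i \<in> {1..k} \<Longrightarrow> \<bar>f i\<bar> \<le> b" "0 \<le> b"
  shows "L2_set f {1..k} \<le> sqrt (real k) * b"
proof -
  have "(\<Sum>i=1..k. (f i)\<^sup>2) \<le> (\<Sum>i=1..k. b\<^sup>2)"
    using assms by (intro sum_mono) (simp add: abs_le_square_iff[symmetric])
  then have "L2_set f {1..k} \<le> sqrt (real k * b\<^sup>2)" unfolding L2_set_def by simp
  then show ?thesis using assms(2) by (simp add: real_sqrt_mult)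
qed

text \<open>Both bodies are joined to nearby members of the nets through all scales between \<open>4 ^ - j0\<close> and
  \<open>4 ^ - j1\<close>.  Only the coarsest links are compared with the distance of the two bodies; the finer ones
  are estimated by their sup norm, and below the finest scale the noise is summed absolutely.\<close>

lemma chaining_bound:
  fixes u :: "nat \<Rightarrow> 'a::euclidean_space" and j0 j1 k :: nat
  assumes good: "noise_good T B u \<sigma> k x" and \<sigma>: "0 < \<sigma>" and B: "0 \<le> B"
    and net: "\<And>j K. body_in 1 K \<Longrightarrow> \<exists>L\<in>T j. \<forall>v. norm v = 1 \<longrightarrow>
        \<bar>support_fun K v - support_fun L v\<bar> \<le> a / 4 ^ j"
    and u: "\<And>i. i \<in> {1..k} \<Longrightarrow> norm (u i) = 1"
    and K: "body_in 1 K" and L: "body_in 1 L"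
    and j: "j0 \<le> j1" "j1 < k" and lnk: "ln (real k) \<le> 2 ^ (j0 * (DIM('a) - 1))"
  defines "\<tau> \<equiv> sqrt (2 ^ (DIM('a) - 1))" and "b \<equiv> sqrt (4 * B + 8)"
  shows "(\<Sum>i=1..k. (support_fun K (u i) - support_fun L (u i)) * x i)
    \<le> (b * \<tau> + 6 * a * b * \<tau> + 4 * a) * \<sigma> *
      (\<tau> ^ j0 * L2_set (\<lambda>i. support_fun K (u i) - support_fun L (u i)) {1..k}
       + sqrt (real k) * (\<Sum>j=j0..j1. (\<tau> / 4) ^ j) + real k / 4 ^ j1)"
proof -
  let ?d = "DIM('a) - 1"
  define Y where "Y = (\<lambda>M::'a set. \<Sum>i=1..k. support_fun M (u i) * x i)"
  define N where "N = (\<lambda>M M'::'a set. L2_set (\<lambda>i. support_fun M (u i) - support_fun M' (u i)) {1..k})"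
  define near where "near = (\<lambda>\<epsilon> (M::'a set) M'. \<forall>i\<in>{1..k}. \<bar>support_fun M (u i) - support_fun M' (u i)\<bar> \<le> \<epsilon>)"
  have "\<exists>f. \<forall>j. f j \<in> T j \<and> near (a / 4 ^ j) M (f j)" if "body_in 1 M" for M
    using net[OF that] u unfolding near_def by (metis)
  then obtain f g where f: "\<And>j. f j \<in> T j" "\<And>j. near (a / 4 ^ j) K (f j)"
    and g: "\<And>j. g j \<in> T j" "\<And>j. near (a / 4 ^ j) L (g j)"
    using K L by metis
  have k0: "0 < k" using j by simp
  then have "1 \<in> {1..k}" by simp
  then have "\<bar>support_fun K (u 1) - support_fun (f 0) (u 1)\<bar> \<le> a / 4 ^ 0"
    using f(2)[of 0] unfolding near_def by blast
  then have a: "0 \<le> a" by simp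
  have near_comm: "near \<epsilon> M M' \<Longrightarrow> near \<epsilon> M' M" for \<epsilon> M M'
    by (simp add: near_def abs_minus_commute)
  have near_trans: "near (\<epsilon> + \<epsilon>') M M''" if "near \<epsilon> M M'" "near \<epsilon>' M' M''" for \<epsilon> \<epsilon>' M M' M''
    unfolding near_def
  proof
    fix i assume "i \<in> {1..k}"
    then have "\<bar>support_fun M (u i) - support_fun M' (u i)\<bar> \<le> \<epsilon>"
      "\<bar>support_fun M' (u i) - support_fun M'' (u i)\<bar> \<le> \<epsilon>'" using that by (auto simp: near_def)
    then show "\<bar>support_fun M (u i) - support_fun M'' (u i)\<bar> \<le> \<epsilon> + \<epsilon>'" by linarith
  qed
  have N_near: "N M M' \<le> sqrt (real k) * \<epsilon>" if "near \<epsilon> M M'" "0 \<le> \<epsilon>" for \<epsilon> M M'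
    unfolding N_def by (rule L2_set_le_bound) (use that in \<open>auto simp: near_def\<close>)
  have N_tri: "N M M'' \<le> N M M' + N M' M''" for M M' M''
    unfolding N_def using L2_set_triangle_ineq[of "\<lambda>i. support_fun M (u i) - support_fun M' (u i)"
        "\<lambda>i. support_fun M' (u i) - support_fun M'' (u i)" "{1..k}"] by simp
  have \<tau>2: "\<tau>\<^sup>2 = 2 ^ ?d" by (simp add: \<tau>_def)
  have \<tau>0: "0 < \<tau>" by (simp add: \<tau>_def)
  have b0: "0 \<le> b" using B by (simp add: b_def)
  have \<tau>p: "sqrt (2 ^ (m * ?d)) = \<tau> ^ m" for m
  proof (rule real_sqrt_unique)
    have "(\<tau> ^ m)\<^sup>2 = (\<tau>\<^sup>2) ^ m" by (simp only: power_mult[symmetric] mult.commute)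
    also have "\<dots> = 2 ^ (m * ?d)" unfolding \<tau>2 by (simp only: power_mult[symmetric] mult.commute)
    finally show "(\<tau> ^ m)\<^sup>2 = 2 ^ (m * ?d)" .
  qed (use \<tau>0 in simp)
  have level: "sqrt (2 * (2 * B * 2 ^ (Suc j * ?d) + 4 * ln (real k))) \<le> b * \<tau> ^ Suc j" if "j0 \<le> j" for j
  proof -
    have "(2::real) ^ (j0 * ?d) \<le> 2 ^ (Suc j * ?d)" using that by (intro power_increasing mult_right_mono) auto
    then have "ln (real k) \<le> 2 ^ (Suc j * ?d)" using lnk by linarith
    moreover have "2 * (2 * B * p + 4 * l) \<le> (4 * B + 8) * p" if "l \<le> p" for p l
      using that by (simp add: algebra_simps)
    ultimately have "2 * (2 * B * 2 ^ (Suc j * ?d) + 4 * ln (real k)) \<le> (4 * B + 8) * 2 ^ (Suc j * ?d)"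
      by blast
    then have "sqrt (2 * (2 * B * 2 ^ (Suc j * ?d) + 4 * ln (real k))) \<le> sqrt ((4 * B + 8) * 2 ^ (Suc j * ?d))"
      by (rule real_sqrt_le_mono)
    then show ?thesis unfolding real_sqrt_mult \<tau>p b_def .
  qed
  have Y_diff: "\<bar>Y M - Y M'\<bar> \<le> \<sigma> * (b * \<tau> ^ Suc j) * N M M'"
    if "j0 \<le> j" "j < k" "M \<in> T j \<union> T (Suc j)" "M' \<in> T j \<union> T (Suc j)" for j M M'
  proof -
    have eq: "Y M - Y M' = (\<Sum>i=1..k. (support_fun M (u i) - support_fun M' (u i)) * x i)"
      by (simp add: Y_def sum_subtractf left_diff_distrib)
    have "\<bar>Y M - Y M'\<bar> \<le> \<sigma> * sqrt (2 * (2 * B * 2 ^ (Suc j * ?d) + 4 * ln (real k))) * N M M'"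
      unfolding eq N_def L2_set_def using good that(2-4) unfolding noise_good_def by blast
    also have "\<dots> \<le> \<sigma> * (b * \<tau> ^ Suc j) * N M M'"
      using \<sigma> level[OF that(1)] by (intro mult_right_mono mult_left_mono) (auto simp: N_def L2_set_nonneg)
    finally show ?thesis .
  qed
  define S where "S = (\<Sum>j\<in>{j0..<j1}. (\<tau> / 4) ^ j)"
  have chain: "\<bar>Y (h j1) - Y (h j0)\<bar> \<le> 2 * a * b * \<tau> * \<sigma> * sqrt (real k) * S"
    if h: "\<And>j. h j \<in> T j" "\<And>j. near (a / 4 ^ j) M (h j)" for h M
  proof -
    have "Y (h j1) - Y (h j0) = (\<Sum>j\<in>{j0..<j1}. Y (h (Suc j)) - Y (h j))"
      using sum_Suc_diff'[OF j(1), of "\<lambda>j. Y (h j)"] by simp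
    then have "\<bar>Y (h j1) - Y (h j0)\<bar> \<le> (\<Sum>j\<in>{j0..<j1}. \<bar>Y (h (Suc j)) - Y (h j)\<bar>)" by simp
    also have "\<dots> \<le> (\<Sum>j\<in>{j0..<j1}. 2 * a * b * \<tau> * \<sigma> * sqrt (real k) * (\<tau> / 4) ^ j)"
    proof (rule sum_mono)
      fix j assume "j \<in> {j0..<j1}"
      then have jj: "j0 \<le> j" "j < k" using j by auto
      have "near (a / 4 ^ Suc j + a / 4 ^ j) (h (Suc j)) (h j)"
        by (rule near_trans[OF near_comm[OF h(2)] h(2)])
      moreover have "a / 4 ^ Suc j \<le> a / 4 ^ j" using a by (intro divide_left_mono) auto
      ultimately have "near (2 * (a / 4 ^ j)) (h (Suc j)) (h j)"
        unfolding near_def by (smt (verit))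
      then have nn: "N (h (Suc j)) (h j) \<le> sqrt (real k) * (2 * (a / 4 ^ j))"
        by (rule N_near) (use a in auto)
      have "\<bar>Y (h (Suc j)) - Y (h j)\<bar> \<le> \<sigma> * (b * \<tau> ^ Suc j) * N (h (Suc j)) (h j)"
        by (rule Y_diff[OF jj]) (use h(1) in auto)
      also have "\<dots> \<le> \<sigma> * (b * \<tau> ^ Suc j) * (sqrt (real k) * (2 * (a / 4 ^ j)))"
        using \<sigma> b0 \<tau>0 by (intro mult_left_mono nn) auto
      also have "\<dots> = 2 * a * b * \<tau> * \<sigma> * sqrt (real k) * (\<tau> / 4) ^ j"
        by (simp add: power_divide)
      finally show "\<bar>Y (h (Suc j)) - Y (h j)\<bar> \<le> 2 * a * b * \<tau> * \<sigma> * sqrt (real k) * (\<tau> / 4) ^ j" .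
    qed
    finally show ?thesis by (simp add: S_def sum_distrib_left)
  qed
  have tail: "\<bar>Y M - Y M'\<bar> \<le> 2 * a * \<sigma> * (real k / 4 ^ j1)" if "near (a / 4 ^ j1) M M'" for M M'
  proof -
    have "Y M - Y M' = (\<Sum>i=1..k. (support_fun M (u i) - support_fun M' (u i)) * x i)"
      by (simp add: Y_def sum_subtractf left_diff_distrib)
    also have "\<bar>\<dots>\<bar> \<le> (\<Sum>i=1..k. \<bar>support_fun M (u i) - support_fun M' (u i)\<bar> * \<bar>x i\<bar>)"
      by (rule order_trans[OF sum_abs]) (simp add: abs_mult)
    also have "\<dots> \<le> N M M' * L2_set x {1..k}" unfolding N_def by (rule L2_set_mult_ineq)
    also have "\<dots> \<le> (sqrt (real k) * (a / 4 ^ j1)) * (2 * \<sigma> * sqrt (real k))"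
    proof (intro mult_mono)
      show "N M M' \<le> sqrt (real k) * (a / 4 ^ j1)" by (rule N_near[OF that]) (use a in auto)
      have "L2_set x {1..k} \<le> sqrt (4 * \<sigma>\<^sup>2 * real k)"
        unfolding L2_set_def using good by (intro real_sqrt_le_mono) (simp add: noise_good_def)
      also have "\<dots> = 2 * \<sigma> * sqrt (real k)" using \<sigma> by (simp add: real_sqrt_mult)
      finally show "L2_set x {1..k} \<le> 2 * \<sigma> * sqrt (real k)" .
    qed (use a in \<open>auto simp: L2_set_nonneg\<close>)
    also have "\<dots> = 2 * a * \<sigma> * ((sqrt (real k) * sqrt (real k)) / 4 ^ j1)" by simp
    also have "\<dots> = 2 * a * \<sigma> * (real k / 4 ^ j1)" by simp
    finally show ?thesis .
  qed
  have coarse: "\<bar>Y (f j0) - Y (g j0)\<bar>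
      \<le> \<sigma> * b * \<tau> * \<tau> ^ j0 * N K L + 2 * a * b * \<tau> * \<sigma> * sqrt (real k) * (\<tau> / 4) ^ j0"
  proof -
    define e where "e = sqrt (real k) * (a / 4 ^ j0)"
    have N0: "N M M' \<le> e" if "near (a / 4 ^ j0) M M'" for M M'
      unfolding e_def by (rule N_near[OF that]) (use a in auto)
    have "N (f j0) (g j0) \<le> N (f j0) K + (N K L + N L (g j0))"
      using N_tri[of "f j0" "g j0" K] N_tri[of K "g j0" L] by linarith
    also have "\<dots> \<le> N K L + 2 * e"
      using N0[OF near_comm[OF f(2)]] N0[OF g(2)] by linarith
    finally have n: "N (f j0) (g j0) \<le> N K L + 2 * e" .
    have "\<bar>Y (f j0) - Y (g j0)\<bar> \<le> \<sigma> * (b * \<tau> ^ Suc j0) * N (f j0) (g j0)"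
      by (rule Y_diff) (use f(1) g(1) j in auto)
    also have "\<dots> \<le> \<sigma> * (b * \<tau> ^ Suc j0) * (N K L + 2 * e)"
      using \<sigma> b0 \<tau>0 by (intro mult_left_mono n) auto
    also have "\<dots> = \<sigma> * b * \<tau> * \<tau> ^ j0 * N K L + 2 * a * b * \<tau> * \<sigma> * sqrt (real k) * (\<tau> / 4) ^ j0"
      by (simp add: e_def power_divide algebra_simps)
    finally show ?thesis .
  qed
  define c where "c = a * b * \<tau> * \<sigma> * sqrt (real k)"
  have c: "0 \<le> c" using a b0 \<tau>0 \<sigma> by (simp add: c_def)
  have "Y K - Y L \<le> \<bar>Y K - Y (f j1)\<bar> + \<bar>Y (f j1) - Y (f j0)\<bar> + \<bar>Y (f j0) - Y (g j0)\<bar>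
      + \<bar>Y (g j1) - Y (g j0)\<bar> + \<bar>Y L - Y (g j1)\<bar>" by linarith
  also have "\<dots> \<le> \<sigma> * b * \<tau> * \<tau> ^ j0 * N K L + (2 * c * (\<tau> / 4) ^ j0 + 4 * c * S)
      + 4 * a * \<sigma> * (real k / 4 ^ j1)"
  proof -
    define w where "w = a * \<sigma> * (real k / 4 ^ j1)"
    define m where "m = \<sigma> * b * \<tau> * \<tau> ^ j0 * N K L"
    define p where "p = c * (\<tau> / 4) ^ j0"
    define r where "r = c * S"
    have "\<bar>Y K - Y (f j1)\<bar> \<le> 2 * w" "\<bar>Y L - Y (g j1)\<bar> \<le> 2 * w"
      using tail[OF f(2)] tail[OF g(2)] by (simp_all add: w_def)
    moreover have "\<bar>Y (f j1) - Y (f j0)\<bar> \<le> 2 * r" "\<bar>Y (g j1) - Y (g j0)\<bar> \<le> 2 * r"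
      using chain[OF f] chain[OF g] by (simp_all add: r_def c_def mult_ac)
    moreover have "\<bar>Y (f j0) - Y (g j0)\<bar> \<le> m + 2 * p"
      using coarse by (simp add: p_def m_def c_def mult_ac)
    ultimately have "\<bar>Y K - Y (f j1)\<bar> + \<bar>Y (f j1) - Y (f j0)\<bar> + \<bar>Y (f j0) - Y (g j0)\<bar>
      + \<bar>Y (g j1) - Y (g j0)\<bar> + \<bar>Y L - Y (g j1)\<bar> \<le> m + (2 * p + 4 * r) + 4 * w" by linarith
    then show ?thesis by (simp add: w_def m_def p_def r_def mult_ac)
  qed
  also have "2 * c * (\<tau> / 4) ^ j0 + 4 * c * S \<le> 6 * c * (\<Sum>j=j0..j1. (\<tau> / 4) ^ j)"
  proof -
    have "S \<le> (\<Sum>j=j0..j1. (\<tau> / 4) ^ j)"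
      unfolding S_def using \<tau>0 by (intro sum_mono2) auto
    moreover have "(\<tau> / 4) ^ j0 \<le> (\<Sum>j=j0..j1. (\<tau> / 4) ^ j)"
      by (rule member_le_sum) (use j \<tau>0 in auto)
    ultimately have "c * S \<le> c * (\<Sum>j=j0..j1. (\<tau> / 4) ^ j)"
      "c * (\<tau> / 4) ^ j0 \<le> c * (\<Sum>j=j0..j1. (\<tau> / 4) ^ j)"
      using c by (auto intro: mult_left_mono)
    then show ?thesis by simp
  qed
  finally have "Y K - Y L \<le> \<sigma> * (b * \<tau>) * (\<tau> ^ j0 * N K L)
      + \<sigma> * (6 * a * b * \<tau>) * (sqrt (real k) * (\<Sum>j=j0..j1. (\<tau> / 4) ^ j))
      + \<sigma> * (4 * a) * (real k / 4 ^ j1)"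
    by (simp add: c_def mult_ac)
  also have "\<dots> \<le> \<sigma> * (b * \<tau> + 6 * a * b * \<tau> + 4 * a) * (\<tau> ^ j0 * N K L)
      + \<sigma> * (b * \<tau> + 6 * a * b * \<tau> + 4 * a) * (sqrt (real k) * (\<Sum>j=j0..j1. (\<tau> / 4) ^ j))
      + \<sigma> * (b * \<tau> + 6 * a * b * \<tau> + 4 * a) * (real k / 4 ^ j1)"
    using \<sigma> a b0 \<tau>0
    by (intro add_mono mult_right_mono mult_left_mono) (auto simp: N_def L2_set_nonneg intro!: mult_nonneg_nonneg sum_nonneg)
  also have "\<dots> = (b * \<tau> + 6 * a * b * \<tau> + 4 * a) * \<sigma> *
      (\<tau> ^ j0 * N K L + sqrt (real k) * (\<Sum>j=j0..j1. (\<tau> / 4) ^ j) + real k / 4 ^ j1)"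
    by (simp only: distrib_left mult_ac)
  also have "Y K - Y L = (\<Sum>i=1..k. (support_fun K (u i) - support_fun L (u i)) * x i)"
    by (simp add: Y_def sum_subtractf left_diff_distrib)
  finally show ?thesis unfolding N_def .
qed

section \<open>Choice of the scales and rates of convergence\<close>

text \<open>The order of the geometric sum of the errors of the links from the scale \<open>2 ^ j0 \<approx> \<theta>\<close> to the finest
  scale \<open>2 ^ j1 \<approx> k powr (1 / d)\<close>.\<close>

definition scale_sum :: "nat \<Rightarrow> real \<Rightarrow> real \<Rightarrow> real" where
  "scale_sum d \<theta> k =
     (if d \<le> 3 then \<theta> powr (real d / 2 - 2) else if d = 4 then 1 + ln k else k powr (1 / 2 - 2 / real d))"

lemma scale_sum_nonneg: "1 \<le> k \<Longrightarrow> 0 \<le> scale_sum d \<theta> k"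
  by (simp add: scale_sum_def)

lemma sqrt_two_power:
  "sqrt (2 ^ d) ^ j = (2 ^ j) powr (real d / 2)" "(sqrt (2 ^ d) / 4) ^ j = (2 ^ j) powr (real d / 2 - 2)"
proof -
  have "sqrt (2 ^ d) = 2 powr (real d / 2)"
    by (simp add: powr_half_sqrt[symmetric] powr_realpow[symmetric] powr_powr)
  then show 1: "sqrt (2 ^ d) ^ j = (2 ^ j) powr (real d / 2)"
    by (simp add: powr_realpow[symmetric] powr_powr mult.commute)
  have "(4::real) ^ j = (2 ^ j) powr 2"
    by (simp add: power_mult[symmetric] power2_eq_square power_mult_distrib[symmetric])
  then show "(sqrt (2 ^ d) / 4) ^ j = (2 ^ j) powr (real d / 2 - 2)"
    by (simp add: power_divide 1 powr_diff)
qed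

text \<open>The three regimes of dimension: the sum over the scales is dominated by the coarsest scale, by all
  scales alike, or by the finest scale.\<close>

lemma scale_sum_bound:
  assumes d: "1 \<le> d"
  obtains C :: real where "0 < C"
    "\<And>\<theta> k j0 j1. 1 \<le> k \<Longrightarrow> 0 < \<theta> \<Longrightarrow> j0 \<le> j1 \<Longrightarrow> \<theta> / 2 \<le> 2 ^ j0 \<Longrightarrow> 2 ^ j1 \<le> 2 * k powr (1 / real d)
      \<Longrightarrow> (\<Sum>j=j0..j1. (sqrt (2 ^ d) / 4) ^ j) \<le> C * scale_sum d \<theta> k"
proof -
  define e where "e = real d / 2 - 2"
  define q where "q = sqrt (2 ^ d) / 4"
  have q: "q = 2 powr e" using sqrt_two_power(2)[of d 1] by (simp add: q_def e_def)
  have qp: "q ^ j = (2 ^ j) powr e" for j using sqrt_two_power(2)[of d j] by (simp add: q_def e_def)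
  have q0: "0 < q" by (simp add: q)
  consider "d \<le> 3" | "d = 4" | "5 \<le> d" by linarith
  then show ?thesis
  proof cases
    case 1
    then have e: "e < 0" by (simp add: e_def)
    then have q1: "q < 1" by (simp add: q powr_less_one)
    show ?thesis
    proof (rule that[of "2 powr (- e) / (1 - q)"])
      show "0 < 2 powr (- e) / (1 - q)" using q1 by simp
      fix \<theta> k :: real and j0 j1 :: nat
      assume *: "0 < \<theta>" "j0 \<le> j1" "\<theta> / 2 \<le> 2 ^ j0"
      have "(1 - q) * (\<Sum>j=j0..j1. q ^ j) = q ^ j0 - q ^ Suc j1" by (rule sum_gp_multiplied[OF *(2)])
      also have "\<dots> \<le> q ^ j0" using q0 by simp
      also have "\<dots> \<le> (\<theta> / 2) powr e" unfolding qp using e * by (intro powr_mono2') auto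
      also have "\<dots> = \<theta> powr e * 2 powr (- e)" using * by (simp add: powr_divide powr_minus_divide)
      finally show "(\<Sum>j=j0..j1. (sqrt (2 ^ d) / 4) ^ j) \<le> 2 powr (- e) / (1 - q) * scale_sum d \<theta> k"
        unfolding q_def[symmetric] using q1 1 by (simp add: scale_sum_def e_def field_simps)
    qed
  next
    case 2
    then have q1: "q = 1" by (simp add: q e_def)
    show ?thesis
    proof (rule that[of "4"])
      show "0 < (4::real)" by simp
      fix \<theta> k :: real and j0 j1 :: nat
      assume *: "1 \<le> k" "j0 \<le> j1" "2 ^ j1 \<le> 2 * k powr (1 / real d)"
      have "ln (2 ^ j1) \<le> ln (2 * k powr (1 / real d))" using * by simp
      also have "\<dots> = ln 2 + ln k / 4" using * 2 by (simp add: ln_mult ln_powr)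
      finally have "real j1 * ln 2 \<le> ln 2 + ln k / 4" by (simp add: ln_realpow)
      moreover have "1 / 2 \<le> ln (2::real)" using ln2_ge_two_thirds by simp
      moreover have "ln (2::real) \<le> 1" using ln2_le_25_over_36 by simp
      moreover have "real j1 * (1 / 2) \<le> real j1 * ln 2" using calculation(2) by (intro mult_left_mono) auto
      ultimately have "real j1 \<le> 2 + ln k / 2" by linarith
      moreover have "0 \<le> ln k" using * by simp
      moreover have "(\<Sum>j=j0..j1. q ^ j) \<le> real j1 + 1" by (simp add: q1)
      ultimately show "(\<Sum>j=j0..j1. (sqrt (2 ^ d) / 4) ^ j) \<le> 4 * scale_sum d \<theta> k"
        unfolding q_def[symmetric] scale_sum_def using 2 by simp
    qed
  next
    case 3
    then have e: "0 < e" by (simp add: e_def)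
    then have q1: "1 < q" using gr_one_powr[of 2 e] by (simp add: q)
    show ?thesis
    proof (rule that[of "q * 2 powr e / (q - 1)"])
      show "0 < q * 2 powr e / (q - 1)" using q1 by simp
      fix \<theta> k :: real and j0 j1 :: nat
      assume *: "1 \<le> k" "j0 \<le> j1" "2 ^ j1 \<le> 2 * k powr (1 / real d)"
      have "(1 - q) * (\<Sum>j=j0..j1. q ^ j) = q ^ j0 - q ^ Suc j1" by (rule sum_gp_multiplied[OF *(2)])
      then have "(q - 1) * (\<Sum>j=j0..j1. q ^ j) = q ^ Suc j1 - q ^ j0" by (simp add: algebra_simps)
      also have "\<dots> \<le> q * q ^ j1" using q0 by simp
      also have "q ^ j1 \<le> (2 * k powr (1 / real d)) powr e" unfolding qp using e * by (intro powr_mono2) auto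
      also have "(2 * k powr (1 / real d)) powr e = 2 powr e * k powr (1 / real d * e)"
        using * by (simp add: powr_mult powr_powr)
      also have "1 / real d * e = 1 / 2 - 2 / real d" using 3 by (simp add: e_def field_simps)
      finally have "(q - 1) * (\<Sum>j=j0..j1. q ^ j) \<le> q * (2 powr e * k powr (1 / 2 - 2 / real d))"
        using q0 by simp
      then show "(\<Sum>j=j0..j1. (sqrt (2 ^ d) / 4) ^ j) \<le> q * 2 powr e / (q - 1) * scale_sum d \<theta> k"
        unfolding q_def[symmetric] using q1 3 by (simp add: scale_sum_def field_simps)
    qed
  qed
qed

lemma dyadic_below:
  assumes "1 \<le> (y::real)"
  obtains j :: nat where "2 ^ j \<le> y" "y \<le> 2 * 2 ^ j"
proof -
  define j where "j = nat \<lfloor>log 2 y\<rfloor>"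
  have l: "0 \<le> log 2 y" using assms by simp
  then have j: "real j \<le> log 2 y" "log 2 y \<le> real j + 1" unfolding j_def by linarith+
  have y: "2 powr log 2 y = y" using assms by simp
  have "2 powr real j \<le> 2 powr log 2 y" using j by simp
  then have 1: "2 ^ j \<le> y" unfolding y by (simp add: powr_realpow)
  have "2 powr log 2 y \<le> 2 powr (real j + 1)" using j by simp
  then have "y \<le> 2 * 2 ^ j" unfolding y by (simp add: powr_add powr_realpow)
  then show ?thesis using that 1 by blast
qed

lemma le_of_square_le:
  fixes x p q :: real
  assumes "x\<^sup>2 \<le> p * x + q" "0 \<le> p" "0 \<le> q"
  shows "x \<le> p + sqrt q"
proof (rule ccontr)
  assume "\<not> ?thesis"
  then have *: "sqrt q < x - p" by simp
  have s: "0 \<le> sqrt q" using assms by simp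
  have p: "0 \<le> x - p" "x - p \<le> x" using * s assms(2) by linarith+
  have "sqrt q * sqrt q < (x - p) * (x - p)" using * s by (intro mult_strict_mono') auto
  also have "\<dots> \<le> x * (x - p)" using p by (intro mult_right_mono)
  finally have "q < x * (x - p)" using assms by simp
  then show False using assms(1) by (simp add: power2_eq_square algebra_simps)
qed

text \<open>The scale parameter \<open>\<theta>\<close> stands for \<open>2 ^ j0\<close> and remains free; the finest scale is the one at which
  the net has about \<open>exp k\<close> members.\<close>

lemma empirical_bound:
  fixes u :: "nat \<Rightarrow> 'a::euclidean_space"
  assumes B: "0 \<le> B" and a: "0 \<le> a" and d1: "1 \<le> DIM('a) - 1"
    and net: "\<And>j K. body_in 1 K \<Longrightarrow> \<exists>L\<in>T j. \<forall>v. norm v = 1 \<longrightarrow>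
        \<bar>support_fun K v - support_fun L v\<bar> \<le> a / 4 ^ j"
  defines "d \<equiv> DIM('a) - 1"
  obtains C :: real where "0 < C"
    "\<And>k x \<sigma> \<rho> K L \<theta>. \<lbrakk>noise_good T B u \<sigma> k x; 0 < \<sigma>; 0 < \<rho>; body_in \<rho> K; body_in \<rho> L;
      \<And>i. i \<in> {1..k} \<Longrightarrow> norm (u i) = 1; 3 \<le> k; 1 \<le> \<theta>; \<theta> \<le> real k powr (1 / real d); ln (real k) \<le> (\<theta> / 2) ^ d;
      (\<Sum>i=1..k. (support_fun K (u i) - support_fun L (u i))\<^sup>2)
        \<le> 2 * (\<Sum>i=1..k. (support_fun K (u i) - support_fun L (u i)) * x i)\<rbrakk>
     \<Longrightarrow> L2_set (\<lambda>i. support_fun K (u i) - support_fun L (u i)) {1..k} / sqrt (real k)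
        \<le> C * \<rho> * (\<sigma> / \<rho> * \<theta> powr (real d / 2) / sqrt (real k)
          + sqrt (\<sigma> / \<rho> * (scale_sum d \<theta> (real k) / sqrt (real k) + real k powr (- 2 / real d))))"
proof -
  define \<tau> :: real where "\<tau> = sqrt (2 ^ d)"
  define b where "b = sqrt (4 * B + 8)"
  define C0 where "C0 = b * \<tau> + 6 * a * b * \<tau> + 4 * a"
  obtain C1 :: real where C1: "0 < C1"
    "\<And>\<theta> k j0 j1. 1 \<le> k \<Longrightarrow> 0 < \<theta> \<Longrightarrow> j0 \<le> j1 \<Longrightarrow> \<theta> / 2 \<le> 2 ^ j0 \<Longrightarrow> 2 ^ j1 \<le> 2 * k powr (1 / real d)
      \<Longrightarrow> (\<Sum>j=j0..j1. (sqrt (2 ^ d) / 4) ^ j) \<le> C1 * scale_sum d \<theta> k"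
    using scale_sum_bound[of d] d1 unfolding d_def by blast
  have C0: "0 \<le> C0" using a B by (simp add: C0_def b_def \<tau>_def)
  define C where "C = 2 * C0 * (1 + C1) + 1"
  have C: "1 \<le> C" "2 * C0 \<le> C" "2 * C0 * C1 \<le> C"
    using C0 C1(1) by (auto simp: C_def algebra_simps)
  show ?thesis
  proof (rule that[of C])
    show "0 < C" using C by simp
    fix k :: nat and x :: "nat \<Rightarrow> real" and \<sigma> \<rho> :: real and K L :: "'a set" and \<theta> :: real
    assume good: "noise_good T B u \<sigma> k x" and \<sigma>: "0 < \<sigma>" and \<rho>: "0 < \<rho>"
      and K: "body_in \<rho> K" and L: "body_in \<rho> L"
      and u: "\<And>i. i \<in> {1..k} \<Longrightarrow> norm (u i) = 1" and k: "3 \<le> k"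
      and \<theta>: "1 \<le> \<theta>" "\<theta> \<le> real k powr (1 / real d)" "ln (real k) \<le> (\<theta> / 2) ^ d"
      and basic: "(\<Sum>i=1..k. (support_fun K (u i) - support_fun L (u i))\<^sup>2)
        \<le> 2 * (\<Sum>i=1..k. (support_fun K (u i) - support_fun L (u i)) * x i)"
    define \<kappa> where "\<kappa> = real k powr (1 / real d)"
    obtain j0 where j0: "2 ^ j0 \<le> \<theta>" "\<theta> \<le> 2 * 2 ^ j0" using dyadic_below[OF \<theta>(1)] by blast
    have "1 \<le> \<kappa>" using \<theta> by (simp add: \<kappa>_def)
    then obtain j where j: "2 ^ j \<le> \<kappa>" "\<kappa> \<le> 2 * 2 ^ j" using dyadic_below by blast
    define j1 where "j1 = Suc j"
    have j1: "\<kappa> \<le> 2 ^ j1" "2 ^ j1 \<le> 2 * \<kappa>" using j by (auto simp: j1_def)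
    have "(2::real) ^ j0 \<le> 2 ^ j1" using j0(1) \<theta>(2) j1(1) unfolding \<kappa>_def by linarith
    then have j01: "j0 \<le> j1" by simp
    have "\<kappa> \<le> real k powr 1" unfolding \<kappa>_def using k d1 by (intro powr_mono) (auto simp: d_def)
    then have "2 ^ j1 \<le> 2 * real k" using j1(2) k by simp
    also have "2 * k < 2 ^ k" using k
      by (induction k rule: dec_induct) auto
    then have "2 * real k < 2 ^ k" by (metis of_nat_less_iff of_nat_mult of_nat_numeral of_nat_power)
    finally have j1k: "j1 < k" by simp
    have "(\<theta> / 2) ^ d \<le> (2 ^ j0) ^ d" using j0(2) \<theta>(1) by (intro power_mono) auto
    then have lnk: "ln (real k) \<le> 2 ^ (j0 * d)" using \<theta>(3) by (simp add: power_mult)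
    define s where "s = \<sigma> / \<rho>"
    have s: "0 < s" using \<sigma> \<rho> by (simp add: s_def)
    define K' where "K' = (*\<^sub>R) (1 / \<rho>) ` K"
    define L' where "L' = (*\<^sub>R) (1 / \<rho>) ` L"
    have KL': "body_in 1 K'" "body_in 1 L'" using body_in_scale K L \<rho> by (auto simp: K'_def L'_def)
    define g where "g = (\<lambda>i. support_fun K (u i) - support_fun L (u i))"
    define g' where "g' = (\<lambda>i. support_fun K' (u i) - support_fun L' (u i))"
    have gg: "g i = \<rho> * g' i" for i
      using support_fun_scale[OF K, of "1 / \<rho>" "u i"] support_fun_scale[OF L, of "1 / \<rho>" "u i"] \<rho>
      by (simp add: g_def g'_def K'_def L'_def field_simps)
    define N where "N = L2_set g' {1..k}"
    have N0: "0 \<le> N" by (simp add: N_def L2_set_nonneg)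
    have N2: "N\<^sup>2 = (\<Sum>i=1..k. (g' i)\<^sup>2)" by (simp add: N_def L2_set_def sum_nonneg)
    have Lg: "L2_set g {1..k} = \<rho> * N"
    proof -
      have "g = (\<lambda>i. \<rho> * g' i)" using gg by blast
      then show ?thesis unfolding N_def using \<rho> by (simp add: L2_set_right_distrib)
    qed
    define S where "S = (\<Sum>j=j0..j1. (\<tau> / 4) ^ j)"
    have S: "S \<le> C1 * scale_sum d \<theta> (real k)"
      unfolding S_def \<tau>_def by (rule C1(2)) (use j01 j0 j1 k \<theta> in \<open>auto simp: \<kappa>_def\<close>)
    have "(\<Sum>i=1..k. (g i)\<^sup>2) \<le> 2 * (\<Sum>i=1..k. g i * x i)" using basic unfolding g_def .
    then have "\<rho>\<^sup>2 * N\<^sup>2 \<le> 2 * (\<rho> * (\<Sum>i=1..k. g' i * x i))"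
      unfolding gg N2 by (simp add: power_mult_distrib sum_distrib_left mult.assoc)
    then have "\<rho> * (\<rho> * N\<^sup>2) \<le> \<rho> * (2 * (\<Sum>i=1..k. g' i * x i))"
      by (simp add: power2_eq_square mult_ac)
    then have "\<rho> * N\<^sup>2 \<le> 2 * (\<Sum>i=1..k. g' i * x i)" using \<rho> by simp
    also have "(\<Sum>i=1..k. g' i * x i) \<le> C0 * \<sigma> * (\<tau> ^ j0 * N + sqrt (real k) * S + real k / 4 ^ j1)"
      using chaining_bound[OF good \<sigma> B net u KL' j01 j1k] lnk
      unfolding C0_def b_def \<tau>_def d_def S_def N_def g'_def by simp
    finally have "\<rho> * N\<^sup>2 \<le> 2 * (C0 * \<sigma> * (\<tau> ^ j0 * N + sqrt (real k) * S + real k / 4 ^ j1))" by simp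
    then have "N\<^sup>2 \<le> 2 * (C0 * \<sigma> * (\<tau> ^ j0 * N + sqrt (real k) * S + real k / 4 ^ j1)) / \<rho>"
      using \<rho> by (simp add: pos_le_divide_eq mult.commute)
    also have "\<dots> = (2 * C0 * s * \<tau> ^ j0) * N + 2 * C0 * s * (sqrt (real k) * S + real k / 4 ^ j1)"
      using \<rho> by (simp add: s_def field_simps)
    finally have N1: "N \<le> 2 * C0 * s * \<tau> ^ j0 + sqrt (2 * C0 * s * (sqrt (real k) * S + real k / 4 ^ j1))"
    proof (rule le_of_square_le)
      have "0 \<le> S" unfolding S_def \<tau>_def by (intro sum_nonneg) auto
      then show "0 \<le> 2 * C0 * s * (sqrt (real k) * S + real k / 4 ^ j1)" using C0 s by simp
      show "0 \<le> 2 * C0 * s * \<tau> ^ j0" using C0 s by (simp add: \<tau>_def)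
    qed
    have e1: "2 * C0 * s * \<tau> ^ j0 \<le> C * (s * \<theta> powr (real d / 2))"
    proof -
      have "\<tau> ^ j0 \<le> \<theta> powr (real d / 2)"
        unfolding \<tau>_def sqrt_two_power using j0 by (intro powr_mono2) auto
      then have "(2 * C0) * (s * \<tau> ^ j0) \<le> C * (s * \<theta> powr (real d / 2))"
        using C C0 s by (intro mult_mono) (auto simp: \<tau>_def)
      then show ?thesis by (simp add: mult.assoc)
    qed
    define E where "E = s * (scale_sum d \<theta> (real k) / sqrt (real k) + real k powr (- 2 / real d))"
    have E0: "0 \<le> E" using s k scale_sum_nonneg[of "real k"] by (auto simp: E_def)
    have e2: "sqrt (2 * C0 * s * (sqrt (real k) * S + real k / 4 ^ j1)) \<le> C * (sqrt (real k) * sqrt E)"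
    proof -
      have "1 / 4 ^ j1 = ((2::real) ^ j1) powr - 2"
        by (simp add: powr_minus_divide power_mult[symmetric] power2_eq_square power_mult_distrib[symmetric])
      also have "\<dots> \<le> \<kappa> powr - 2" using j1 \<open>1 \<le> \<kappa>\<close> by (intro powr_mono2') auto
      also have "\<dots> = real k powr (- 2 / real d)" by (simp add: \<kappa>_def powr_powr)
      finally have f: "real k / 4 ^ j1 \<le> real k * real k powr (- 2 / real d)"
        using mult_left_mono[of "1 / 4 ^ j1" "real k powr (- 2 / real d)" "real k"] by simp
      have "2 * C0 * (sqrt (real k) * S) \<le> 2 * C0 * (sqrt (real k) * (C1 * scale_sum d \<theta> (real k)))"
        using C0 S by (intro mult_left_mono) auto
      also have "\<dots> = (2 * C0 * C1) * (sqrt (real k) * scale_sum d \<theta> (real k))" by simp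
      also have "\<dots> \<le> C * (sqrt (real k) * scale_sum d \<theta> (real k))"
        using C scale_sum_nonneg[of "real k" d \<theta>] k by (intro mult_right_mono) auto
      finally have g1: "2 * C0 * (sqrt (real k) * S) \<le> C * (sqrt (real k) * scale_sum d \<theta> (real k))" .
      have g2: "2 * C0 * (real k / 4 ^ j1) \<le> C * (real k * real k powr (- 2 / real d))"
        using f C C0 by (intro mult_mono) auto
      have "2 * C0 * s * (sqrt (real k) * S + real k / 4 ^ j1)
          = s * (2 * C0 * (sqrt (real k) * S) + 2 * C0 * (real k / 4 ^ j1))" by (simp add: algebra_simps)
      also have "\<dots> \<le> s * (C * (sqrt (real k) * scale_sum d \<theta> (real k)) + C * (real k * real k powr (- 2 / real d)))"
        using s g1 g2 by (intro mult_left_mono add_mono) auto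
      also have "\<dots> = C * (real k * E)"
      proof -
        have "sqrt (real k) = real k / sqrt (real k)" by (simp add: real_div_sqrt)
        then have "sqrt (real k) * scale_sum d \<theta> (real k) = real k * (scale_sum d \<theta> (real k) / sqrt (real k))"
          by (metis times_divide_eq_left times_divide_eq_right)
        then show ?thesis unfolding E_def by (simp only: distrib_left mult_ac)
      qed
      also have "\<dots> \<le> C\<^sup>2 * (real k * E)"
        using C E0 by (intro mult_right_mono) (auto simp: power2_eq_square)
      finally have "sqrt (2 * C0 * s * (sqrt (real k) * S + real k / 4 ^ j1)) \<le> sqrt (C\<^sup>2 * (real k * E))"
        by (rule real_sqrt_le_mono)
      then show ?thesis using C by (simp add: real_sqrt_mult)
    qed
    have "N \<le> C * (s * \<theta> powr (real d / 2)) + C * (sqrt (real k) * sqrt E)"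
      using N1 e1 e2 by linarith
    also have "\<dots> = C * (s * \<theta> powr (real d / 2) / sqrt (real k) + sqrt E) * sqrt (real k)"
      using k by (simp add: field_simps)
    finally have "N / sqrt (real k) \<le> C * (s * \<theta> powr (real d / 2) / sqrt (real k) + sqrt E)"
      using k by (simp add: pos_divide_le_eq)
    then have "\<rho> * (N / sqrt (real k)) \<le> \<rho> * (C * (s * \<theta> powr (real d / 2) / sqrt (real k) + sqrt E))"
      using \<rho> by (intro mult_left_mono) auto
    then show "L2_set (\<lambda>i. support_fun K (u i) - support_fun L (u i)) {1..k} / sqrt (real k)
        \<le> C * \<rho> * (\<sigma> / \<rho> * \<theta> powr (real d / 2) / sqrt (real k)
          + sqrt (\<sigma> / \<rho> * (scale_sum d \<theta> (real k) / sqrt (real k) + real k powr (- 2 / real d))))"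
      unfolding g_def[symmetric] Lg E_def s_def by (simp add: mult_ac)
  qed
qed

definition lsq_rate :: "nat \<Rightarrow> real \<Rightarrow> real \<Rightarrow> real \<Rightarrow> real" where
  "lsq_rate d \<sigma> \<rho> k =
     (if d \<le> 3 then \<sigma> powr (4 / (real d + 4)) * \<rho> powr (real d / (real d + 4)) * k powr (- 2 / (real d + 4))
      else if d = 4 then \<sigma> * k powr (- 1 / 4) * ln k
      else \<rho> * k powr (- 1 / real d))"

text \<open>The scale \<open>\<theta>\<close> balances the coarsest link against the sum over the finer scales: both are of order
  \<open>\<theta> powr - 2\<close> when \<open>\<theta> powr ((d + 4) / 2) = sqrt k * \<rho> / \<sigma>\<close>.  The error of order \<open>k powr (- 1 / d)\<close> from
  sampling the sphere is included and is of lower order.\<close>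

lemma rate_small_dim:
  assumes d: "1 \<le> d" "d \<le> 3" and \<sigma>: "0 < \<sigma>" "\<sigma> \<le> \<rho>" and C: "0 < C"
  shows "\<forall>\<^sub>F k :: nat in at_top. \<exists>\<theta>. 1 \<le> \<theta> \<and> \<theta> \<le> real k powr (1 / real d) \<and> ln (real k) \<le> (\<theta> / 2) ^ d \<and>
    C * \<rho> * (\<sigma> / \<rho> * \<theta> powr (real d / 2) / sqrt (real k)
          + sqrt (\<sigma> / \<rho> * (scale_sum d \<theta> (real k) / sqrt (real k) + real k powr (- 2 / real d))))
      + \<rho> * real k powr (- 1 / real d) \<le> (3 * C + 1) * lsq_rate d \<sigma> \<rho> (real k)"
proof -
  define s where "s = \<sigma> / \<rho>"
  have s: "0 < s" "s \<le> 1" and \<rho>: "0 < \<rho>" using \<sigma> by (auto simp: s_def)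
  define c where "c = s powr (- 2 / (real d + 4))"
  have c: "0 < c" using s by (simp add: c_def)
  define \<theta> where "\<theta> = (\<lambda>k::nat. c * real k powr (1 / (real d + 4)))"
  have d3: "d = 1 \<or> d = 2 \<or> d = 3" using d by auto
  have "\<forall>\<^sub>F k :: nat in at_top. 1 \<le> c * real k powr (1 / (real d + 4))"
    using d3 c by (elim disjE) (simp, real_asymp)+
  then have 1: "\<forall>\<^sub>F k :: nat in at_top. 1 \<le> \<theta> k" by (simp add: \<theta>_def)
  have "\<forall>\<^sub>F k :: nat in at_top. c * real k powr (1 / (real d + 4)) \<le> real k powr (1 / real d)"
    using d3 c by (elim disjE) (simp, real_asymp)+
  then have 2: "\<forall>\<^sub>F k :: nat in at_top. \<theta> k \<le> real k powr (1 / real d)" by (simp add: \<theta>_def)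
  have "\<forall>\<^sub>F k :: nat in at_top. ln (real k) \<le> (c * real k powr (1 / (real d + 4)) / 2) ^ d"
    using d3 c by (elim disjE) (simp, real_asymp)+
  then have 3: "\<forall>\<^sub>F k :: nat in at_top. ln (real k) \<le> (\<theta> k / 2) ^ d" by (simp add: \<theta>_def)
  have "\<forall>\<^sub>F k :: nat in at_top. s * real k powr (- 2 / real d) \<le> c powr - 4 * real k powr (- 4 / (real d + 4))"
    using d3 c s by (elim disjE) (simp, real_asymp)+
  then have 4: "\<forall>\<^sub>F k :: nat in at_top. s * real k powr (- 2 / real d) \<le> \<theta> k powr - 4"
    using c by (simp add: \<theta>_def powr_mult powr_powr)
  have "\<forall>\<^sub>F k :: nat in at_top. real k powr (- 1 / real d) \<le> c powr - 2 * real k powr (- 2 / (real d + 4))"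
    using d3 c by (elim disjE) (simp, real_asymp)+
  then have 5: "\<forall>\<^sub>F k :: nat in at_top. real k powr (- 1 / real d) \<le> \<theta> k powr - 2"
    using c by (simp add: \<theta>_def powr_mult powr_powr)
  show ?thesis
    using 1 2 3 4 5 eventually_gt_at_top[of "0::nat"]
  proof eventually_elim
    case (elim k)
    let ?t = "\<theta> k"
    have t: "0 < ?t" using elim(1) by simp
    have eq: "s = sqrt (real k) * ?t powr (- (real d + 4) / 2)"
    proof -
      have "?t powr (- (real d + 4) / 2) = c powr (- (real d + 4) / 2) * real k powr (1 / (real d + 4) * (- (real d + 4) / 2))"
        using c by (simp add: \<theta>_def powr_mult powr_powr)
      also have "c powr (- (real d + 4) / 2) = s powr (- 2 / (real d + 4) * (- (real d + 4) / 2))"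
        by (simp add: c_def powr_powr)
      also have "- 2 / (real d + 4) * (- (real d + 4) / 2) = 1" by (simp add: field_simps)
      also have "1 / (real d + 4) * (- (real d + 4) / 2) = - (1 / 2)" by (simp add: field_simps)
      finally show ?thesis using s elim(6) by (simp add: powr_minus powr_half_sqrt)
    qed
    have a1: "s * ?t powr (real d / 2) / sqrt (real k) = ?t powr - 2"
    proof -
      have "s * ?t powr (real d / 2) / sqrt (real k) = ?t powr (- (real d + 4) / 2) * ?t powr (real d / 2)"
        using elim(6) by (subst eq) simp
      also have "\<dots> = ?t powr (- (real d + 4) / 2 + real d / 2)" by (simp add: powr_add)
      also have "- (real d + 4) / 2 + real d / 2 = - 2" by (simp add: field_simps)
      finally show ?thesis .
    qed
    have a2: "s * (scale_sum d ?t (real k) / sqrt (real k)) = ?t powr - 4"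
    proof -
      have "s * (scale_sum d ?t (real k) / sqrt (real k)) = ?t powr (- (real d + 4) / 2) * ?t powr (real d / 2 - 2)"
        using elim(6) d by (subst eq) (simp add: scale_sum_def)
      also have "\<dots> = ?t powr (- (real d + 4) / 2 + (real d / 2 - 2))" by (simp add: powr_add)
      also have "- (real d + 4) / 2 + (real d / 2 - 2) = - 4" by (simp add: field_simps)
      finally show ?thesis .
    qed
    have "sqrt (s * (scale_sum d ?t (real k) / sqrt (real k) + real k powr (- 2 / real d)))
        \<le> sqrt (2\<^sup>2 * ?t powr - 4)"
    proof (rule real_sqrt_le_mono)
      have "s * (scale_sum d ?t (real k) / sqrt (real k) + real k powr (- 2 / real d)) \<le> ?t powr - 4 + ?t powr - 4"
        unfolding distrib_left by (intro add_mono elim(4) eq_refl[OF a2])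
      also have "\<dots> \<le> 2\<^sup>2 * ?t powr - 4" by simp
      finally show "s * (scale_sum d ?t (real k) / sqrt (real k) + real k powr (- 2 / real d)) \<le> 2\<^sup>2 * ?t powr - 4" .
    qed
    also have "?t powr - 4 = (?t powr - 2)\<^sup>2" using t by (simp add: power2_eq_square powr_add[symmetric])
    finally have a3: "sqrt (s * (scale_sum d ?t (real k) / sqrt (real k) + real k powr (- 2 / real d))) \<le> 2 * ?t powr - 2"
      by (simp add: real_sqrt_mult)
    have r: "\<rho> * ?t powr - 2 = lsq_rate d \<sigma> \<rho> (real k)"
    proof -
      have "?t powr - 2 = s powr (4 / (real d + 4)) * real k powr (- 2 / (real d + 4))"
        using c by (simp add: \<theta>_def powr_mult powr_powr c_def)
      also have "s powr (4 / (real d + 4)) = \<sigma> powr (4 / (real d + 4)) / \<rho> powr (4 / (real d + 4))"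
        using \<sigma> \<rho> by (simp add: s_def powr_divide)
      finally have "\<rho> * ?t powr - 2
          = \<sigma> powr (4 / (real d + 4)) * (\<rho> powr 1 / \<rho> powr (4 / (real d + 4))) * real k powr (- 2 / (real d + 4))"
        using \<rho> by simp
      also have "\<rho> powr 1 / \<rho> powr (4 / (real d + 4)) = \<rho> powr (1 - 4 / (real d + 4))" by (simp only: powr_diff)
      also have "1 - 4 / (real d + 4) = real d / (real d + 4)" by (simp add: field_simps)
      finally show ?thesis using d by (simp add: lsq_rate_def)
    qed
    have "C * \<rho> * (s * ?t powr (real d / 2) / sqrt (real k)
          + sqrt (s * (scale_sum d ?t (real k) / sqrt (real k) + real k powr (- 2 / real d))))
        + \<rho> * real k powr (- 1 / real d)
        \<le> C * \<rho> * (?t powr - 2 + 2 * ?t powr - 2) + \<rho> * ?t powr - 2"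
      unfolding a1 using a3 elim(5) C \<rho> by (intro add_mono mult_left_mono) auto
    also have "\<dots> = (3 * C + 1) * (\<rho> * ?t powr - 2)" by (simp add: algebra_simps)
    also have "\<dots> = (3 * C + 1) * lsq_rate d \<sigma> \<rho> (real k)" by (simp only: r)
    finally show ?case using elim unfolding s_def by blast
  qed
qed

text \<open>Here the sum over the scales dominates for every \<open>\<theta>\<close> that is a small enough power of \<open>k\<close>.  For
  \<open>d = 4\<close> it is of order \<open>sqrt (ln k)\<close> times the sampling error, and the remaining \<open>sqrt (ln k)\<close> in the
  rate absorbs the powers of \<open>\<rho> / \<sigma>\<close>; for larger \<open>d\<close> it is itself of the order of the sampling error.\<close>

lemma rate_large_dim:
  assumes d: "4 \<le> d" and \<sigma>: "0 < \<sigma>" "\<sigma> \<le> \<rho>" and C: "0 < C"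
  shows "\<forall>\<^sub>F k :: nat in at_top. \<exists>\<theta>. 1 \<le> \<theta> \<and> \<theta> \<le> real k powr (1 / real d) \<and> ln (real k) \<le> (\<theta> / 2) ^ d \<and>
    C * \<rho> * (\<sigma> / \<rho> * \<theta> powr (real d / 2) / sqrt (real k)
          + sqrt (\<sigma> / \<rho> * (scale_sum d \<theta> (real k) / sqrt (real k) + real k powr (- 2 / real d))))
      + \<rho> * real k powr (- 1 / real d) \<le> (3 * C + 1) * lsq_rate d \<sigma> \<rho> (real k)"
proof -
  define s where "s = \<sigma> / \<rho>"
  have s: "0 < s" "s \<le> 1" and \<rho>: "0 < \<rho>" using \<sigma> by (auto simp: s_def)
  define \<theta> where "\<theta> = (\<lambda>k::nat. real k powr (1 / (2 * real d)))"
  define c where "c = (1 / 2 :: real) ^ d"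
  have c: "0 < c" by (simp add: c_def)
  have lnk: "\<forall>\<^sub>F k :: nat in at_top. ln (real k) \<le> c * sqrt (real k)" using c by real_asymp
  have four: "\<forall>\<^sub>F k :: nat in at_top.
      C * \<rho> * (s + sqrt (s * (2 + ln (real k)))) + \<rho> \<le> \<sigma> * ln (real k)"
    using \<sigma> \<rho> s C by real_asymp
  show ?thesis
    using lnk four eventually_ge_at_top[of "1::nat"]
  proof eventually_elim
    case (elim k)
    let ?t = "\<theta> k"
    have t1: "1 \<le> ?t" using elim(3) by (simp add: \<theta>_def ge_one_powr_ge_zero)
    have t2: "?t \<le> real k powr (1 / real d)" unfolding \<theta>_def using elim(3) d by (intro powr_mono) (auto simp: field_simps)
    have "?t ^ d = sqrt (real k)"
      using elim(3) d by (simp add: \<theta>_def powr_realpow[symmetric] powr_powr powr_half_sqrt)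
    then have t3: "ln (real k) \<le> (?t / 2) ^ d" using elim(1) by (simp add: power_divide c_def)
    have t4: "?t powr (real d / 2) / sqrt (real k) = real k powr (- 1 / 4)"
    proof -
      have "?t powr (real d / 2) / sqrt (real k) = real k powr (1 / 4) / real k powr (1 / 2)"
        using d elim(3) by (simp add: \<theta>_def powr_powr powr_half_sqrt)
      then show ?thesis by (simp add: powr_diff[symmetric])
    qed
    have key: "C * \<rho> * (s * ?t powr (real d / 2) / sqrt (real k)
          + sqrt (s * (scale_sum d ?t (real k) / sqrt (real k) + real k powr (- 2 / real d))))
        + \<rho> * real k powr (- 1 / real d) \<le> (3 * C + 1) * lsq_rate d \<sigma> \<rho> (real k)"
    proof (cases "d = 4")
      case True
      let ?p = "real k powr (- 1 / 4)"
      have p: "0 < ?p" using elim(3) by simp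
      have half: "x / sqrt (real k) = x * ?p\<^sup>2" "real k powr - (1 / 2) = ?p\<^sup>2" for x
        using elim(3) by (simp_all add: powr_half_sqrt[symmetric] power2_eq_square powr_add[symmetric] powr_minus_divide)
      have sc: "s * (scale_sum d ?t (real k) / sqrt (real k) + real k powr (- 2 / real d)) = ?p\<^sup>2 * (s * (2 + ln (real k)))"
        using True half by (simp add: scale_sum_def algebra_simps)
      have "C * \<rho> * (s * ?t powr (real d / 2) / sqrt (real k)
          + sqrt (s * (scale_sum d ?t (real k) / sqrt (real k) + real k powr (- 2 / real d))))
        + \<rho> * real k powr (- 1 / real d)
        = C * \<rho> * (s * ?p + ?p * sqrt (s * (2 + ln (real k)))) + \<rho> * ?p"
        unfolding sc using p t4 True by (simp add: real_sqrt_mult times_divide_eq_right[symmetric] del: times_divide_eq_right)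
      also have "\<dots> = ?p * (C * \<rho> * (s + sqrt (s * (2 + ln (real k)))) + \<rho>)" by (simp add: algebra_simps)
      also have "\<dots> \<le> ?p * (\<sigma> * ln (real k))" using elim(2) p by (intro mult_left_mono) auto
      also have "\<dots> = 1 * lsq_rate d \<sigma> \<rho> (real k)" using True by (simp add: lsq_rate_def)
      also have "\<dots> \<le> (3 * C + 1) * lsq_rate d \<sigma> \<rho> (real k)"
        using C True elim(3) \<sigma> by (intro mult_right_mono) (auto simp: lsq_rate_def)
      finally show ?thesis .
    next
      case False
      let ?p = "real k powr (- 1 / real d)"
      have p: "0 < ?p" using elim(3) by simp
      have p2: "real k powr (- 2 / real d) = ?p\<^sup>2" using elim(3) by (simp add: power2_eq_square powr_add[symmetric])
      have "- 1 / 4 \<le> - 1 / real d" using d by (simp add: field_simps)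
      then have "real k powr (- 1 / 4) \<le> ?p" using elim(3) by (intro powr_mono) auto
      then have b1: "s * ?t powr (real d / 2) / sqrt (real k) \<le> 1 * ?p"
        unfolding times_divide_eq_right[symmetric] t4 using s by (intro mult_mono) auto
      have "scale_sum d ?t (real k) / sqrt (real k) = real k powr (1 / 2 - 2 / real d) / real k powr (1 / 2)"
        using False d elim(3) by (simp add: scale_sum_def powr_half_sqrt)
      also have "\<dots> = real k powr (- 2 / real d)" by (simp add: powr_diff[symmetric])
      finally have "s * (scale_sum d ?t (real k) / sqrt (real k) + real k powr (- 2 / real d)) = s * (2 * ?p\<^sup>2)"
        by (simp only: p2 mult_2)
      also have "\<dots> \<le> 1 * (2\<^sup>2 * ?p\<^sup>2)" using s by (intro mult_mono) auto
      finally have "sqrt (s * (scale_sum d ?t (real k) / sqrt (real k) + real k powr (- 2 / real d))) \<le> sqrt (2\<^sup>2 * ?p\<^sup>2)"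
        by (intro real_sqrt_le_mono) simp
      then have b2: "sqrt (s * (scale_sum d ?t (real k) / sqrt (real k) + real k powr (- 2 / real d))) \<le> 2 * ?p"
        using p by (simp add: real_sqrt_mult)
      have "C * \<rho> * (s * ?t powr (real d / 2) / sqrt (real k)
          + sqrt (s * (scale_sum d ?t (real k) / sqrt (real k) + real k powr (- 2 / real d))))
        + \<rho> * ?p \<le> C * \<rho> * (1 * ?p + 2 * ?p) + \<rho> * ?p"
        using b1 b2 C \<rho> by (intro add_mono mult_left_mono) auto
      also have "\<dots> = (3 * C + 1) * (\<rho> * ?p)" by (simp add: algebra_simps)
      also have "\<dots> = (3 * C + 1) * lsq_rate d \<sigma> \<rho> (real k)" using False d by (simp add: lsq_rate_def)
      finally show ?thesis .
    qed
    show ?case using t1 t2 t3 key unfolding s_def by blast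
  qed
qed

section \<open>Transfer between the measured directions and the whole sphere\<close>

lemma spread_dense:
  fixes u :: "nat \<Rightarrow> 'a::euclidean_space"
  assumes k: "1 \<le> k" and sp: "spread u k \<le> D" and w: "norm w = 1"
  shows "\<exists>i\<in>{1..k}. dist w (u i) \<le> D"
proof -
  let ?f = "\<lambda>v. Min ((\<lambda>i. norm (v - u i)) ` {1..k})"
  have "?f v \<le> 1 + norm (u 1)" if "v \<in> sphere 0 1" for v
  proof -
    have "?f v \<le> norm (v - u 1)" by (rule Min_le) (use k in auto)
    also have "\<dots> \<le> 1 + norm (u 1)" using norm_triangle_ineq4[of v "u 1"] that by simp
    finally show ?thesis .
  qed
  then have "bdd_above (?f ` sphere 0 1)" by (intro bdd_aboveI2)
  then have "?f w \<le> spread u k" unfolding spread_def by (rule cSUP_upper2) (use w in auto)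
  moreover have "?f w \<in> (\<lambda>i. norm (w - u i)) ` {1..k}" by (rule Min_in) (use k in auto)
  ultimately show ?thesis using sp by (force simp: dist_norm)
qed

text \<open>A bound for the spread by \<open>c * k powr (- 1 / (n - 1))\<close> says that the first \<open>k\<close> directions are
  nowhere sparser than a net with \<open>k\<close> points; it says nothing about clusters, so only lower bounds for
  the number of directions in a cap are available.\<close>

locale dense_directions =
  fixes u :: "nat \<Rightarrow> 'a::euclidean_space" and c :: real and d :: nat
  assumes dim: "DIM('a) = d + 1" and d1: "1 \<le> d" and c1: "1 \<le> c"
    and unit: "\<And>i. 1 \<le> i \<Longrightarrow> norm (u i) = 1"
    and spr: "\<And>k. 1 \<le> k \<Longrightarrow> spread u k \<le> c * real k powr (- 1 / real d)"
begin

definition mesh :: "nat \<Rightarrow> real" where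
  "mesh k = c * real k powr (- 1 / real d)"

lemma mesh_pos: "1 \<le> k \<Longrightarrow> 0 < mesh k"
  using c1 by (simp add: mesh_def)

lemma mesh_power: "1 \<le> k \<Longrightarrow> mesh k ^ d = c ^ d / real k"
proof -
  assume k: "1 \<le> k"
  have "(real k powr (- 1 / real d)) ^ d = real k powr (-1)"
    using k d1 by (simp add: powr_realpow[symmetric] powr_powr)
  then show ?thesis
    using k unfolding mesh_def power_mult_distrib by (simp add: powr_minus_divide power_divide)
qed

lemma dense: "1 \<le> k \<Longrightarrow> norm w = 1 \<Longrightarrow> \<exists>i\<in>{1..k}. dist w (u i) \<le> mesh k"
  using spread_dense spr unfolding mesh_def by blast

definition cap_const :: real where
  "cap_const = 2 * 6 ^ (d + 1) * c ^ d"

lemma cap_const_ge_1: "1 \<le> cap_const"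
proof -
  have "1 * (1 * 1) \<le> 2 * (6 ^ (d + 1) * c ^ d)"
    using c1 by (intro mult_mono one_le_power) auto
  then show ?thesis by (simp add: cap_const_def)
qed

lemma cap_count:
  assumes k: "1 \<le> k" and r: "mesh k \<le> r" "r \<le> 1" and v: "norm v = 1"
  shows "real k * r ^ d \<le> cap_const * real (card {i\<in>{1..k}. dist v (u i) \<le> 2 * r})"
proof -
  have "(r / mesh k) ^ (DIM('a) - 1) \<le> 2 * 6 ^ DIM('a) * real (card {i\<in>{1..k}. dist v (u i) \<le> 2 * r})"
    by (rule card_directions_in_cap) (use unit dense[OF k] mesh_pos[OF k] r v in auto)
  then have "r ^ d * (real k / c ^ d) \<le> 2 * 6 ^ (d + 1) * real (card {i\<in>{1..k}. dist v (u i) \<le> 2 * r})"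
    using mesh_power[OF k] k c1 by (simp add: dim power_divide)
  then have "r ^ d * (real k / c ^ d) * c ^ d
      \<le> 2 * 6 ^ (d + 1) * real (card {i\<in>{1..k}. dist v (u i) \<le> 2 * r}) * c ^ d"
    using c1 by (intro mult_right_mono) auto
  moreover have "r ^ d * (real k / c ^ d) * c ^ d = real k * r ^ d" using c1 by simp
  ultimately show ?thesis by (simp add: cap_const_def mult_ac)
qed

lemma card_cap_le_L2:
  assumes "\<And>i. i \<in> {1..k} \<Longrightarrow> dist v (u i) \<le> 2 * r \<Longrightarrow> t \<le> \<bar>f i\<bar>" "0 \<le> t"
  shows "real (card {i\<in>{1..k}. dist v (u i) \<le> 2 * r}) * t\<^sup>2 \<le> (L2_set f {1..k})\<^sup>2"
proof -
  let ?J = "{i\<in>{1..k}. dist v (u i) \<le> 2 * r}"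
  have "real (card ?J) * t\<^sup>2 = (\<Sum>i\<in>?J. t\<^sup>2)" by simp
  also have "\<dots> \<le> (\<Sum>i\<in>?J. (f i)\<^sup>2)"
  proof (rule sum_mono)
    fix i assume "i \<in> ?J"
    then have "t \<le> \<bar>f i\<bar>" using assms by auto
    then have "t\<^sup>2 \<le> \<bar>f i\<bar>\<^sup>2" using assms(2) by (intro power_mono) auto
    then show "t\<^sup>2 \<le> (f i)\<^sup>2" by simp
  qed
  also have "\<dots> \<le> (\<Sum>i\<in>{1..k}. (f i)\<^sup>2)" by (rule sum_mono2) auto
  also have "\<dots> = (L2_set f {1..k})\<^sup>2" by (simp add: L2_set_def sum_nonneg)
  finally show ?thesis .
qed

section \<open>From the measured directions to the norms on the sphere\<close>

lemma support_diff_lipschitz: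
  assumes "body_in \<rho> K" "body_in \<rho> L"
  shows "\<bar>(support_fun K v - support_fun L v) - (support_fun K w - support_fun L w)\<bar> \<le> 2 * \<rho> * dist v w"
  using support_fun_lipschitz[OF assms(1), of v w] support_fun_lipschitz[OF assms(2), of v w]
  by (simp add: dist_norm)

text \<open>The caps of radius \<open>mesh k\<close> about the directions cover the sphere, each has measure of order \<open>1 / k\<close>,
  and a support function varies by at most \<open>\<rho> * mesh k\<close> on it.  The caps may overlap arbitrarily.\<close>

lemma l2_dist_le_empirical:
  assumes k: "1 \<le> k" and m: "mesh k \<le> 1" and K: "body_in \<rho> K" and L: "body_in \<rho> L" and \<rho>: "0 < \<rho>"
  defines "g \<equiv> \<lambda>v. support_fun K v - support_fun L v"
  shows "l2_dist K L \<le> sqrt (4 * 8 ^ (d + 1) * unit_ball_vol (real d) * c ^ d)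
    * (L2_set (\<lambda>i. g (u i)) {1..k} / sqrt (real k) + 2 * \<rho> * mesh k)"
proof -
  define H :: "'a measure" where "H = hausdorff_measure (real DIM('a) - 1)"
  define w where "w = 4 * 8 ^ (d + 1) * unit_ball_vol (real d)"
  have w: "0 < w" by (simp add: w_def)
  define b where "b = (\<lambda>i. \<bar>g (u i)\<bar> + 2 * \<rho> * mesh k)"
  define Q where "Q = (\<lambda>i. sphere 0 1 \<inter> cball (u i) (mesh k))"
  have mp: "0 < mesh k" by (rule mesh_pos[OF k])
  have b0: "0 \<le> b i" for i using \<rho> mp by (simp add: b_def)
  have sets_H: "sets H = sets borel"
    unfolding H_def hausdorff_measure_def using sets.sigma_sets_eq[of borel] by simp
  have space_H: "space H = UNIV" by (simp add: H_def hausdorff_measure_def)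
  have Q_H: "Q i \<in> sets H" for i unfolding sets_H Q_def by (intro borel_closed closed_Int) auto
  have emQ: "emeasure H (Q i) \<le> ennreal (w * mesh k ^ d)" for i
  proof -
    have "emeasure H (Q i) = hausdorff_outer (real DIM('a) - 1) (Q i)"
      unfolding H_def by (rule emeasure_hausdorff_measure) (use Q_H sets_H in auto)
    also have "\<dots> \<le> ennreal (4 * 8 ^ DIM('a) * unit_ball_vol (real DIM('a) - 1) * mesh k ^ (DIM('a) - 1))"
      unfolding Q_def by (rule hausdorff_cap_upper) (use dim d1 mp m in auto)
    also have "\<dots> = ennreal (w * mesh k ^ d)" by (simp add: dim w_def)
    finally show ?thesis .
  qed
  have cont: "continuous_on UNIV g"
    unfolding g_def by (intro continuous_intros continuous_on_support_fun[OF K] continuous_on_support_fun[OF L])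
  define F where "F = (\<lambda>v. indicator (sphere 0 1) v *\<^sub>R (g v)\<^sup>2)"
  have F_meas: "F \<in> borel_measurable H"
  proof -
    have "g \<in> borel_measurable borel" using cont by (rule borel_measurable_continuous_onI)
    moreover have "sphere (0::'a) 1 \<in> sets borel" by (intro borel_closed closed_sphere)
    ultimately have "F \<in> borel_measurable borel" unfolding F_def by measurable
    then show ?thesis using sets_H by (simp cong: measurable_cong_sets)
  qed
  have F_le: "ennreal (F v) \<le> (\<Sum>i=1..k. ennreal ((b i)\<^sup>2) * indicator (Q i) v)" for v
  proof (cases "norm v = 1")
    case True
    then obtain i where i: "i \<in> {1..k}" "dist v (u i) \<le> mesh k" using dense[OF k] by blast
    have "\<bar>g v - g (u i)\<bar> \<le> 2 * \<rho> * dist v (u i)"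
      unfolding g_def by (rule support_diff_lipschitz[OF K L])
    also have "\<dots> \<le> 2 * \<rho> * mesh k" using i \<rho> by (intro mult_left_mono) auto
    finally have "\<bar>g v\<bar> \<le> b i" by (simp add: b_def)
    then have "\<bar>g v\<bar>\<^sup>2 \<le> (b i)\<^sup>2" by (intro power_mono) auto
    then have "F v \<le> (b i)\<^sup>2" using True by (simp add: F_def)
    then have "ennreal (F v) \<le> ennreal ((b i)\<^sup>2) * indicator (Q i) v"
      using True i by (simp add: Q_def dist_commute ennreal_leI)
    also have "\<dots> \<le> (\<Sum>i=1..k. ennreal ((b i)\<^sup>2) * indicator (Q i) v)"
      by (rule member_le_sum) (use i in auto)
    finally show ?thesis .
  next
    case False
    then show ?thesis by (simp add: F_def)
  qed
  have "(\<integral>\<^sup>+v. ennreal (F v) \<partial>H) \<le> (\<integral>\<^sup>+v. (\<Sum>i=1..k. ennreal ((b i)\<^sup>2) * indicator (Q i) v) \<partial>H)"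
    by (rule nn_integral_mono) (rule F_le)
  also have "\<dots> = (\<Sum>i=1..k. ennreal ((b i)\<^sup>2) * emeasure H (Q i))"
    using Q_H by (subst nn_integral_sum) (auto simp: nn_integral_cmult_indicator)
  also have "\<dots> \<le> (\<Sum>i=1..k. ennreal ((b i)\<^sup>2) * ennreal (w * mesh k ^ d))"
    by (intro sum_mono mult_left_mono emQ) auto
  also have "\<dots> = (\<Sum>i=1..k. ennreal ((b i)\<^sup>2 * (w * mesh k ^ d)))"
    using w mp by (simp add: ennreal_mult')
  also have "\<dots> = ennreal (\<Sum>i=1..k. (b i)\<^sup>2 * (w * mesh k ^ d))"
    using w mp by (intro sum_ennreal) auto
  also have "(\<Sum>i=1..k. (b i)\<^sup>2 * (w * mesh k ^ d)) = (L2_set b {1..k})\<^sup>2 * (w * mesh k ^ d)"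
    by (simp add: L2_set_def sum_nonneg sum_distrib_right)
  finally have nn: "(\<integral>\<^sup>+v. ennreal (F v) \<partial>H) \<le> ennreal ((L2_set b {1..k})\<^sup>2 * (w * mesh k ^ d))" .
  have "(LINT v:sphere 0 1|H. (g v)\<^sup>2) = enn2real (\<integral>\<^sup>+v. ennreal (F v) \<partial>H)"
    unfolding set_lebesgue_integral_def F_def[symmetric]
    by (rule integral_eq_nn_integral[OF F_meas]) (simp add: F_def)
  also have "\<dots> \<le> (L2_set b {1..k})\<^sup>2 * (w * mesh k ^ d)"
    by (rule enn2real_leI[OF _ nn]) (use w mp in auto)
  finally have "l2_dist K L \<le> sqrt ((L2_set b {1..k})\<^sup>2 * (w * mesh k ^ d))"
    unfolding l2_dist_def g_def H_def by (rule real_sqrt_le_mono)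
  also have "\<dots> = sqrt (w * c ^ d) * (L2_set b {1..k} / sqrt (real k))"
    using mesh_power[OF k] by (simp add: real_sqrt_mult real_sqrt_divide L2_set_nonneg)
  also have "\<dots> \<le> sqrt (w * c ^ d) * (L2_set (\<lambda>i. g (u i)) {1..k} / sqrt (real k) + 2 * \<rho> * mesh k)"
  proof (rule mult_left_mono)
    have "L2_set b {1..k} \<le> L2_set (\<lambda>i. \<bar>g (u i)\<bar>) {1..k} + L2_set (\<lambda>i. 2 * \<rho> * mesh k) {1..k}"
      unfolding b_def by (rule L2_set_triangle_ineq)
    also have "L2_set (\<lambda>i. \<bar>g (u i)\<bar>) {1..k} = L2_set (\<lambda>i. g (u i)) {1..k}" by (simp add: L2_set_def)
    also have "L2_set (\<lambda>i::nat. 2 * \<rho> * mesh k) {1..k} \<le> sqrt (real k) * (2 * \<rho> * mesh k)"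
      by (rule L2_set_le_bound) (use \<rho> mp in auto)
    finally have "L2_set b {1..k} \<le> (L2_set (\<lambda>i. g (u i)) {1..k} / sqrt (real k) + 2 * \<rho> * mesh k) * sqrt (real k)"
      using k by (simp add: algebra_simps)
    then show "L2_set b {1..k} / sqrt (real k) \<le> L2_set (\<lambda>i. g (u i)) {1..k} / sqrt (real k) + 2 * \<rho> * mesh k"
      using k by (simp add: pos_divide_le_eq)
  qed (use w c1 in simp)
  finally show ?thesis by (simp add: w_def)
qed

text \<open>A difference of support functions that equals \<open>E\<close> at one point exceeds \<open>E / 2\<close> on a cap of radius
  proportional to \<open>E\<close>, and the cap contains its share of the measured directions; if the cap is smaller
  than the mesh, then \<open>E\<close> itself is small.\<close>

lemma support_diff_power_le:
  assumes k: "1 \<le> k" and K: "body_in \<rho> K" and L: "body_in \<rho> L" and \<rho>: "0 < \<rho>" and v: "norm v = 1"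
    and F: "L2_set (\<lambda>i. support_fun K (u i) - support_fun L (u i)) {1..k} / sqrt (real k) \<le> F"
      "\<rho> * real k powr (- 1 / real d) \<le> F"
  shows "\<bar>support_fun K v - support_fun L v\<bar> ^ (d + 2) \<le> (4 * 8 ^ d * cap_const + 2 ^ d * (8 * c)\<^sup>2) * \<rho> ^ d * F\<^sup>2"
proof -
  define g where "g = (\<lambda>v. support_fun K v - support_fun L v)"
  define E where "E = \<bar>g v\<bar>"
  define N where "N = L2_set (\<lambda>i. g (u i)) {1..k}"
  have N0: "0 \<le> N" by (simp add: N_def L2_set_nonneg)
  have E0: "0 \<le> E" by (simp add: E_def)
  have F0: "0 \<le> F" using F(2) \<rho> by (meson mult_nonneg_nonneg order_trans powr_ge_zero less_imp_le)
  have E2: "E \<le> 2 * \<rho>"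
    using support_fun_abs_le[OF K, of v] support_fun_abs_le[OF L, of v] v by (simp add: E_def g_def)
  define r where "r = E / (8 * \<rho>)"
  have Er: "E = 8 * \<rho> * r" using \<rho> by (simp add: r_def)
  have r1: "r \<le> 1" using E2 \<rho> by (simp add: r_def)
  have r0: "0 \<le> r" using E0 \<rho> by (simp add: r_def)
  have cc: "0 \<le> cap_const" using cap_const_ge_1 by simp
  show ?thesis
  proof (cases "mesh k \<le> r")
    case True
    have "real (card {i\<in>{1..k}. dist v (u i) \<le> 2 * r}) * (E / 2)\<^sup>2 \<le> N\<^sup>2"
      unfolding N_def
    proof (rule card_cap_le_L2)
      fix i assume i: "dist v (u i) \<le> 2 * r"
      have "\<bar>g v - g (u i)\<bar> \<le> 2 * \<rho> * dist v (u i)"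
        unfolding g_def by (rule support_diff_lipschitz[OF K L])
      also have "\<dots> \<le> 2 * \<rho> * (2 * r)" using i \<rho> by (intro mult_left_mono) auto
      also have "\<dots> = E / 2" by (simp add: Er)
      finally show "E / 2 \<le> \<bar>g (u i)\<bar>" unfolding E_def by linarith
    qed (use E0 in simp)
    moreover have "real k * r ^ d * (E / 2)\<^sup>2
        \<le> cap_const * real (card {i\<in>{1..k}. dist v (u i) \<le> 2 * r}) * (E / 2)\<^sup>2"
      by (intro mult_right_mono cap_count k True r1 v) auto
    ultimately have "real k * r ^ d * (E / 2)\<^sup>2 \<le> cap_const * N\<^sup>2"
      using mult_left_mono[OF _ cc] by (smt (verit) mult.assoc)
    also have "\<dots> \<le> cap_const * (sqrt (real k) * F)\<^sup>2"
    proof (rule mult_left_mono[OF power_mono[OF _ N0] cc])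
      show "N \<le> sqrt (real k) * F"
        using F(1) k unfolding N_def g_def by (simp add: pos_divide_le_eq mult.commute)
    qed
    finally have "real k * (r ^ d * (E / 2)\<^sup>2) \<le> real k * (cap_const * F\<^sup>2)"
      by (simp add: power_mult_distrib mult_ac)
    then have "r ^ d * (E / 2)\<^sup>2 \<le> cap_const * F\<^sup>2" using k by simp
    then have "(8 * \<rho>) ^ d * (r ^ d * (E / 2)\<^sup>2) \<le> (8 * \<rho>) ^ d * (cap_const * F\<^sup>2)"
      using \<rho> by (intro mult_left_mono) auto
    moreover have "E ^ (d + 2) = 4 * ((8 * \<rho>) ^ d * (r ^ d * (E / 2)\<^sup>2))"
    proof -
      have "(8 * \<rho>) ^ d * r ^ d = E ^ d" by (simp only: power_mult_distrib[symmetric] Er[symmetric])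
      then have "4 * ((8 * \<rho>) ^ d * (r ^ d * (E / 2)\<^sup>2)) = 4 * (E ^ d * (E / 2)\<^sup>2)"
        by (simp only: mult.assoc[symmetric])
      then show ?thesis by (simp only: power_add power_divide) simp
    qed
    ultimately have "E ^ (d + 2) \<le> 4 * ((8 * \<rho>) ^ d * (cap_const * F\<^sup>2))" by linarith
    also have "\<dots> = (4 * 8 ^ d * cap_const) * \<rho> ^ d * F\<^sup>2" by (simp add: power_mult_distrib)
    also have "\<dots> \<le> (4 * 8 ^ d * cap_const + 2 ^ d * (8 * c)\<^sup>2) * \<rho> ^ d * F\<^sup>2"
      using \<rho> by (intro mult_right_mono) auto
    finally show ?thesis by (simp add: E_def g_def)
  next
    case False
    then have "E \<le> 8 * \<rho> * mesh k" unfolding Er using \<rho> by (intro mult_left_mono) auto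
    also have "\<dots> = 8 * c * (\<rho> * real k powr (- 1 / real d))" by (simp add: mesh_def)
    also have "\<dots> \<le> 8 * c * F" using F(2) c1 by (intro mult_left_mono) auto
    finally have "E ^ d * E\<^sup>2 \<le> (2 * \<rho>) ^ d * (8 * c * F)\<^sup>2"
      using E2 E0 \<rho> by (intro mult_mono power_mono) auto
    also have "\<dots> = (2 ^ d * (8 * c)\<^sup>2) * \<rho> ^ d * F\<^sup>2" by (simp add: power_mult_distrib)
    also have "\<dots> \<le> (4 * 8 ^ d * cap_const + 2 ^ d * (8 * c)\<^sup>2) * \<rho> ^ d * F\<^sup>2"
      using \<rho> cc by (intro mult_right_mono) auto
    finally show ?thesis unfolding E_def g_def power_add .
  qed
qed

section \<open>The least squares estimator\<close>

text \<open>A consistent vector is the vector of support function values of the polytope that it cuts out, and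
  the true body competes in the minimization.  Comparing the two residuals gives a crude bound for the
  estimated values, hence for the size of the polytope, and the basic inequality.\<close>

lemma lsq_output_props:
  assumes k: "1 \<le> k" and m: "mesh k \<le> 1 / 2"
    and K: "body_in R K" and A: "A = UNIV \<or> A = {0..} \<and> 0 \<in> K" and \<sigma>: "0 < \<sigma>" "\<sigma> \<le> R"
    and x: "(\<Sum>i=1..k. (x i)\<^sup>2) \<le> 4 * \<sigma>\<^sup>2 * real k"
    and out: "noisy_support_lsq_output A k u (\<lambda>i. support_fun K (u i) + x i) P"
  shows "body_in (10 * sqrt (2 ^ d * cap_const) * R) P"
    "(\<Sum>i=1..k. (support_fun P (u i) - support_fun K (u i))\<^sup>2)
       \<le> 2 * (\<Sum>i=1..k. (support_fun P (u i) - support_fun K (u i)) * x i)"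
proof -
  obtain h L where hA: "\<forall>i\<in>{1..k}. h i \<in> A"
    and L: "L \<noteq> {}" "compact L" "convex L" "\<forall>i\<in>{1..k}. support_fun L (u i) = h i"
    and opt: "\<And>h'. consistent A k u h' \<Longrightarrow>
      (\<Sum>i=1..k. (support_fun K (u i) + x i - h i)\<^sup>2) \<le> (\<Sum>i=1..k. (support_fun K (u i) + x i - h' i)\<^sup>2)"
    and P: "P = (\<Inter>i\<in>{1..k}. {y. y \<bullet> u i \<le> h i})"
    using out unfolding noisy_support_lsq_output_def consistent_def by blast
  have K': "compact K" "convex K" "K \<noteq> {}" using K by (auto simp: body_in_def)
  have "support_fun K (u i) \<in> A" for i
    using A support_fun_upper[OF K'(1), of 0 "u i"] by auto
  then have consK: "consistent A k u (\<lambda>i. support_fun K (u i))"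
    unfolding consistent_def using K' by blast
  define g where "g = (\<lambda>i. h i - support_fun K (u i))"
  have resid: "(\<Sum>i=1..k. (x i - g i)\<^sup>2) \<le> (\<Sum>i=1..k. (x i)\<^sup>2)"
    using opt[OF consK] by (simp add: g_def algebra_simps)
  have basic: "(\<Sum>i=1..k. (g i)\<^sup>2) \<le> 2 * (\<Sum>i=1..k. g i * x i)"
  proof -
    have "(\<Sum>i=1..k. (x i - g i)\<^sup>2) = (\<Sum>i=1..k. (x i)\<^sup>2) + (\<Sum>i=1..k. (g i)\<^sup>2) - 2 * (\<Sum>i=1..k. g i * x i)"
      by (simp add: power2_diff sum.distrib sum_subtractf sum_distrib_left mult_ac)
    then show ?thesis using resid by linarith
  qed
  have Lx: "L2_set x {1..k} \<le> 2 * \<sigma> * sqrt (real k)"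
  proof -
    have "L2_set x {1..k} \<le> sqrt (4 * \<sigma>\<^sup>2 * real k)"
      unfolding L2_set_def by (rule real_sqrt_le_mono[OF x])
    also have "\<dots> = 2 * \<sigma> * sqrt (real k)" using \<sigma> by (simp add: real_sqrt_mult)
    finally show ?thesis .
  qed
  have Lh: "L2_set h {1..k} \<le> 5 * R * sqrt (real k)"
  proof -
    have "L2_set (\<lambda>i. x i - g i) {1..k} \<le> L2_set x {1..k}"
      unfolding L2_set_def by (rule real_sqrt_le_mono[OF resid])
    moreover have "L2_set (\<lambda>i. support_fun K (u i)) {1..k} \<le> sqrt (real k) * R"
      by (rule L2_set_le_bound) (use support_fun_abs_le[OF K] unit \<sigma> in \<open>auto, metis mult.right_neutral Suc_le_eq\<close>)
    moreover have "L2_set h {1..k} \<le> L2_set (\<lambda>i. g i - x i) {1..k} + L2_set (\<lambda>i. x i + support_fun K (u i)) {1..k}"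
      using L2_set_triangle_ineq[of "\<lambda>i. g i - x i" "\<lambda>i. x i + support_fun K (u i)" "{1..k}"]
      by (simp add: g_def)
    moreover have "L2_set (\<lambda>i. x i + support_fun K (u i)) {1..k}
        \<le> L2_set x {1..k} + L2_set (\<lambda>i. support_fun K (u i)) {1..k}" by (rule L2_set_triangle_ineq)
    moreover have "L2_set (\<lambda>i. g i - x i) {1..k} = L2_set (\<lambda>i. x i - g i) {1..k}"
      by (simp add: L2_set_def power2_commute)
    moreover have "\<sigma> * sqrt (real k) \<le> R * sqrt (real k)" using \<sigma> by (intro mult_right_mono) auto
    ultimately show ?thesis using Lx by (simp add: mult.commute[of "sqrt (real k)" R])
  qed
  have LP: "L \<subseteq> P"
  proof
    fix y assume y: "y \<in> L"
    have "y \<bullet> u i \<le> h i" if "i \<in> {1..k}" for i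
      using support_fun_upper[OF L(2) y, of "u i"] L(4) that by (simp add: inner_commute)
    then show "y \<in> P" by (simp add: P)
  qed
  define \<rho> where "\<rho> = 10 * sqrt (2 ^ d * cap_const) * R"
  have cc: "1 \<le> cap_const" by (rule cap_const_ge_1)
  have \<rho>0: "0 \<le> \<rho>" using \<sigma> cc by (simp add: \<rho>_def)
  have bound: "norm y \<le> \<rho>" if y: "y \<in> P" for y
  proof (cases "y = 0")
    case True
    then show ?thesis using \<rho>0 by simp
  next
    case False
    define D where "D = norm y"
    have D: "0 < D" using False by (simp add: D_def)
    define v where "v = (1 / D) *\<^sub>R y"
    have v: "norm v = 1" "y = D *\<^sub>R v" using D by (auto simp: v_def D_def)
    let ?J = "{i\<in>{1..k}. dist v (u i) \<le> 2 * (1/2)}"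
    have "real (card ?J) * (D / 2)\<^sup>2 \<le> (L2_set h {1..k})\<^sup>2"
    proof (rule card_cap_le_L2)
      fix i assume i: "i \<in> {1..k}" "dist v (u i) \<le> 2 * (1/2)"
      have "(norm (v - u i))\<^sup>2 \<le> 1\<^sup>2" using i(2) by (intro power_mono) (auto simp: dist_norm)
      moreover have "(norm (v - u i))\<^sup>2 = 2 - 2 * (v \<bullet> u i)"
      proof -
        have "v \<bullet> v = 1" "u i \<bullet> u i = 1" using v(1) unit[of i] i(1) by (simp_all add: dot_square_norm)
        then show ?thesis
          unfolding power2_norm_eq_inner by (simp add: inner_diff inner_commute[of "u i" v])
      qed
      ultimately have "1 / 2 \<le> v \<bullet> u i" by simp
      then have "D * (1 / 2) \<le> D * (v \<bullet> u i)" using D by (intro mult_left_mono) auto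
      also have "\<dots> = y \<bullet> u i" by (simp add: v(2))
      also have "\<dots> \<le> h i" using y i(1) by (auto simp: P)
      finally show "D / 2 \<le> \<bar>h i\<bar>" by simp
    qed (use D in simp)
    also have "\<dots> \<le> (5 * R * sqrt (real k))\<^sup>2"
      using Lh by (intro power_mono) (auto simp: L2_set_nonneg)
    finally have c1: "real (card ?J) * (D / 2)\<^sup>2 \<le> 25 * R\<^sup>2 * real k" by (simp add: power_mult_distrib)
    have "real k * (1/2) ^ d * (D / 2)\<^sup>2 \<le> cap_const * real (card ?J) * (D / 2)\<^sup>2"
      by (intro mult_right_mono cap_count k m v(1)) auto
    also have "\<dots> \<le> cap_const * (25 * R\<^sup>2 * real k)"
      unfolding mult.assoc[of cap_const] using cc by (intro mult_left_mono c1) auto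
    finally have "real k * ((1/2) ^ d * (D / 2)\<^sup>2) \<le> real k * (25 * cap_const * R\<^sup>2)" by (simp add: mult_ac)
    then have "(1/2) ^ d * (D / 2)\<^sup>2 \<le> 25 * cap_const * R\<^sup>2" using k by simp
    then have "D\<^sup>2 \<le> 100 * (2 ^ d * cap_const) * R\<^sup>2"
      by (simp add: power_divide field_simps)
    also have "\<dots> = \<rho>\<^sup>2" using cc by (simp add: \<rho>_def power_mult_distrib)
    finally show ?thesis unfolding D_def by (rule power2_le_imp_le[OF _ \<rho>0])
  qed
  have half: "{y. y \<bullet> u i \<le> h i} = {y. u i \<bullet> y \<le> h i}" for i by (simp add: inner_commute)
  have closedP: "closed P" unfolding P half by (intro closed_INT ballI closed_halfspace_le)
  have convexP: "convex P" unfolding P half by (intro convex_INT convex_halfspace_le)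
  have Psub: "P \<subseteq> cball 0 \<rho>" using bound by auto
  have compP: "compact P"
    using closedP Psub bounded_subset bounded_cball compact_eq_bounded_closed by blast
  have neP: "P \<noteq> {}" using LP L(1) by blast
  show "body_in (10 * sqrt (2 ^ d * cap_const) * R) P"
    using compP convexP neP Psub by (simp add: body_in_def \<rho>_def)
  have hP: "support_fun P (u i) = h i" if i: "i \<in> {1..k}" for i
  proof (rule antisym)
    show "support_fun P (u i) \<le> h i"
      by (rule support_fun_le[OF neP]) (use i in \<open>auto simp: P inner_commute\<close>)
    obtain y where y: "y \<in> L" "support_fun L (u i) = u i \<bullet> y" using support_fun_attained[OF L(2,1)] by blast
    have "u i \<bullet> y \<le> support_fun P (u i)" by (rule support_fun_upper[OF compP]) (use y LP in auto)
    then show "h i \<le> support_fun P (u i)" using y(2) L(4) i by auto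
  qed
  show "(\<Sum>i=1..k. (support_fun P (u i) - support_fun K (u i))\<^sup>2)
       \<le> 2 * (\<Sum>i=1..k. (support_fun P (u i) - support_fun K (u i)) * x i)"
    using basic hP by (simp add: g_def)
qed

end

section \<open>The convergence theorem\<close>

lemma lsq_rate_nonneg: "1 \<le> k \<Longrightarrow> 0 < \<sigma> \<Longrightarrow> 0 < \<rho> \<Longrightarrow> 0 \<le> lsq_rate d \<sigma> \<rho> k"
  by (simp add: lsq_rate_def)

lemma lsq_rate_scale:
  assumes "1 \<le> k" "0 < \<sigma>" "0 < R" "1 \<le> r"
  shows "lsq_rate d \<sigma> (r * R) k \<le> r * lsq_rate d \<sigma> R k"
proof -
  have "r powr (real d / (real d + 4)) \<le> r powr 1" using assms by (intro powr_mono) auto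
  then have p: "r powr (real d / (real d + 4)) \<le> r" using assms by simp
  consider "d \<le> 3" | "d = 4" | "5 \<le> d" by linarith
  then show ?thesis
  proof cases
    case 1
    have "lsq_rate d \<sigma> (r * R) k = r powr (real d / (real d + 4)) * lsq_rate d \<sigma> R k"
      using 1 assms by (simp add: lsq_rate_def powr_mult mult_ac)
    also have "\<dots> \<le> r * lsq_rate d \<sigma> R k"
      using lsq_rate_nonneg[OF assms(1-3)] by (intro mult_right_mono p)
    finally show ?thesis .
  next
    case 2
    then have "lsq_rate d \<sigma> (r * R) k = 1 * lsq_rate d \<sigma> R k" by (simp add: lsq_rate_def)
    also have "\<dots> \<le> r * lsq_rate d \<sigma> R k"
      using lsq_rate_nonneg[OF assms(1-3)] assms(4) by (intro mult_right_mono) auto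
    finally show ?thesis .
  next
    case 3
    then show ?thesis by (simp add: lsq_rate_def)
  qed
qed

lemma l2_dist_commute: "l2_dist K L = l2_dist L K"
  by (simp add: l2_dist_def power2_commute)

context dense_directions
begin

lemma eventually_mesh_le: "0 < e \<Longrightarrow> \<forall>\<^sub>F k in sequentially. mesh k \<le> e"
proof -
  assume e: "0 < e"
  have "((\<lambda>k. c * real k powr (- 1 / real d)) \<longlongrightarrow> c * 0) sequentially"
    using d1 by (intro tendsto_mult tendsto_const tendsto_neg_powr filterlim_real_sequentially) auto
  then have "\<forall>\<^sub>F k in sequentially. c * real k powr (- 1 / real d) < e"
    using e by (intro order_tendstoD(2)) auto
  then show ?thesis unfolding mesh_def by (rule eventually_mono) simp
qed

text \<open>On the event that the noise is good the estimate is deterministic, and the number of measurements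
  from which on it holds depends on \<open>\<sigma>\<close> and \<open>R\<close> only.\<close>

lemma lsq_estimate:
  assumes B: "0 \<le> B" and a: "0 \<le> a"
    and net: "\<And>j K. body_in 1 K \<Longrightarrow> \<exists>L\<in>T j. \<forall>v. norm v = 1 \<longrightarrow>
        \<bar>support_fun K v - support_fun L v\<bar> \<le> a / 4 ^ j"
  obtains C :: real where "0 < C"
    "\<And>\<sigma> R. 0 < \<sigma> \<Longrightarrow> \<sigma> \<le> R \<Longrightarrow> \<exists>N. \<forall>k\<ge>N. 1 \<le> k \<and> (\<forall>x K A P.
       noise_good T B u \<sigma> k x \<and> body_in R K \<and> (A = UNIV \<or> A = {0..} \<and> 0 \<in> K) \<and>
       noisy_support_lsq_output A k u (\<lambda>i. support_fun K (u i) + x i) P \<longrightarrow>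
       l2_dist K P \<le> C * lsq_rate d \<sigma> R (real k) \<and>
       hausdorff_dist K P \<le> (C * R ^ d * (lsq_rate d \<sigma> R (real k))\<^sup>2) powr (1 / (real d + 2)))"
proof -
  have dd: "DIM('a) - 1 = d" using dim by simp
  show ?thesis
  proof (rule empirical_bound[of B a T u, unfolded dd], goal_cases)
    case (5 C0)
    note C0 = 5
    define r where "r = 10 * sqrt (2 ^ d * cap_const)"
    have r1: "1 \<le> r"
    proof -
      have "1 * 1 \<le> 2 ^ d * cap_const" using cap_const_ge_1 by (intro mult_mono) auto
      then have "1 \<le> sqrt (2 ^ d * cap_const)" by simp
      then show ?thesis unfolding r_def by linarith
    qed
    define c2 where "c2 = (3 * C0 + 1) * r"
    have c2: "0 < c2" using C0(1) r1 by (simp add: c2_def)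
    define w where "w = sqrt (4 * 8 ^ (d + 1) * unit_ball_vol (real d) * c ^ d)"
    have w: "0 \<le> w" using c1 by (simp add: w_def)
    define c3 where "c3 = 4 * 8 ^ d * cap_const + 2 ^ d * (8 * c)\<^sup>2"
    have c3: "0 \<le> c3" using cap_const_ge_1 by (simp add: c3_def)
    define C where "C = w * (1 + 2 * c) * c2 + c3 * r ^ d * c2\<^sup>2 + 1"
    have Cs: "0 \<le> w * (1 + 2 * c) * c2" "0 \<le> c3 * r ^ d * c2\<^sup>2" using w c1 c2 c3 r1 by auto
    show ?thesis
    proof (rule that[of C])
      show "0 < C" unfolding C_def using Cs by linarith
      fix \<sigma> R :: real assume \<sigma>: "0 < \<sigma>" "\<sigma> \<le> R"
      define \<rho> where "\<rho> = r * R"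
      have R: "0 < R" using \<sigma> by simp
      have \<rho>R: "R \<le> \<rho>" using r1 R by (simp add: \<rho>_def)
      then have \<rho>: "0 < \<rho>" "\<sigma> \<le> \<rho>" using R \<sigma> by auto
      have "\<forall>\<^sub>F k :: nat in at_top. \<exists>\<theta>. 1 \<le> \<theta> \<and> \<theta> \<le> real k powr (1 / real d) \<and> ln (real k) \<le> (\<theta> / 2) ^ d \<and>
        C0 * \<rho> * (\<sigma> / \<rho> * \<theta> powr (real d / 2) / sqrt (real k)
            + sqrt (\<sigma> / \<rho> * (scale_sum d \<theta> (real k) / sqrt (real k) + real k powr (- 2 / real d))))
          + \<rho> * real k powr (- 1 / real d) \<le> (3 * C0 + 1) * lsq_rate d \<sigma> \<rho> (real k)"
        using rate_small_dim[OF d1 _ \<sigma>(1) \<rho>(2) C0(1)] rate_large_dim[OF _ \<sigma>(1) \<rho>(2) C0(1), of d]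
        by (cases "d \<le> 3") auto
      moreover have "\<forall>\<^sub>F k in sequentially. mesh k \<le> 1 / 2" by (rule eventually_mesh_le) simp
      ultimately have "\<forall>\<^sub>F k in sequentially. 3 \<le> k \<and> mesh k \<le> 1 / 2 \<and>
        (\<exists>\<theta>. 1 \<le> \<theta> \<and> \<theta> \<le> real k powr (1 / real d) \<and> ln (real k) \<le> (\<theta> / 2) ^ d \<and>
        C0 * \<rho> * (\<sigma> / \<rho> * \<theta> powr (real d / 2) / sqrt (real k)
            + sqrt (\<sigma> / \<rho> * (scale_sum d \<theta> (real k) / sqrt (real k) + real k powr (- 2 / real d))))
          + \<rho> * real k powr (- 1 / real d) \<le> (3 * C0 + 1) * lsq_rate d \<sigma> \<rho> (real k))"
        using eventually_ge_at_top[of "3::nat"] by eventually_elim auto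
      then obtain N where N: "\<And>k. N \<le> k \<Longrightarrow> 3 \<le> k \<and> mesh k \<le> 1 / 2 \<and>
        (\<exists>\<theta>. 1 \<le> \<theta> \<and> \<theta> \<le> real k powr (1 / real d) \<and> ln (real k) \<le> (\<theta> / 2) ^ d \<and>
        C0 * \<rho> * (\<sigma> / \<rho> * \<theta> powr (real d / 2) / sqrt (real k)
            + sqrt (\<sigma> / \<rho> * (scale_sum d \<theta> (real k) / sqrt (real k) + real k powr (- 2 / real d))))
          + \<rho> * real k powr (- 1 / real d) \<le> (3 * C0 + 1) * lsq_rate d \<sigma> \<rho> (real k))"
        unfolding eventually_sequentially by blast
      show "\<exists>N. \<forall>k\<ge>N. 1 \<le> k \<and> (\<forall>x K A P.
         noise_good T B u \<sigma> k x \<and> body_in R K \<and> (A = UNIV \<or> A = {0..} \<and> 0 \<in> K) \<and>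
         noisy_support_lsq_output A k u (\<lambda>i. support_fun K (u i) + x i) P \<longrightarrow>
         l2_dist K P \<le> C * lsq_rate d \<sigma> R (real k) \<and>
         hausdorff_dist K P \<le> (C * R ^ d * (lsq_rate d \<sigma> R (real k))\<^sup>2) powr (1 / (real d + 2)))"
      proof (rule exI[of _ N], intro allI impI conjI; (elim conjE)?)
        fix k assume "N \<le> k"
        then show "1 \<le> k" using N by fastforce
      next
        fix k :: nat and x :: "nat \<Rightarrow> real" and K P :: "'a set" and A :: "real set"
        assume kN: "N \<le> k" and good: "noise_good T B u \<sigma> k x" and K: "body_in R K"
          and A: "A = UNIV \<or> A = {0..} \<and> 0 \<in> K"
          and out: "noisy_support_lsq_output A k u (\<lambda>i. support_fun K (u i) + x i) P"
        have k3: "3 \<le> k" and m: "mesh k \<le> 1 / 2" using N[OF kN] by auto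
        have k: "1 \<le> k" using k3 by simp
        obtain \<theta> where \<theta>: "1 \<le> \<theta>" "\<theta> \<le> real k powr (1 / real d)" "ln (real k) \<le> (\<theta> / 2) ^ d"
          "C0 * \<rho> * (\<sigma> / \<rho> * \<theta> powr (real d / 2) / sqrt (real k)
            + sqrt (\<sigma> / \<rho> * (scale_sum d \<theta> (real k) / sqrt (real k) + real k powr (- 2 / real d))))
          + \<rho> * real k powr (- 1 / real d) \<le> (3 * C0 + 1) * lsq_rate d \<sigma> \<rho> (real k)"
          using N[OF kN] by blast
        define F where "F = lsq_rate d \<sigma> R (real k)"
        have F0: "0 \<le> F" unfolding F_def by (rule lsq_rate_nonneg) (use k \<sigma> R in auto)
        have x2: "(\<Sum>i=1..k. (x i)\<^sup>2) \<le> 4 * \<sigma>\<^sup>2 * real k" using good by (simp add: noise_good_def)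
        note props = lsq_output_props[OF k m K A \<sigma> x2 out, folded r_def \<rho>_def]
        have P: "body_in \<rho> P" by (rule props(1))
        have K\<rho>: "body_in \<rho> K" using K \<rho>R by (auto simp: body_in_def)
        define D where "D = L2_set (\<lambda>i. support_fun P (u i) - support_fun K (u i)) {1..k} / sqrt (real k)"
        have D0: "0 \<le> D" by (simp add: D_def L2_set_nonneg)
        have "D + \<rho> * real k powr (- 1 / real d) \<le> (3 * C0 + 1) * lsq_rate d \<sigma> \<rho> (real k)"
          using C0(2)[OF good \<sigma>(1) \<rho>(1) P K\<rho> _ k3 \<theta>(1-3) props(2)] \<theta>(4) unit unfolding D_def by force
        also have "\<dots> \<le> (3 * C0 + 1) * (r * F)"
          unfolding \<rho>_def F_def using C0(1) k \<sigma> R r1 by (intro mult_left_mono lsq_rate_scale) auto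
        finally have sum: "D + \<rho> * real k powr (- 1 / real d) \<le> c2 * F" by (simp add: c2_def mult.assoc)
        have q0: "0 \<le> \<rho> * real k powr (- 1 / real d)" using \<rho> by simp
        have D: "D \<le> c2 * F" and q: "\<rho> * real k powr (- 1 / real d) \<le> c2 * F" using sum D0 q0 by linarith+
        have "l2_dist P K \<le> w * (D + 2 * \<rho> * mesh k)"
          unfolding w_def D_def by (rule l2_dist_le_empirical[OF k _ P K\<rho> \<rho>(1)]) (use m in simp)
        also have "\<dots> = w * (D + 2 * c * (\<rho> * real k powr (- 1 / real d)))" by (simp add: mesh_def mult_ac)
        also have "\<dots> \<le> w * (c2 * F + 2 * c * (c2 * F))"
          using w c1 D q by (intro mult_left_mono add_mono) auto
        also have "\<dots> = (w * (1 + 2 * c) * c2) * F" by (simp add: algebra_simps)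
        also have "\<dots> \<le> C * F" using Cs F0 unfolding C_def by (intro mult_right_mono) auto
        finally show "l2_dist K P \<le> C * lsq_rate d \<sigma> R (real k)"
          unfolding F_def by (simp add: l2_dist_commute[of K P])
        show "hausdorff_dist K P \<le> (C * R ^ d * (lsq_rate d \<sigma> R (real k))\<^sup>2) powr (1 / (real d + 2))"
          unfolding hausdorff_dist_def
        proof (rule cSUP_least)
          fix v :: 'a assume "v \<in> sphere 0 1"
          then have v: "norm v = 1" by simp
          define E where "E = \<bar>support_fun P v - support_fun K v\<bar>"
          have "E ^ (d + 2) \<le> c3 * \<rho> ^ d * (c2 * F)\<^sup>2"
            unfolding E_def c3_def by (rule support_diff_power_le[OF k P K\<rho> \<rho>(1) v D[unfolded D_def] q])
          also have "\<dots> = (c3 * r ^ d * c2\<^sup>2) * (R ^ d * F\<^sup>2)" by (simp add: \<rho>_def power_mult_distrib)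
          also have "\<dots> \<le> C * (R ^ d * F\<^sup>2)" using Cs R unfolding C_def by (intro mult_right_mono) auto
          finally have "E ^ (d + 2) \<le> C * R ^ d * F\<^sup>2" by (simp add: mult.assoc)
          then have "(E ^ (d + 2)) powr (1 / (real d + 2)) \<le> (C * R ^ d * F\<^sup>2) powr (1 / (real d + 2))"
            by (intro powr_mono2) (auto simp: E_def)
          moreover have "(E ^ (d + 2)) powr (1 / (real d + 2)) = E"
          proof (cases "E = 0")
            case False
            then have "0 < E" by (simp add: E_def)
            then have "(E powr (real d + 2)) powr (1 / (real d + 2)) = E" by (simp add: powr_powr)
            moreover have "E powr (real d + 2) = E ^ (d + 2)"
              using powr_realpow[OF \<open>0 < E\<close>, of "d + 2"] by (simp only: of_nat_add of_nat_numeral)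
            ultimately show ?thesis by simp
          qed simp
          ultimately show "\<bar>support_fun K v - support_fun P v\<bar> \<le> (C * R ^ d * (lsq_rate d \<sigma> R (real k))\<^sup>2) powr (1 / (real d + 2))"
            unfolding E_def F_def by (simp add: abs_minus_commute)
        qed simp
      qed
    qed
  qed (use B a d1 net in auto)
qed

end

text \<open>The exponents of the Hausdorff bounds arise from those of the \<open>L\<^sub>2\<close> rate through the interpolation
  \<open>R powr (d / (n + 1)) * rate powr (2 / (n + 1))\<close>.\<close>

lemma hausdorff_rate:
  assumes C: "0 < C" and \<sigma>: "0 < \<sigma>" and R: "0 < R" and k: "1 \<le> k" and d: "1 \<le> d" and n: "n = d + 1"
  shows "(C * R ^ d * (lsq_rate d \<sigma> R (real k))\<^sup>2) powr (1 / (real d + 2)) \<le>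
    (if n \<le> 4 then
       C powr (1 / (real d + 2)) * \<sigma> powr (8 / ((real n + 1) * (real n + 3)))
          * R powr ((real n - 1) * (real n + 5) / ((real n + 1) * (real n + 3)))
          * real k powr (- 4 / ((real n + 1) * (real n + 3)))
     else if n = 5 then
       C powr (1 / (real d + 2)) * \<sigma> powr (1 / 3) * R powr (2 / 3) * real k powr (- 1 / 12) * ln (real k) powr (1 / 3)
     else
       C powr (1 / (real d + 2)) * (R + \<sigma> powr (1 / (real n + 1)) * R powr (real n / (real n + 1)))
          * real k powr (- 2 / ((real n)\<^sup>2 - 1)))"
proof -
  let ?e = "1 / (real d + 2)"
  let ?F = "lsq_rate d \<sigma> R (real k)"
  have F0: "0 \<le> ?F" by (rule lsq_rate_nonneg) (use assms in auto)
  have "(?F\<^sup>2) powr ?e = ?F powr (2 * ?e)"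
  proof (cases "?F = 0")
    case False
    then have "0 < ?F" using F0 by simp
    then have "?F\<^sup>2 = ?F powr 2" using powr_realpow[of ?F 2] by simp
    then show ?thesis by (simp only: powr_powr)
  qed simp
  then have eq: "(C * R ^ d * ?F\<^sup>2) powr ?e = C powr ?e * R powr (real d * ?e) * ?F powr (2 * ?e)"
    using C R by (simp add: powr_mult powr_realpow[symmetric] powr_powr)
  consider "d \<le> 3" | "d = 4" | "5 \<le> d" by linarith
  then show ?thesis
  proof cases
    case 1
    have "?F powr (2 * ?e) = \<sigma> powr (4 / (real d + 4) * (2 * ?e)) * R powr (real d / (real d + 4) * (2 * ?e))
        * real k powr (- 2 / (real d + 4) * (2 * ?e))"
      using 1 by (simp add: lsq_rate_def powr_mult powr_powr)
    then have "(C * R ^ d * ?F\<^sup>2) powr ?e = C powr ?e * \<sigma> powr (4 / (real d + 4) * (2 * ?e))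
        * (R powr (real d * ?e) * R powr (real d / (real d + 4) * (2 * ?e)))
        * real k powr (- 2 / (real d + 4) * (2 * ?e))"
      unfolding eq by (simp only: mult_ac)
    also have "R powr (real d * ?e) * R powr (real d / (real d + 4) * (2 * ?e))
        = R powr (real d * ?e + real d / (real d + 4) * (2 * ?e))" by (simp only: powr_add)
    also have "real d * ?e + real d / (real d + 4) * (2 * ?e)
        = (real n - 1) * (real n + 5) / ((real n + 1) * (real n + 3))"
      unfolding n by (simp add: divide_simps) (simp add: algebra_simps)
    also have "4 / (real d + 4) * (2 * ?e) = 8 / ((real n + 1) * (real n + 3))"
      unfolding n by (simp add: divide_simps) (simp add: algebra_simps)
    also have "- 2 / (real d + 4) * (2 * ?e) = - 4 / ((real n + 1) * (real n + 3))"
      unfolding n by (simp add: divide_simps) (simp add: algebra_simps)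
    finally show ?thesis using 1 n by simp
  next
    case 2
    have "?F powr (2 * ?e) = \<sigma> powr (1 / 3) * real k powr (- 1 / 12) * ln (real k) powr (1 / 3)"
      using 2 k by (simp add: lsq_rate_def powr_mult powr_powr)
    then show ?thesis unfolding eq using 2 n by simp
  next
    case 3
    have "?F powr (2 * ?e) = R powr (2 * ?e) * real k powr (- 1 / real d * (2 * ?e))"
      using 3 by (simp add: lsq_rate_def powr_mult powr_powr)
    then have "(C * R ^ d * ?F\<^sup>2) powr ?e
        = C powr ?e * (R powr (real d * ?e) * R powr (2 * ?e)) * real k powr (- 1 / real d * (2 * ?e))"
      unfolding eq by (simp only: mult_ac)
    also have "R powr (real d * ?e) * R powr (2 * ?e) = R powr (real d * ?e + 2 * ?e)" by (simp only: powr_add)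
    also have "real d * ?e + 2 * ?e = 1" by (simp add: divide_simps)
    also have "- 1 / real d * (2 * ?e) = - 2 / ((real n)\<^sup>2 - 1)"
    proof -
      have "(real n)\<^sup>2 - 1 = real d * (real d + 2)" unfolding n by (simp add: power2_eq_square algebra_simps)
      then show ?thesis by simp
    qed
    also have "C powr ?e * R powr 1 * real k powr (- 2 / ((real n)\<^sup>2 - 1))
        \<le> C powr ?e * (R + \<sigma> powr (1 / (real n + 1)) * R powr (real n / (real n + 1)))
          * real k powr (- 2 / ((real n)\<^sup>2 - 1))"
      using R C by (intro mult_right_mono mult_left_mono) auto
    finally show ?thesis using 3 n by simp
  qed
qed

lemma l2_rate:
  assumes C: "0 < C" and \<sigma>: "0 < \<sigma>" and R: "0 < R" and k: "1 \<le> k" and d: "1 \<le> d" and n: "n = d + 1"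
  shows "C * lsq_rate d \<sigma> R (real k) \<le>
    (if n \<le> 4 then
       C * \<sigma> powr (4 / (real n + 3)) * R powr ((real n - 1) / (real n + 3)) * real k powr (- 2 / (real n + 3))
     else if n = 5 then C * \<sigma> * real k powr (- 1 / 4) * ln (real k)
     else C * (R + (\<sigma> * R) powr (1 / 2)) * real k powr (- 1 / (real n - 1)))"
proof -
  have "C * R * real k powr (- 1 / real d) \<le> C * (R + (\<sigma> * R) powr (1 / 2)) * real k powr (- 1 / real d)"
    using C R by (intro mult_right_mono mult_left_mono) auto
  moreover have "4 + real d = real d + 4" by simp
  ultimately show ?thesis using n by (auto simp: lsq_rate_def mult.assoc add_ac)
qed

theorem theorem6p2:
  fixes n :: nat and u :: "nat \<Rightarrow> real ^ 'n" and c :: real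
  assumes n_def: "n = CARD('n)"
    and n_ge_2: "2 \<le> n"
    and u_sphere: "\<forall>i\<ge>1. u i \<in> sphere 0 1"
    and u_spread: "\<forall>k\<ge>1. spread u k \<le> c * real k powr (- 1 / (real n - 1))"
  shows
    "(\<exists>C4::real. \<forall>\<sigma> R. 0 < \<sigma> \<and> 2 powr (15/2) * \<sigma> \<le> R \<longrightarrow>
       (\<exists>N4 :: (nat \<Rightarrow> real) \<Rightarrow> nat.
         \<forall>K A (M :: 'w measure) X.
           convex_body K \<and> K \<subseteq> cball 0 R \<and> (A = UNIV \<or> A = {0..} \<and> 0 \<in> K) \<and> normal_noise M \<sigma> X \<longrightarrow>
           (AE \<omega> in M. \<forall>k \<ge> N4 (\<lambda>i. X i \<omega>). \<forall>P.
              noisy_support_lsq_output A k u (\<lambda>i. support_fun K (u i) + X i \<omega>) P \<longrightarrow>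
              l2_dist K P \<le>
                (if n \<le> 4 then
                   C4 * \<sigma> powr (4 / (real n + 3)) * R powr ((real n - 1) / (real n + 3))
                      * real k powr (- 2 / (real n + 3))
                 else if n = 5 then
                   C4 * \<sigma> * real k powr (- 1 / 4) * ln (real k)
                 else
                   C4 * (R + (\<sigma> * R) powr (1 / 2)) * real k powr (- 1 / (real n - 1))))))
     \<and>
     (\<exists>C5::real. \<forall>\<sigma> R. 0 < \<sigma> \<and> 2 powr (15/2) * \<sigma> \<le> R \<longrightarrow>
       (\<exists>N5 :: (nat \<Rightarrow> real) \<Rightarrow> nat.
         \<forall>K A (M :: 'w measure) X.
           convex_body K \<and> K \<subseteq> cball 0 R \<and> (A = UNIV \<or> A = {0..} \<and> 0 \<in> K) \<and> normal_noise M \<sigma> X \<longrightarrow>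
           (AE \<omega> in M. \<forall>k \<ge> N5 (\<lambda>i. X i \<omega>). \<forall>P.
              noisy_support_lsq_output A k u (\<lambda>i. support_fun K (u i) + X i \<omega>) P \<longrightarrow>
              hausdorff_dist K P \<le>
                (if n \<le> 4 then
                   C5 * \<sigma> powr (8 / ((real n + 1) * (real n + 3)))
                      * R powr ((real n - 1) * (real n + 5) / ((real n + 1) * (real n + 3)))
                      * real k powr (- 4 / ((real n + 1) * (real n + 3)))
                 else if n = 5 then
                   C5 * \<sigma> powr (1 / 3) * R powr (2 / 3) * real k powr (- 1 / 12) * ln (real k) powr (1 / 3)
                 else
                   C5 * (R + \<sigma> powr (1 / (real n + 1)) * R powr (real n / (real n + 1)))
                      * real k powr (- 2 / ((real n)\<^sup>2 - 1))))))"
proof -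
  define d where "d = n - 1"
  have d1: "1 \<le> d" and n: "n = d + 1" using n_ge_2 by (auto simp: d_def)
  have rd: "real n - 1 = real d" using n by simp
  interpret dense_directions u "max c 1" d
  proof
    show "DIM(real ^ 'n) = d + 1" using n n_def by simp
    show "norm (u i) = 1" if "1 \<le> i" for i using u_sphere that by auto
    show "spread u k \<le> max c 1 * real k powr (- 1 / real d)" if "1 \<le> k" for k
    proof -
      have "spread u k \<le> c * real k powr (- 1 / real d)" using u_spread that unfolding rd by blast
      also have "\<dots> \<le> max c 1 * real k powr (- 1 / real d)" by (intro mult_right_mono) auto
      finally show ?thesis .
    qed
  qed (use d1 in auto)
  have dim2: "2 \<le> DIM(real ^ 'n)" using n_ge_2 n_def by simp
  obtain B :: real and T :: "nat \<Rightarrow> (real ^ 'n) set set" where B: "0 \<le> B"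
    and T: "\<And>j. finite (T j)" "\<And>j. real (card (T j)) \<le> exp (B * 2 ^ (j * (DIM(real ^ 'n) - 1)))"
    and net: "\<And>j K. body_in 1 K \<Longrightarrow> \<exists>L\<in>T j. \<forall>v. norm v = 1 \<longrightarrow>
        \<bar>support_fun K v - support_fun L v\<bar> \<le> (real DIM(real ^ 'n) + 2) / 4 ^ j"
    by (rule convex_body_entropy[OF dim2]) blast
  have a0: "0 \<le> real DIM(real ^ 'n) + 2" by simp
  obtain C :: real where C: "0 < C" and est: "\<And>\<sigma> R. 0 < \<sigma> \<Longrightarrow> \<sigma> \<le> R \<Longrightarrow> \<exists>N. \<forall>k\<ge>N. 1 \<le> k \<and> (\<forall>x K A P.
       noise_good T B u \<sigma> k x \<and> body_in R K \<and> (A = UNIV \<or> A = {0..} \<and> 0 \<in> K) \<and>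
       noisy_support_lsq_output A k u (\<lambda>i. support_fun K (u i) + x i) P \<longrightarrow>
       l2_dist K P \<le> C * lsq_rate d \<sigma> R (real k) \<and>
       hausdorff_dist K P \<le> (C * R ^ d * (lsq_rate d \<sigma> R (real k))\<^sup>2) powr (1 / (real d + 2)))"
    using lsq_estimate[OF B a0 net] by blast
  have uniform: "\<exists>N :: (nat \<Rightarrow> real) \<Rightarrow> nat. \<forall>K (A :: real set) (M :: 'w measure) X.
      convex_body K \<and> K \<subseteq> cball 0 R \<and> (A = UNIV \<or> A = {0..} \<and> 0 \<in> K) \<and> normal_noise M \<sigma> X \<longrightarrow>
      (AE \<omega> in M. \<forall>k \<ge> N (\<lambda>i. X i \<omega>). \<forall>P.
        noisy_support_lsq_output A k u (\<lambda>i. support_fun K (u i) + X i \<omega>) P \<longrightarrow>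
        1 \<le> k \<and> l2_dist K P \<le> C * lsq_rate d \<sigma> R (real k) \<and>
        hausdorff_dist K P \<le> (C * R ^ d * (lsq_rate d \<sigma> R (real k))\<^sup>2) powr (1 / (real d + 2)))"
    if \<sigma>: "0 < \<sigma>" "\<sigma> \<le> R" for \<sigma> R
  proof -
    obtain N0 where N0: "\<And>k x K A P. N0 \<le> k \<Longrightarrow> 1 \<le> k \<and> (
       noise_good T B u \<sigma> k x \<and> body_in R K \<and> (A = UNIV \<or> A = {0..} \<and> 0 \<in> K) \<and>
       noisy_support_lsq_output A k u (\<lambda>i. support_fun K (u i) + x i) P \<longrightarrow>
       l2_dist K P \<le> C * lsq_rate d \<sigma> R (real k) \<and>
       hausdorff_dist K P \<le> (C * R ^ d * (lsq_rate d \<sigma> R (real k))\<^sup>2) powr (1 / (real d + 2)))"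
      using est[OF \<sigma>] by blast
    \<comment> \<open>For noise that is never eventually good the choice is arbitrary; this has probability zero.\<close>
    define N where "N = (\<lambda>x. max N0 (SOME N. \<forall>k\<ge>N. noise_good T B u \<sigma> k x))"
    show ?thesis
    proof (intro exI[of _ N] allI impI, elim conjE)
      fix K :: "(real ^ 'n) set" and A :: "real set" and M :: "'w measure" and X :: "nat \<Rightarrow> 'w \<Rightarrow> real"
      assume K: "convex_body K" "K \<subseteq> cball 0 R" and A: "A = UNIV \<or> A = {0..} \<and> 0 \<in> K"
        and noise: "normal_noise M \<sigma> X"
      have bK: "body_in R K" using K unfolding convex_body_def body_in_def by auto
      have "AE \<omega> in M. \<exists>N. \<forall>k\<ge>N. noise_good T B u \<sigma> k (\<lambda>i. X i \<omega>)"
        by (rule AE_eventually_noise_good[OF noise \<sigma>(1) B T])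
      then show "AE \<omega> in M. \<forall>k \<ge> N (\<lambda>i. X i \<omega>). \<forall>P.
        noisy_support_lsq_output A k u (\<lambda>i. support_fun K (u i) + X i \<omega>) P \<longrightarrow>
        1 \<le> k \<and> l2_dist K P \<le> C * lsq_rate d \<sigma> R (real k) \<and>
        hausdorff_dist K P \<le> (C * R ^ d * (lsq_rate d \<sigma> R (real k))\<^sup>2) powr (1 / (real d + 2))"
      proof (rule AE_mp, intro AE_I2 impI allI)
        fix \<omega> k P
        assume ex: "\<exists>N. \<forall>k\<ge>N. noise_good T B u \<sigma> k (\<lambda>i. X i \<omega>)" and k: "N (\<lambda>i. X i \<omega>) \<le> k"
          and out: "noisy_support_lsq_output A k u (\<lambda>i. support_fun K (u i) + X i \<omega>) P"
        have "\<forall>k\<ge>SOME N. \<forall>k\<ge>N. noise_good T B u \<sigma> k (\<lambda>i. X i \<omega>). noise_good T B u \<sigma> k (\<lambda>i. X i \<omega>)"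
          using ex by (rule someI_ex)
        then have good: "noise_good T B u \<sigma> k (\<lambda>i. X i \<omega>)" using k by (simp add: N_def)
        show "1 \<le> k \<and> l2_dist K P \<le> C * lsq_rate d \<sigma> R (real k) \<and>
          hausdorff_dist K P \<le> (C * R ^ d * (lsq_rate d \<sigma> R (real k))\<^sup>2) powr (1 / (real d + 2))"
          using N0[of k "\<lambda>i. X i \<omega>" K A P] k good bK A out by (simp add: N_def)
      qed
    qed
  qed
  have large: "\<sigma> \<le> R" if "0 < \<sigma>" "2 powr (15/2) * \<sigma> \<le> R" for \<sigma> R :: real
  proof -
    have "1 * \<sigma> \<le> 2 powr (15/2) * \<sigma>" using that(1) by (intro mult_right_mono ge_one_powr_ge_zero) auto
    then show ?thesis using that(2) by simp
  qed
  show ?thesis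
  proof (rule conjI, goal_cases)
    case 1
    show ?case
    proof (rule exI[of _ C], intro allI impI, goal_cases)
      case (1 \<sigma> R)
      then have \<sigma>: "0 < \<sigma>" "\<sigma> \<le> R" and R: "0 < R" using large[of \<sigma> R] by auto
      obtain N where N: "\<And>K (A :: real set) (M :: 'w measure) X.
        convex_body K \<and> K \<subseteq> cball 0 R \<and> (A = UNIV \<or> A = {0..} \<and> 0 \<in> K) \<and> normal_noise M \<sigma> X \<Longrightarrow>
        (AE \<omega> in M. \<forall>k \<ge> N (\<lambda>i. X i \<omega>). \<forall>P.
          noisy_support_lsq_output A k u (\<lambda>i. support_fun K (u i) + X i \<omega>) P \<longrightarrow>
          1 \<le> k \<and> l2_dist K P \<le> C * lsq_rate d \<sigma> R (real k) \<and>
          hausdorff_dist K P \<le> (C * R ^ d * (lsq_rate d \<sigma> R (real k))\<^sup>2) powr (1 / (real d + 2)))"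
        using uniform[OF \<sigma>] by blast
      show ?case
      proof (intro exI[of _ N] allI impI, goal_cases)
        case (1 K A M X)
        show ?case
        proof (rule AE_mp[OF N[OF 1]], intro AE_I2 impI allI, goal_cases)
          case (1 \<omega> k P)
          have k: "1 \<le> k" and le: "l2_dist K P \<le> C * lsq_rate d \<sigma> R (real k)"
            using 1(2)[rule_format, OF 1(3,4)] by simp_all
          show ?case by (rule order_trans[OF le l2_rate[OF C \<sigma>(1) R k d1 n]])
        qed
      qed
    qed
  next
    case 2
    show ?case
    proof (rule exI[of _ "C powr (1 / (real d + 2))"], intro allI impI, goal_cases)
      case (1 \<sigma> R)
      then have \<sigma>: "0 < \<sigma>" "\<sigma> \<le> R" and R: "0 < R" using large[of \<sigma> R] by auto
      obtain N where N: "\<And>K (A :: real set) (M :: 'w measure) X.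
        convex_body K \<and> K \<subseteq> cball 0 R \<and> (A = UNIV \<or> A = {0..} \<and> 0 \<in> K) \<and> normal_noise M \<sigma> X \<Longrightarrow>
        (AE \<omega> in M. \<forall>k \<ge> N (\<lambda>i. X i \<omega>). \<forall>P.
          noisy_support_lsq_output A k u (\<lambda>i. support_fun K (u i) + X i \<omega>) P \<longrightarrow>
          1 \<le> k \<and> l2_dist K P \<le> C * lsq_rate d \<sigma> R (real k) \<and>
          hausdorff_dist K P \<le> (C * R ^ d * (lsq_rate d \<sigma> R (real k))\<^sup>2) powr (1 / (real d + 2)))"
        using uniform[OF \<sigma>] by blast
      show ?case
      proof (intro exI[of _ N] allI impI, goal_cases)
        case (1 K A M X)
        show ?case
        proof (rule AE_mp[OF N[OF 1]], intro AE_I2 impI allI, goal_cases)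
          case (1 \<omega> k P)
          have k: "1 \<le> k" and le: "hausdorff_dist K P
            \<le> (C * R ^ d * (lsq_rate d \<sigma> R (real k))\<^sup>2) powr (1 / (real d + 2))"
            using 1(2)[rule_format, OF 1(3,4)] by simp_all
          show ?case by (rule order_trans[OF le hausdorff_rate[OF C \<sigma>(1) R k d1 n]])
        qed
      qed
    qed
  qed
qed

end
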